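(* Let $\Omega$ be a doubly periodic domain with periodic cell $\varpi$, satisfying assumption $(\mathcal{A})$ (both as defined in the context). The Floquet transform $\mathsf{F}$ is a unitary operator from $A^2(\Omega)$ onto $L^2(\mathbf{Q};A^2_\eta(\varpi))$, with inverse $\mathsf{F}^{-1}: L^2(\mathbf{Q};A^2_\eta(\varpi))\to A^2(\Omega)$ given by $$\mathsf{F}^{-1}g(z)=\frac1{2\pi}\int_{\mathbf{Q}} e^{i[\mathrm{Re}\,z]\eta_1+i[\mathrm{Im}\,z]\eta_2}\, g\big(z-[\mathrm{Re}\,z]-i[\mathrm{Im}\,z],\eta\big)\,d\eta,\qquad z\in\Omega .$$
   Context: Notation: $\Lambda=\{m\in\mathbb{C}: \mathrm{Re}\,m\in\mathbb{Z},\ \mathrm{Im}\,m\in\mathbb{Z}\}$; for $m\in\Lambda$ write $m_1=\mathrm{Re}\,m$, $m_2=\mathrm{Im}\,m$. $[x]$ is the largest integer not larger than $x\in\mathbb{R}$. $Q=(0,1)\times(0,1)\subset\mathbb{R}^2\cong\mathbb{C}$; $\mathbf{Q}=[-\pi,\pi]^2$, with elements $\eta=(\eta_1,\eta_2)$. $\mathrm{cl}$ denotes closure. $L^2(D)$ is with respect to area measure $dA$, and $A^2(D)$ is the closed subspace of $L^2(D)$ consisting of analytic functions. Doubly periodic domain: the periodic cell $\varpi$ is a domain in $\mathbb{C}$ such that (i) $\varpi\subset Q$; (ii) $\partial\varpi\supset\partial Q$; (iii) $Q\setminus\mathrm{cl}(\varpi)$ contains a nonempty open set. Put $\varpi_m=\varpi+m$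 for $m\in\Lambda$. The doubly periodic domain $\Omega$ is the interior of $\bigcup_{m\in\Lambda}\mathrm{cl}(\varpi_m)$. Assumption $(\mathcal{A})$: there is an elliptic function $\varphi$ (meromorphic in $\mathbb{C}$ with $\varphi(z)=\varphi(z+1)=\varphi(z+i)$) all of whose zeros lie in $\mathbb{C}\setminus\mathrm{cl}(\Omega)$, and which has a representation $\varphi(z)=\sum_{m\in\Lambda}\phi(z-m)$ for some function $\phi$ meromorphic in $\mathbb{C}$ with only finitely many poles, all situated in $Q$, and such that $\sup_{z\in\Omega\setminus\mathrm{cl}(Q)}(1+|z|)^b|\phi(z)|<\infty$ for some constant $b>2$. Floquet transform: for $f$ on $\Omega$, $$\mathsf{F}f(z,\eta)=\frac1{2\pi}\sum_{m\in\Lambda}e^{-i\eta_1m_1-i\eta_2m_2}f(z+m),\quad z\in\varpi,\ \eta\in\mathbf{Q},$$ regarded as an isometric operator from $L^2(\Omega)$ onto the Bochner space $L^2(\mathbf{Q};L^2(\varpi))$. For $\eta\in\mathbf{Q}$, $A^2_{\eta,\mathrm{ext}}(\varpi)$ is the subspace of $A^2(\varpi)$ consisting of functions $f$ which can be extended as analytic functions to a neighborhood of $\mathrm{cl}(\varpi)\cap\Omega$ in $\Omega$ and satisfy $f(1+iy)=e^{i\eta_1}f(iy)$ and $f(x+i)=e^{i\eta_2}f(x)$ for all $x,y\in(0,1)$. $A^2_\eta(\varpi)$ is the closure of $A^2_{\eta,\mathrm{ext}}(\varpi)$ in $A^2(\varpi)$. $L^2(\mathbf{Q};A^2_\eta(\varpi))$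 is the subspace of $L^2(\mathbf{Q};A^2(\varpi))$ of functions $f$ such that $z\mapsto f(z,\eta)$ belongs to $A^2_\eta(\varpi)$ for a.e. $\eta\in\mathbf{Q}$.
   Formalization: Assumes in addition that Ω minus the union of the cells ϖ_m has area zero; without this (e.g. a cell with a totally disconnected compact set of positive area removed) F ignores part of the L²(Ω) norm and is not isometric. *)

theory Defs
  imports "HOL-Complex_Analysis.Complex_Analysis"
begin

section \<open>Doubly periodic domains\<close>

definition gauss_lattice :: "complex set" where
  "gauss_lattice = {m. Re m \<in> \<int> \<and> Im m \<in> \<int>}"

definition unit_square :: "complex set" where
  "unit_square = {z. 0 < Re z \<and> Re z < 1 \<and> 0 < Im z \<and> Im z < 1}"

definition quasimomenta :: "(real \<times> real) set" where
  "quasimomenta = {-pi..pi} \<times> {-pi..pi}"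

definition periodic_cell :: "complex set \<Rightarrow> bool" where
  "periodic_cell \<omega> \<longleftrightarrow>
     open \<omega> \<and> connected \<omega> \<and> \<omega> \<noteq> {} \<and>
     \<omega> \<subseteq> unit_square \<and>
     frontier unit_square \<subseteq> frontier \<omega> \<and>
     (\<exists>U. open U \<and> U \<noteq> {} \<and> U \<subseteq> unit_square - closure \<omega>)"

definition translated_cell :: "complex set \<Rightarrow> complex \<Rightarrow> complex set" where
  "translated_cell \<omega> m = (\<lambda>z. z + m) ` \<omega>"

definition periodic_domain :: "complex set \<Rightarrow> complex set" where
  "periodic_domain \<omega> = interior (\<Union>m\<in>gauss_lattice. closure (translated_cell \<omega> m))"

text \<open>
  Meromorphic functions are total functions here; \<^const>\<open>nicely_meromorphic_on\<close> fixes the value at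
  a pole to be \<open>0\<close> and makes the function analytic everywhere else. A zero is therefore a point
  that is not a pole and at which the value is \<open>0\<close>. The series representation is required at
  every point at which no summand has a pole.
\<close>

definition elliptic_function :: "(complex \<Rightarrow> complex) \<Rightarrow> bool" where
  "elliptic_function \<phi> \<longleftrightarrow>
     \<phi> nicely_meromorphic_on UNIV \<and> (\<forall>z. \<phi> (z + 1) = \<phi> z \<and> \<phi> (z + \<i>) = \<phi> z)"

definition assumption_A :: "complex set \<Rightarrow> bool" where
  "assumption_A \<omega> \<longleftrightarrow>
     (\<exists>\<phi> \<psi>. elliptic_function \<phi> \<and>
        {z. \<not> is_pole \<phi> z \<and> \<phi> z = 0} \<subseteq> - closure (periodic_domain \<omega>) \<and>
        \<psi> nicely_meromorphic_on UNIV \<and>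
        finite {z. is_pole \<psi> z} \<and> {z. is_pole \<psi> z} \<subseteq> unit_square \<and>
        (\<forall>z. (\<forall>m\<in>gauss_lattice. \<not> is_pole \<psi> (z - m)) \<longrightarrow>
             ((\<lambda>m. \<psi> (z - m)) has_sum \<phi> z) gauss_lattice) \<and>
        (\<exists>b>2. bdd_above ((\<lambda>z. (1 + cmod z) powr b * cmod (\<psi> z)) `
                  (periodic_domain \<omega> - closure unit_square))))"


section \<open>Lebesgue and Bergman spaces\<close>

text \<open>
  Elements of \<open>L\<^sup>2\<close> spaces are represented by functions, two of them being identified if their
  difference has norm \<open>0\<close>. Elements of Bergman spaces are genuinely holomorphic on \<open>D\<close>.
  Values outside \<open>D\<close> are irrelevant.
\<close>

definition L2 :: "complex set \<Rightarrow> (complex \<Rightarrow> complex) set" where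
  "L2 D = {f. f \<in> borel_measurable (lebesgue_on D) \<and>
              integrable (lebesgue_on D) (\<lambda>z. (cmod (f z))\<^sup>2)}"

definition L2_inner :: "complex set \<Rightarrow> (complex \<Rightarrow> complex) \<Rightarrow> (complex \<Rightarrow> complex) \<Rightarrow> complex" where
  "L2_inner D f g = (LINT z|lebesgue_on D. f z * cnj (g z))"

definition L2_norm :: "complex set \<Rightarrow> (complex \<Rightarrow> complex) \<Rightarrow> real" where
  "L2_norm D f = sqrt (LINT z|lebesgue_on D. (cmod (f z))\<^sup>2)"

definition A2 :: "complex set \<Rightarrow> (complex \<Rightarrow> complex) set" where
  "A2 D = {f \<in> L2 D. f holomorphic_on D}"

text \<open>
  The function \<open>h\<close> below is the analytic extension of \<open>f\<close>; it is uniquely determined on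
  \<open>closure \<omega> \<inter> \<Omega>\<close>. The boundary conditions make sense at those points of the sides of the
  unit square which lie in \<open>\<Omega>\<close> (a lattice-periodic set).
\<close>

definition A2_eta_ext :: "complex set \<Rightarrow> real \<times> real \<Rightarrow> (complex \<Rightarrow> complex) set" where
  "A2_eta_ext \<omega> \<eta> =
     {f \<in> A2 \<omega>. \<exists>U h. open U \<and> closure \<omega> \<inter> periodic_domain \<omega> \<subseteq> U \<and> U \<subseteq> periodic_domain \<omega> \<and>
        h holomorphic_on U \<and> (\<forall>z\<in>\<omega>. h z = f z) \<and>
        (\<forall>y\<in>{0<..<1}. Complex 0 y \<in> periodic_domain \<omega> \<longrightarrow>
            h (Complex 1 y) = exp (\<i> * of_real (fst \<eta>)) * h (Complex 0 y)) \<and>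
        (\<forall>x\<in>{0<..<1}. Complex x 0 \<in> periodic_domain \<omega> \<longrightarrow>
            h (Complex x 1) = exp (\<i> * of_real (snd \<eta>)) * h (Complex x 0))}"

definition A2_eta :: "complex set \<Rightarrow> real \<times> real \<Rightarrow> (complex \<Rightarrow> complex) set" where
  "A2_eta \<omega> \<eta> = {f \<in> A2 \<omega>. \<forall>\<epsilon>>0. \<exists>h\<in>A2_eta_ext \<omega> \<eta>. L2_norm \<omega> (\<lambda>z. f z - h z) < \<epsilon>}"


section \<open>Bochner spaces over the quasimomenta\<close>

text \<open>
  \<open>Bochner_L2 D X\<close> is \<open>L\<^sup>2(\<^bold>Q; X)\<close> for a subspace \<open>X\<close> of \<open>L\<^sup>2(D)\<close>: the strongly measurable
  functions (limits almost everywhere, in the norm of \<open>L\<^sup>2(D)\<close>, of \<open>X\<close>-valued simple functions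
  \<open>s n\<close>) whose norm is square integrable.
\<close>

definition Bochner_L2 ::
    "complex set \<Rightarrow> (complex \<Rightarrow> complex) set \<Rightarrow> (complex \<times> real \<times> real \<Rightarrow> complex) set" where
  "Bochner_L2 D X =
     {g. (AE \<eta> in lebesgue_on quasimomenta. (\<lambda>z. g (z, \<eta>)) \<in> X) \<and>
         (\<exists>s :: nat \<Rightarrow> real \<times> real \<Rightarrow> complex \<Rightarrow> complex.
            (\<forall>n. finite (s n ` quasimomenta) \<and> s n ` quasimomenta \<subseteq> X \<and>
                 (\<forall>h. {\<eta> \<in> quasimomenta. s n \<eta> = h} \<in> sets lebesgue)) \<and>
            (AE \<eta> in lebesgue_on quasimomenta.
               (\<lambda>n. L2_norm D (\<lambda>z. s n \<eta> z - g (z, \<eta>))) \<longlonglongrightarrow> 0)) \<and>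
         integrable (lebesgue_on quasimomenta) (\<lambda>\<eta>. (L2_norm D (\<lambda>z. g (z, \<eta>)))\<^sup>2)}"

definition Bochner_inner ::
    "complex set \<Rightarrow> (complex \<times> real \<times> real \<Rightarrow> complex) \<Rightarrow> (complex \<times> real \<times> real \<Rightarrow> complex) \<Rightarrow> complex" where
  "Bochner_inner D g h =
     (LINT \<eta>|lebesgue_on quasimomenta. L2_inner D (\<lambda>z. g (z, \<eta>)) (\<lambda>z. h (z, \<eta>)))"

definition Bochner_norm :: "complex set \<Rightarrow> (complex \<times> real \<times> real \<Rightarrow> complex) \<Rightarrow> real" where
  "Bochner_norm D g =
     sqrt (LINT \<eta>|lebesgue_on quasimomenta. (L2_norm D (\<lambda>z. g (z, \<eta>)))\<^sup>2)"

definition Bochner_A2_eta :: "complex set \<Rightarrow> (complex \<times> real \<times> real \<Rightarrow> complex) set" where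
  "Bochner_A2_eta \<omega> =
     {g \<in> Bochner_L2 \<omega> (A2 \<omega>). AE \<eta> in lebesgue_on quasimomenta. (\<lambda>z. g (z, \<eta>)) \<in> A2_eta \<omega> \<eta>}"


section \<open>The Floquet transform\<close>

definition floquet_partial_sum ::
    "complex set \<Rightarrow> (complex \<Rightarrow> complex) \<Rightarrow> complex \<times> real \<times> real \<Rightarrow> complex" where
  "floquet_partial_sum A f = (\<lambda>(z, \<eta>1, \<eta>2). 1 / (2 * of_real pi) *
     (\<Sum>m\<in>A. exp (- \<i> * of_real \<eta>1 * of_real (Re m) - \<i> * of_real \<eta>2 * of_real (Im m)) * f (z + m)))"

text \<open>
  For \<open>f \<in> L\<^sup>2(\<Omega>)\<close> the series defining the Floquet transform converges unconditionally in
  \<open>L\<^sup>2(\<^bold>Q; L\<^sup>2(\<omega>))\<close>, not necessarily pointwise. Its sum \<open>g\<close> is determined up to norm \<open>0\<close>, so the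
  transform is written as a relation, in the style of \<^const>\<open>has_sum\<close>.
\<close>

definition has_floquet_transform ::
    "complex set \<Rightarrow> (complex \<Rightarrow> complex) \<Rightarrow> (complex \<times> real \<times> real \<Rightarrow> complex) \<Rightarrow> bool" where
  "has_floquet_transform \<omega> f g \<longleftrightarrow>
     f \<in> L2 (periodic_domain \<omega>) \<and> g \<in> Bochner_L2 \<omega> (L2 \<omega>) \<and>
     ((\<lambda>A. Bochner_norm \<omega> (\<lambda>p. floquet_partial_sum A f p - g p)) \<longlongrightarrow> 0)
       (finite_subsets_at_top gauss_lattice)"

text \<open>
  \<open>unitary_graph V ipV W ipW R\<close>: the relation \<open>R\<close> is the graph of a unitary operator from \<open>V\<close>
  onto \<open>W\<close>, where elements are identified if their difference has norm \<open>0\<close>. That \<open>R\<close> is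
  single-valued and injective up to this identification follows from the last two clauses.
\<close>

definition unitary_graph ::
    "('a \<Rightarrow> complex) set \<Rightarrow> (('a \<Rightarrow> complex) \<Rightarrow> ('a \<Rightarrow> complex) \<Rightarrow> complex) \<Rightarrow>
     ('b \<Rightarrow> complex) set \<Rightarrow> (('b \<Rightarrow> complex) \<Rightarrow> ('b \<Rightarrow> complex) \<Rightarrow> complex) \<Rightarrow>
     (('a \<Rightarrow> complex) \<Rightarrow> ('b \<Rightarrow> complex) \<Rightarrow> bool) \<Rightarrow> bool" where
  "unitary_graph V ipV W ipW R \<longleftrightarrow>
     (\<forall>f\<in>V. \<exists>g\<in>W. R f g) \<and>
     (\<forall>g\<in>W. \<exists>f\<in>V. R f g) \<and>
     (\<forall>f\<in>V. \<forall>f'\<in>V. \<forall>g\<in>W. \<forall>g'\<in>W. R f g \<longrightarrow> R f' g' \<longrightarrow>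
        (\<forall>a b. R (\<lambda>x. a * f x + b * f' x) (\<lambda>y. a * g y + b * g' y))) \<and>
     (\<forall>f\<in>V. \<forall>f'\<in>V. \<forall>g\<in>W. \<forall>g'\<in>W. R f g \<longrightarrow> R f' g' \<longrightarrow> ipW g g' = ipV f f')"

text \<open>
  For \<open>z \<in> \<Omega>\<close> the point \<open>z - \<lfloor>Re z\<rfloor> - \<i>\<lfloor>Im z\<rfloor>\<close> lies in \<open>closure \<omega> \<inter> \<Omega>\<close>, but not always in \<open>\<omega>\<close>
  (it may lie on a side of the unit square). On \<open>closure \<omega> \<inter> \<Omega> - \<omega>\<close>, elements of the space
  \<open>A2_eta \<omega> \<eta>\<close> are evaluated by continuous extension from \<open>\<omega>\<close>.
\<close>

definition cell_value :: "complex set \<Rightarrow> (complex \<Rightarrow> complex) \<Rightarrow> complex \<Rightarrow> complex" where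
  "cell_value \<omega> f w = (if w \<in> \<omega> then f w else Lim (at w within \<omega>) f)"

definition floquet_inverse ::
    "complex set \<Rightarrow> (complex \<times> real \<times> real \<Rightarrow> complex) \<Rightarrow> complex \<Rightarrow> complex" where
  "floquet_inverse \<omega> g z = 1 / (2 * of_real pi) *
     (LINT \<eta>|lebesgue_on quasimomenta.
        exp (\<i> * of_int \<lfloor>Re z\<rfloor> * of_real (fst \<eta>) + \<i> * of_int \<lfloor>Im z\<rfloor> * of_real (snd \<eta>)) *
        cell_value \<omega> (\<lambda>w. g (w, \<eta>)) (z - of_int \<lfloor>Re z\<rfloor> - \<i> * of_int \<lfloor>Im z\<rfloor>))"

end

theory Submission imports Defs begin

text \<open>
  Bergman's inequality bounds an analytic function at a point by its \<open>L\<^sup>2\<close> norm near that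
  point, and the lattice translates of the cell \<open>\<omega>\<close> fill \<open>\<Omega>\<close> up to a null
  set. So analytic functions on \<open>\<Omega>\<close> that converge in \<open>L\<^sup>2\<close> of every translated cell converge
  locally uniformly on \<open>\<Omega>\<close>, and the limit is analytic (\<open>holomorphic_limit\<close>). The proof is this
  principle combined with Fourier series in the quasimomentum.

  The principle first identifies \<open>A2_eta \<omega> \<eta>\<close>: an admissible extension of a function on the cell
  glues, by the identity theorem, to a Bloch function, that is, an analytic function \<open>H\<close> on all of
  \<open>\<Omega>\<close> with \<open>H (z + m) = phase \<eta> m * H z\<close>, and restrictions of Bloch functions are already closed
  in \<open>L\<^sup>2\<close> (\<open>A2_eta_iff\<close>). Hence \<open>cell_value\<close> evaluates the Bloch function, and the
  inversion formula reads \<open>floquet_inverse \<omega> g z = (1 / 2\<pi>) \<integral> H\<^sub>\<eta> z d\<eta>\<close>, where \<open>H\<^sub>\<eta>\<close> extends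
  \<open>g (\<cdot>, \<eta>)\<close>.

  Let \<open>f \<in> A2 \<Omega>\<close>. The functions \<open>mode m \<eta> = exp (-i \<eta>\<cdot>m) / 2\<pi>\<close> are orthonormal, so the
  partial sum over \<open>A\<close> has squared norm \<open>\<Sum>m\<in>A. \<parallel>f (\<cdot> + m)\<parallel>\<^sup>2\<close>, a piece of a convergent series.
  Translating \<open>z\<close> by \<open>k\<close> multiplies the partial sum by \<open>phase \<eta> k\<close> and shifts the index set by
  \<open>k\<close>. If index sets \<open>A\<^sub>j\<close> are chosen so that they and all their shifts exhaust the series
  geometrically fast, then for almost every \<open>\<eta>\<close> the partial sums converge on every translated
  cell, and the limit is a Bloch function. This is the transform of \<open>f\<close> (\<open>floquet_exists\<close>).

  Conversely, for \<open>g\<close> in the target space put \<open>f = floquet_inverse \<omega> g\<close>. It is analytic as a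
  dominated integral of analytic functions, and \<open>f (z + m)\<close> is a Fourier coefficient of
  \<open>g (z, \<cdot>)\<close>, so \<open>f \<in> A2 \<Omega>\<close> by Bessel's inequality. Its transform \<open>h\<close> exists by the
  previous step and has, for almost every \<open>z\<close>, the same Fourier coefficients as \<open>g\<close>; uniqueness
  of Fourier coefficients gives \<open>h = g\<close> almost everywhere (\<open>floquet_inverse_transform\<close>).

  The norm of \<open>f\<close> is the limit of the norms of its partial sums, hence the norm of the transform
  (\<open>floquet_norm\<close>); inner products follow by polarization (\<open>floquet_inner\<close>), and the pointwise
  inversion formula follows from injectivity together with Bergman's inequality
  (\<open>floquet_injective\<close>).
\<close>

section \<open>The area mean value inequality\<close>

lemma lborel_complex_eq_distr_pair:
  "(lborel :: complex measure) = distr (lborel \<Otimes>\<^sub>M lborel) borel (\<lambda>(x, y). Complex x y)"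
proof (rule lborel_eqI)
  fix l u :: complex
  assume le: "\<And>b. b \<in> Basis \<Longrightarrow> l \<bullet> b \<le> u \<bullet> b"
  have m: "(\<lambda>(x, y). Complex x y) \<in> borel_measurable (lborel \<Otimes>\<^sub>M lborel)"
    by (simp add: Complex_eq split_beta)
  have "emeasure (distr (lborel \<Otimes>\<^sub>M lborel) borel (\<lambda>(x, y). Complex x y)) (box l u)
      = emeasure (lborel \<Otimes>\<^sub>M lborel) ((\<lambda>(x, y). Complex x y) -` box l u \<inter> space (lborel \<Otimes>\<^sub>M lborel))"
    by (rule emeasure_distr[OF m]) simp
  also have "(\<lambda>(x, y). Complex x y) -` box l u \<inter> space (lborel \<Otimes>\<^sub>M lborel)
      = {Re l<..<Re u} \<times> {Im l<..<Im u}"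
    by (auto simp: in_box_complex_iff space_pair_measure)
  also have "emeasure (lborel \<Otimes>\<^sub>M lborel) \<dots> = emeasure lborel {Re l<..<Re u} * emeasure lborel {Im l<..<Im u}"
    by (rule lborel.emeasure_pair_measure_Times) auto
  also have "\<dots> = (\<Prod>b\<in>Basis. (u - l) \<bullet> b)"
    using le[of 1] le[of \<i>] by (simp add: Basis_complex_def ennreal_mult'')
  finally show "emeasure (distr (lborel \<Otimes>\<^sub>M lborel) borel (\<lambda>(x, y). Complex x y)) (box l u)
      = (\<Prod>b\<in>Basis. (u - l) \<bullet> b)" .
qed simp

lemma nn_integral_lborel_complex:
  assumes [measurable]: "u \<in> borel_measurable borel"
  shows "(\<integral>\<^sup>+w. u w \<partial>(lborel :: complex measure)) = (\<integral>\<^sup>+x. \<integral>\<^sup>+y. u (Complex x y) \<partial>lborel \<partial>lborel)"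
    and "(\<integral>\<^sup>+w. u w \<partial>(lborel :: complex measure)) = (\<integral>\<^sup>+y. \<integral>\<^sup>+x. u (Complex x y) \<partial>lborel \<partial>lborel)"
proof -
  have m[measurable]: "(\<lambda>(x, y). Complex x y) \<in> borel_measurable (lborel \<Otimes>\<^sub>M lborel)"
    by (simp add: Complex_eq split_beta)
  have "(\<integral>\<^sup>+w. u w \<partial>(lborel :: complex measure))
      = (\<integral>\<^sup>+p. u (case p of (x, y) \<Rightarrow> Complex x y) \<partial>(lborel \<Otimes>\<^sub>M lborel))"
    by (subst lborel_complex_eq_distr_pair, subst nn_integral_distr) auto
  also have "\<dots> = (\<integral>\<^sup>+x. \<integral>\<^sup>+y. u (Complex x y) \<partial>lborel \<partial>lborel)"
    by (subst lborel.nn_integral_fst[symmetric]) auto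
  finally show 1: "(\<integral>\<^sup>+w. u w \<partial>(lborel :: complex measure)) = (\<integral>\<^sup>+x. \<integral>\<^sup>+y. u (Complex x y) \<partial>lborel \<partial>lborel)" .
  have "(\<lambda>p. u (Complex (snd p) (fst p))) \<in> borel_measurable (lborel \<Otimes>\<^sub>M lborel)"
    by (simp add: Complex_eq split_beta)
  then have "(\<lambda>(y, x). u (Complex x y)) \<in> borel_measurable (lborel \<Otimes>\<^sub>M lborel)"
    by (simp add: split_beta)
  from lborel_pair.Fubini'[OF this]
  show "(\<integral>\<^sup>+w. u w \<partial>(lborel :: complex measure)) = (\<integral>\<^sup>+y. \<integral>\<^sup>+x. u (Complex x y) \<partial>lborel \<partial>lborel)"
    using 1 by simp
qed

lemma nn_integral_lborel_shift_real:
  assumes [measurable]: "v \<in> borel_measurable borel"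
  shows "(\<integral>\<^sup>+x. v (x + c) \<partial>lborel) = (\<integral>\<^sup>+x. v x \<partial>(lborel :: real measure))"
  using nn_integral_real_affine[of v 1 c] by (simp add: add.commute)

text \<open>
  After Fubini a shear is, on each line, a translation.
\<close>

lemma nn_integral_shear_real:
  assumes u[measurable]: "u \<in> borel_measurable borel"
  shows "(\<integral>\<^sup>+w. u (Complex (Re w + a * Im w) (Im w)) \<partial>lborel) = (\<integral>\<^sup>+w. u w \<partial>lborel)"
    and "(\<integral>\<^sup>+w. u (Complex (Re w) (Im w + a * Re w)) \<partial>lborel) = (\<integral>\<^sup>+w. u w \<partial>lborel)"
proof -
  have [measurable]: "(\<lambda>w. u (Complex (Re w + a * Im w) (Im w))) \<in> borel_measurable borel"
    "(\<lambda>w. u (Complex (Re w) (Im w + a * Re w))) \<in> borel_measurable borel"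
    "(\<lambda>x. u (Complex x y)) \<in> borel_measurable borel"
    "(\<lambda>y. u (Complex x y)) \<in> borel_measurable borel" for x y
    by (simp_all add: Complex_eq)
  show "(\<integral>\<^sup>+w. u (Complex (Re w + a * Im w) (Im w)) \<partial>lborel) = (\<integral>\<^sup>+w. u w \<partial>lborel)"
    using nn_integral_lborel_shift_real[of "\<lambda>x. u (Complex x _)"]
    by (subst (1 2) nn_integral_lborel_complex(2)) simp_all
  show "(\<integral>\<^sup>+w. u (Complex (Re w) (Im w + a * Re w)) \<partial>lborel) = (\<integral>\<^sup>+w. u w \<partial>lborel)"
    using nn_integral_lborel_shift_real[of "\<lambda>y. u (Complex _ y)"]
    by (subst (1 2) nn_integral_lborel_complex(1)) simp_all
qed

text \<open>
  A rotation other than by \<open>\<pi>\<close> is a product of three shears, and the rotation by \<open>\<pi>\<close> is the square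
  of a quarter turn.
\<close>

lemma nn_integral_rotate:
  assumes u[measurable]: "u \<in> borel_measurable borel" and e: "cmod e = 1"
  shows "(\<integral>\<^sup>+w. u (e * w) \<partial>lborel) = (\<integral>\<^sup>+w. u w \<partial>(lborel :: complex measure))"
proof -
  have main: "(\<integral>\<^sup>+w. u (e * w) \<partial>lborel) = (\<integral>\<^sup>+w. u w \<partial>(lborel :: complex measure))"
    if u[measurable]: "u \<in> borel_measurable borel" and e: "cmod e = 1" and ne: "e \<noteq> -1" for u e
  proof -
    define c s where "c = Re e" and "s = Im e"
    have cs: "c\<^sup>2 + s\<^sup>2 = 1"
      using e by (simp add: cmod_def c_def s_def)
    have c: "1 + c \<noteq> 0"
    proof
      assume "1 + c = 0"
      then have c1: "c = -1" by simp
      then have "s = 0" using cs by simp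
      then show False using ne c1 by (simp add: c_def s_def complex_eq_iff)
    qed
    define a where "a = - s / (1 + c)"
    have ab: "1 + a * s = c"
      using c cs by (simp add: a_def field_simps power2_eq_square)
    have "a * c + a = a * (1 + c)" by (simp add: algebra_simps)
    then have ac: "a * c + a = - s"
      using c by (simp add: a_def)
    define X where "X = (\<lambda>w. Complex (Re w + a * Im w) (Im w))"
    define Y where "Y = (\<lambda>w. Complex (Re w) (Im w + s * Re w))"
    have [measurable]: "X \<in> borel_measurable borel" "Y \<in> borel_measurable borel"
      unfolding X_def Y_def Complex_eq by measurable
    have m: "(\<lambda>w. u (X (Y w))) \<in> borel_measurable borel" "(\<lambda>w. u (X w)) \<in> borel_measurable borel"
      by measurable
    have "X (Y (X w)) = e * w" for w
    proof -
      have "Re (X (Y (X w))) = (1 + a * s) * Re w + (a * (1 + a * s) + a) * Im w"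
        "Im (X (Y (X w))) = s * Re w + (1 + a * s) * Im w"
        by (simp_all add: X_def Y_def algebra_simps)
      then show ?thesis unfolding ab ac
        by (simp add: complex_eq_iff c_def s_def)
    qed
    then have "(\<integral>\<^sup>+w. u (e * w) \<partial>lborel) = (\<integral>\<^sup>+w. u (X (Y (X w))) \<partial>lborel)"
      by simp
    also have "\<dots> = (\<integral>\<^sup>+w. u (X (Y w)) \<partial>lborel)"
      using nn_integral_shear_real(1)[OF m(1), of a] by (simp only: X_def)
    also have "\<dots> = (\<integral>\<^sup>+w. u (X w) \<partial>lborel)"
      using nn_integral_shear_real(2)[OF m(2), of s] by (simp only: Y_def)
    also have "\<dots> = (\<integral>\<^sup>+w. u w \<partial>lborel)"
      using nn_integral_shear_real(1)[OF u, of a] by (simp only: X_def)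
    finally show ?thesis .
  qed
  show ?thesis
  proof (cases "e = -1")
    case False
    then show ?thesis using main[OF u e] by simp
  next
    case True
    have "(\<integral>\<^sup>+w. u (\<i> * (\<i> * w)) \<partial>lborel) = (\<integral>\<^sup>+w. u (\<i> * w) \<partial>lborel)"
      by (rule main[of "\<lambda>w. u (\<i> * w)" \<i>]) (auto simp: complex_eq_iff)
    also have "\<dots> = (\<integral>\<^sup>+w. u w \<partial>lborel)"
      by (rule main) (auto simp: complex_eq_iff)
    finally show ?thesis using True by (simp add: mult.assoc[symmetric])
  qed
qed

lemma nn_integral_lborel_shift:
  fixes z :: complex
  assumes [measurable]: "v \<in> borel_measurable borel"
  shows "(\<integral>\<^sup>+w. v (z + w) \<partial>lborel) = (\<integral>\<^sup>+w. v w \<partial>lborel)"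
proof -
  have "(\<integral>\<^sup>+w. v w \<partial>lborel) = (\<integral>\<^sup>+w. v w \<partial>distr lborel borel ((+) z))"
    by (simp add: lborel_distr_plus)
  then show ?thesis by (subst (asm) nn_integral_distr) auto
qed

lemma mean_value_circle:
  assumes f: "f holomorphic_on cball 0 1"
  shows "ennreal (cmod (f 0)) \<le> (\<integral>\<^sup>+t\<in>{0..1}. ennreal (cmod (f (exp (2 * of_real pi * \<i> * of_real t)))) \<partial>lborel)"
proof -
  define E where "E = (\<lambda>t::real. exp (2 * of_real pi * \<i> * of_real t))"
  have E1: "cmod (E t) = 1" for t by (simp add: E_def)
  have "continuous_on (cball 0 1) f" using f holomorphic_on_imp_continuous_on by blast
  then have "((\<lambda>u. f u / (u - 0)) has_contour_integral 2 * of_real pi * \<i> * f 0) (circlepath 0 1)"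
    using holomorphic_on_subset[OF f] by (intro Cauchy_integral_circlepath) auto
  then have "((\<lambda>t. (2 * of_real pi * \<i>) * f (E t)) has_integral ((2 * of_real pi * \<i>) * f 0)) {0..1}"
    unfolding has_contour_integral_def
    by (rule has_integral_eq[rotated])
      (simp add: vector_derivative_circlepath01, simp add: circlepath E_def mult_ac)
  then have "((\<lambda>t. f (E t)) has_integral f 0) {0..1}"
    by (subst (asm) has_integral_mult_right_iff) auto
  moreover have "continuous_on {0..1} (\<lambda>t. f (E t))"
  proof (rule continuous_on_compose2[of "cball 0 1" f "{0..1}" E])
    show "continuous_on {0..1} E" unfolding E_def by (intro continuous_intros)
  qed (use f holomorphic_on_imp_continuous_on E1 in auto)
  then have si: "set_integrable lborel {0..1} (\<lambda>t. f (E t))"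
    unfolding set_integrable_def by (intro borel_integrable_compact) auto
  ultimately have "f 0 = (LINT t:{0..1}|lborel. f (E t))"
    by (metis set_borel_integral_eq_integral(2) integral_unique)
  then have "ennreal (cmod (f 0)) \<le> (\<integral>\<^sup>+t. ennreal (cmod (indicator {0..1} t *\<^sub>R f (E t))) \<partial>lborel)"
    using integral_norm_bound_ennreal[OF si[unfolded set_integrable_def]]
    by (simp add: set_lebesgue_integral_def)
  also have "\<dots> = (\<integral>\<^sup>+t\<in>{0..1}. ennreal (cmod (f (E t))) \<partial>lborel)"
    by (intro nn_integral_cong) (auto simp: indicator_def)
  finally show ?thesis by (simp add: E_def)
qed

text \<open>
  This avoids polar coordinates: for each \<open>w\<close> in the disc around \<open>0\<close> the mean value inequality holds
  on the circle through \<open>z + w\<close>; integrating it over \<open>w\<close> and exchanging the integrals leaves an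
  average over rotated copies of the disc, which all contribute the same.
\<close>

lemma area_mean_value_inequality:
  assumes f: "f holomorphic_on ball z r" and r: "r > 0"
  shows "ennreal (pi * r\<^sup>2 * cmod (f z)) \<le> (\<integral>\<^sup>+w\<in>ball z r. ennreal (cmod (f w)) \<partial>lborel)"
proof -
  define E where "E = (\<lambda>t::real. exp (2 * of_real pi * \<i> * of_real t))"
  have E1: "cmod (E t) = 1" for t by (simp add: E_def)
  define g where "g = (\<lambda>u. ennreal (cmod (indicator (ball z r) u *\<^sub>R f u)))"
  have "(\<lambda>u. indicator (ball z r) u *\<^sub>R f u) \<in> borel_measurable borel"
    using f by (intro borel_measurable_continuous_on_indicator holomorphic_on_imp_continuous_on) auto
  then have [measurable]: "g \<in> borel_measurable borel"
    unfolding g_def by measurable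
  have [measurable]: "E \<in> borel_measurable borel"
    unfolding E_def by (intro borel_measurable_continuous_onI continuous_intros)
  have circle: "ennreal (cmod (f z)) * indicator (ball 0 r) w
      \<le> (\<integral>\<^sup>+t. g (z + E t * w) * indicator {0..1} t \<partial>lborel)" for w
  proof (cases "w \<in> ball 0 r")
    case True
    have sub: "z + w * u \<in> ball z r" if "u \<in> cball 0 1" for u
    proof -
      have "cmod w * cmod u \<le> cmod w * 1" using that by (intro mult_left_mono) auto
      then show ?thesis using True by (simp add: dist_norm norm_mult)
    qed
    have "(\<lambda>u. f (z + w * u)) holomorphic_on cball 0 1"
      using sub by (intro holomorphic_on_compose_gen[of "\<lambda>u. z + w * u" "cball 0 1" f "ball z r", unfolded o_def]
          holomorphic_intros f) auto
    from mean_value_circle[OF this]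
    have "ennreal (cmod (f z)) \<le> (\<integral>\<^sup>+t\<in>{0..1}. ennreal (cmod (f (z + w * E t))) \<partial>lborel)"
      by (simp add: E_def)
    also have "\<dots> = (\<integral>\<^sup>+t. g (z + E t * w) * indicator {0..1} t \<partial>lborel)"
      using sub[of "E _"] E1 by (intro nn_integral_cong) (simp add: g_def mult.commute[of "E _"])
    finally show ?thesis using True by simp
  qed simp
  have "ennreal (pi * r\<^sup>2 * cmod (f z)) = (\<integral>\<^sup>+w. ennreal (cmod (f z)) * indicator (ball 0 r) w \<partial>(lborel :: complex measure))"
    using r by (subst nn_integral_cmult_indicator) (auto simp: emeasure_ball unit_ball_vol_2 ennreal_mult'' mult.commute)
  also have "\<dots> \<le> (\<integral>\<^sup>+w. \<integral>\<^sup>+t. g (z + E t * w) * indicator {0..1} t \<partial>lborel \<partial>lborel)"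
    by (intro nn_integral_mono circle)
  also have "\<dots> = (\<integral>\<^sup>+t. \<integral>\<^sup>+w. g (z + E t * w) * indicator {0..1} t \<partial>lborel \<partial>lborel)"
    by (rule lborel_pair.Fubini') measurable
  also have "\<dots> = (\<integral>\<^sup>+t. (\<integral>\<^sup>+w. g w \<partial>lborel) * indicator {0..1::real} t \<partial>lborel)"
  proof (intro nn_integral_cong)
    fix t :: real
    \<comment> \<open>\<open>g\<close> vanishes off the disc, so that the integral over the rotated disc is one over the plane\<close>
    have "(\<integral>\<^sup>+w. g (z + E t * w) \<partial>lborel) = (\<integral>\<^sup>+w. g w \<partial>lborel)"
      using nn_integral_rotate[OF _ E1, of "\<lambda>w. g (z + w)" t] nn_integral_lborel_shift[of g z]
      by simp
    then show "(\<integral>\<^sup>+w. g (z + E t * w) * indicator {0..1} t \<partial>lborel)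
        = (\<integral>\<^sup>+w. g w \<partial>lborel) * indicator {0..1} t"
      by (simp add: nn_integral_multc)
  qed
  also have "\<dots> = (\<integral>\<^sup>+w. g w \<partial>lborel)"
    by (subst nn_integral_cmult_indicator) auto
  also have "\<dots> = (\<integral>\<^sup>+w\<in>ball z r. ennreal (cmod (f w)) \<partial>lborel)"
    by (intro nn_integral_cong) (auto simp: g_def indicator_def)
  finally show ?thesis .
qed

section \<open>Square integrals and the Bergman inequality\<close>

text \<open>
  The squared norm is a nonnegative extended real, so that it can be computed with before
  integrability is known. Throughout, \<open>\<bar>a + b\<bar>\<^sup>2 \<le> 2 \<bar>a\<bar>\<^sup>2 + 2 \<bar>b\<bar>\<^sup>2\<close> takes the place of the
  triangle inequality for the norm.
\<close>

definition l2sq :: "'a measure \<Rightarrow> ('a \<Rightarrow> complex) \<Rightarrow> ennreal" where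
  "l2sq M G = (\<integral>\<^sup>+x. ennreal ((cmod (G x))\<^sup>2) \<partial>M)"

lemma cmod_add_power2_le: "(cmod (a + b))\<^sup>2 \<le> 2 * (cmod a)\<^sup>2 + 2 * (cmod b)\<^sup>2"
proof -
  have "(cmod (a + b))\<^sup>2 \<le> (cmod a + cmod b)\<^sup>2"
    by (intro power_mono norm_triangle_ineq) auto
  also have "\<dots> \<le> 2 * (cmod a)\<^sup>2 + 2 * (cmod b)\<^sup>2"
    using sum_squares_bound[of "cmod a" "cmod b"] by (simp add: power2_sum)
  finally show ?thesis .
qed

lemma l2sq_add_le:
  assumes [measurable]: "f \<in> borel_measurable M" "g \<in> borel_measurable M"
  shows "l2sq M (\<lambda>x. f x + g x) \<le> 2 * l2sq M f + 2 * l2sq M g"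
proof -
  have "l2sq M (\<lambda>x. f x + g x) \<le> (\<integral>\<^sup>+x. 2 * ennreal ((cmod (f x))\<^sup>2) + 2 * ennreal ((cmod (g x))\<^sup>2) \<partial>M)"
    unfolding l2sq_def
  proof (rule nn_integral_mono)
    fix x
    have "ennreal ((cmod (f x + g x))\<^sup>2) \<le> ennreal (2 * (cmod (f x))\<^sup>2 + 2 * (cmod (g x))\<^sup>2)"
      by (intro ennreal_leI cmod_add_power2_le)
    then show "ennreal ((cmod (f x + g x))\<^sup>2) \<le> 2 * ennreal ((cmod (f x))\<^sup>2) + 2 * ennreal ((cmod (g x))\<^sup>2)"
      by (simp add: ennreal_mult'')
  qed
  also have "\<dots> = 2 * l2sq M f + 2 * l2sq M g"
    unfolding l2sq_def by (simp add: nn_integral_add nn_integral_cmult)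
  finally show ?thesis .
qed

lemma l2sq_diff_le:
  assumes "f \<in> borel_measurable M" "g \<in> borel_measurable M"
  shows "l2sq M (\<lambda>x. f x - g x) \<le> 2 * l2sq M f + 2 * l2sq M g"
  using l2sq_add_le[of f M "\<lambda>x. - g x"] assms by (simp add: l2sq_def)

lemma l2sq_scale:
  assumes [measurable]: "f \<in> borel_measurable M"
  shows "l2sq M (\<lambda>x. c * f x) = ennreal ((cmod c)\<^sup>2) * l2sq M f"
  unfolding l2sq_def by (simp add: norm_mult power_mult_distrib ennreal_mult'' nn_integral_cmult)

lemma l2sq_minus_commute: "l2sq M (\<lambda>x. f x - g x) = l2sq M (\<lambda>x. g x - f x)"
  by (simp add: l2sq_def norm_minus_commute)

lemma l2sq_cong_AE:
  assumes "AE x in M. f x = g x" shows "l2sq M f = l2sq M g"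
  unfolding l2sq_def using assms by (intro nn_integral_cong_AE) auto

lemma L2_iff: "f \<in> L2 D \<longleftrightarrow> f \<in> borel_measurable (lebesgue_on D) \<and> l2sq (lebesgue_on D) f < \<infinity>"
proof -
  have "integrable (lebesgue_on D) (\<lambda>z. (cmod (f z))\<^sup>2) \<longleftrightarrow> l2sq (lebesgue_on D) f < \<infinity>"
    if [measurable]: "f \<in> borel_measurable (lebesgue_on D)"
    unfolding l2sq_def by (subst integrable_iff_bounded) auto
  then show ?thesis by (auto simp: L2_def)
qed

lemma L2_norm_eq:
  assumes [measurable]: "f \<in> borel_measurable (lebesgue_on D)"
  shows "L2_norm D f = sqrt (enn2real (l2sq (lebesgue_on D) f))"
  unfolding L2_norm_def l2sq_def by (subst integral_eq_nn_integral) auto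

lemma L2_norm_sq:
  assumes "f \<in> L2 D"
  shows "ennreal ((L2_norm D f)\<^sup>2) = l2sq (lebesgue_on D) f"
  using assms L2_norm_eq[of f D] by (simp add: L2_iff)

lemma l2sq_lebesgue_on:
  assumes "D \<in> sets lebesgue"
  shows "l2sq (lebesgue_on D) G = (\<integral>\<^sup>+z\<in>D. ennreal ((cmod (G z))\<^sup>2) \<partial>lborel)"
  using assms by (simp add: l2sq_def nn_integral_restrict_space nn_integral_completion)

lemma open_in_sets_lebesgue: "open D \<Longrightarrow> D \<in> sets lebesgue"
  by simp

lemma holomorphic_measurable_lebesgue_on:
  assumes "G holomorphic_on D" "open D"
  shows "G \<in> borel_measurable (lebesgue_on D)"
  using assms by (intro continuous_imp_measurable_on_sets_lebesgue holomorphic_on_imp_continuous_on) auto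

text \<open>
  The mean value inequality, applied to the square of the function.
\<close>

lemma bergman_ball:
  assumes G: "G holomorphic_on ball z r" and r: "r > 0"
  shows "ennreal ((cmod (G z))\<^sup>2) \<le> ennreal (1 / (pi * r\<^sup>2)) * (\<integral>\<^sup>+w\<in>ball z r. ennreal ((cmod (G w))\<^sup>2) \<partial>lborel)"
proof -
  have "(\<lambda>w. (G w)\<^sup>2) holomorphic_on ball z r" using G by (intro holomorphic_intros)
  from area_mean_value_inequality[OF this r]
  have *: "ennreal (pi * r\<^sup>2 * (cmod (G z))\<^sup>2) \<le> (\<integral>\<^sup>+w\<in>ball z r. ennreal ((cmod (G w))\<^sup>2) \<partial>lborel)"
    by (simp add: norm_power)
  have "ennreal ((cmod (G z))\<^sup>2) = ennreal (1 / (pi * r\<^sup>2)) * ennreal (pi * r\<^sup>2 * (cmod (G z))\<^sup>2)"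
    using r by (subst ennreal_mult''[symmetric]) auto
  also have "\<dots> \<le> ennreal (1 / (pi * r\<^sup>2)) * (\<integral>\<^sup>+w\<in>ball z r. ennreal ((cmod (G w))\<^sup>2) \<partial>lborel)"
    using * by (intro mult_left_mono) auto
  finally show ?thesis .
qed

lemma bergman_estimate:
  assumes D: "open D" and z: "z \<in> D"
  obtains C where "C \<ge> 0"
    "\<forall>G. G holomorphic_on D \<longrightarrow> ennreal ((cmod (G z))\<^sup>2) \<le> ennreal C * l2sq (lebesgue_on D) G"
proof -
  obtain r where r: "r > 0" "ball z r \<subseteq> D" using D z openE by blast
  have "ennreal ((cmod (G z))\<^sup>2) \<le> ennreal (1 / (pi * r\<^sup>2)) * l2sq (lebesgue_on D) G"
    if G: "G holomorphic_on D" for G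
  proof -
    have "ennreal ((cmod (G z))\<^sup>2) \<le> ennreal (1 / (pi * r\<^sup>2)) * (\<integral>\<^sup>+w\<in>ball z r. ennreal ((cmod (G w))\<^sup>2) \<partial>lborel)"
      using holomorphic_on_subset[OF G r(2)] r(1) by (rule bergman_ball)
    also have "\<dots> \<le> ennreal (1 / (pi * r\<^sup>2)) * l2sq (lebesgue_on D) G"
      using r(2) D by (auto simp: l2sq_lebesgue_on indicator_def intro!: mult_left_mono nn_integral_mono)
    finally show ?thesis .
  qed
  then show thesis using that[of "1 / (pi * r\<^sup>2)"] by simp
qed

section \<open>The lattice and the translated cells\<close>

definition cell_index :: "complex \<Rightarrow> complex" where
  "cell_index z = of_int \<lfloor>Re z\<rfloor> + \<i> * of_int \<lfloor>Im z\<rfloor>"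

lemma Re_cell_index [simp]: "Re (cell_index z) = of_int \<lfloor>Re z\<rfloor>"
  and Im_cell_index [simp]: "Im (cell_index z) = of_int \<lfloor>Im z\<rfloor>"
  by (simp_all add: cell_index_def)

lemma cell_index_in_lattice: "cell_index z \<in> gauss_lattice"
  by (simp add: gauss_lattice_def)

lemma lattice_add: "m \<in> gauss_lattice \<Longrightarrow> k \<in> gauss_lattice \<Longrightarrow> m + k \<in> gauss_lattice"
  and lattice_diff: "m \<in> gauss_lattice \<Longrightarrow> k \<in> gauss_lattice \<Longrightarrow> m - k \<in> gauss_lattice"
  and lattice_minus: "m \<in> gauss_lattice \<Longrightarrow> - m \<in> gauss_lattice"
  and lattice_0: "0 \<in> gauss_lattice" and lattice_1: "1 \<in> gauss_lattice"
  and lattice_i: "\<i> \<in> gauss_lattice"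
  by (auto simp: gauss_lattice_def)

lemmas lattice_intros = lattice_add lattice_diff lattice_minus lattice_0 lattice_1 lattice_i
  cell_index_in_lattice

lemma cell_index_add:
  assumes "k \<in> gauss_lattice"
  shows "cell_index (z + k) = cell_index z + k"
proof -
  obtain a b where "Re k = of_int a" "Im k = of_int b"
    using assms by (auto simp: gauss_lattice_def elim!: Ints_cases)
  then show ?thesis by (simp add: complex_eq_iff)
qed

lemma lattice_eq_range: "gauss_lattice = range (\<lambda>(a, b). Complex (of_int a) (of_int b))"
proof
  show "gauss_lattice \<subseteq> range (\<lambda>(a, b). Complex (of_int a) (of_int b))"
  proof
    fix m assume "m \<in> gauss_lattice"
    then obtain a b where "Re m = of_int a" "Im m = of_int b"
      by (auto simp: gauss_lattice_def elim!: Ints_cases)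
    then have "m = (\<lambda>(a, b). Complex (of_int a) (of_int b)) (a, b)" by (simp add: complex_eq_iff)
    then show "m \<in> range (\<lambda>(a, b). Complex (of_int a) (of_int b))" by blast
  qed
qed (auto simp: gauss_lattice_def)

lemma inj_lattice: "inj (\<lambda>(a :: int, b :: int). Complex (of_int a) (of_int b))"
  by (auto simp: inj_def)

lemma countable_lattice: "countable gauss_lattice"
  unfolding lattice_eq_range by simp

lemma infinite_lattice: "infinite gauss_lattice"
  unfolding lattice_eq_range finite_image_iff[OF inj_lattice]
  using infinite_UNIV_int by (simp add: finite_prod)

lemma finite_lattice_bounded: "finite {k \<in> gauss_lattice. cmod k \<le> R}"
proof -
  have "{k \<in> gauss_lattice. cmod k \<le> R} \<subseteq>
      (\<lambda>(a, b). Complex (of_int a) (of_int b)) ` ({- \<lceil>R\<rceil>..\<lceil>R\<rceil>} \<times> {- \<lceil>R\<rceil>..\<lceil>R\<rceil>})"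
  proof
    fix k assume "k \<in> {k \<in> gauss_lattice. cmod k \<le> R}"
    then obtain a b where k: "k = Complex (of_int a) (of_int b)" "cmod k \<le> R"
      by (auto simp: lattice_eq_range)
    have "\<bar>of_int a :: real\<bar> \<le> R" "\<bar>of_int b :: real\<bar> \<le> R"
      using abs_Re_le_cmod[of k] abs_Im_le_cmod[of k] k by auto
    then have "a \<in> {- \<lceil>R\<rceil>..\<lceil>R\<rceil>}" "b \<in> {- \<lceil>R\<rceil>..\<lceil>R\<rceil>}"
      by (auto; linarith)+
    then show "k \<in> (\<lambda>(a, b). Complex (of_int a) (of_int b)) ` ({- \<lceil>R\<rceil>..\<lceil>R\<rceil>} \<times> {- \<lceil>R\<rceil>..\<lceil>R\<rceil>})"
      using k by auto
  qed
  then show ?thesis by (rule finite_subset) auto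
qed

definition lattice_enum :: "nat \<Rightarrow> complex" where
  "lattice_enum = from_nat_into gauss_lattice"

lemma bij_lattice_enum: "bij_betw lattice_enum UNIV gauss_lattice"
  unfolding lattice_enum_def by (intro bij_betw_from_nat_into countable_lattice infinite_lattice)

lemma lattice_enum_in: "lattice_enum n \<in> gauss_lattice"
  using bij_lattice_enum by (auto simp: bij_betw_def)

locale cell_setting =
  fixes \<omega> :: "complex set"
  assumes cell: "periodic_cell \<omega>"
    and null: "negligible (periodic_domain \<omega> - (\<Union>m\<in>gauss_lattice. translated_cell \<omega> m))"
begin

abbreviation \<Omega> where "\<Omega> \<equiv> periodic_domain \<omega>"

lemma open_cell: "open \<omega>" and cell_subset: "\<omega> \<subseteq> unit_square"
  using cell by (auto simp: periodic_cell_def)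

lemma open_domain: "open \<Omega>" by (simp add: periodic_domain_def)

lemma mem_translated_cell: "w \<in> translated_cell \<omega> m \<longleftrightarrow> w - m \<in> \<omega>"
  by (auto simp: translated_cell_def image_iff intro!: bexI[of _ "w - m"])

lemma open_translated_cell: "open (translated_cell \<omega> m)"
  using open_translation[OF open_cell, of m] by (simp add: translated_cell_def add.commute)

lemma translated_cell_subset:
  assumes "m \<in> gauss_lattice" shows "translated_cell \<omega> m \<subseteq> \<Omega>"
  unfolding periodic_domain_def
  by (rule interior_maximal[OF _ open_translated_cell])
    (use assms closure_subset in blast)

lemma cell_add_mem: "z \<in> \<omega> \<Longrightarrow> m \<in> gauss_lattice \<Longrightarrow> z + m \<in> \<Omega>"
  using translated_cell_subset[of m] mem_translated_cell[of "z + m" m] by auto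

lemma cell_subset_domain: "\<omega> \<subseteq> \<Omega>"
  using cell_add_mem[OF _ lattice_0] by auto

lemma cell_index_cell:
  assumes "z \<in> unit_square" "k \<in> gauss_lattice"
  shows "cell_index (z + k) = k"
proof -
  have "cell_index z = 0"
    using assms(1) by (simp add: unit_square_def complex_eq_iff floor_eq_iff)
  then show ?thesis using assms(2) by (simp add: cell_index_add)
qed

lemma disjoint_translated_cells:
  assumes "m \<in> gauss_lattice" "k \<in> gauss_lattice" "m \<noteq> k"
  shows "translated_cell \<omega> m \<inter> translated_cell \<omega> k = {}"
proof -
  have "cell_index w = m" if "w \<in> translated_cell \<omega> m" "m \<in> gauss_lattice" for w m
    using cell_index_cell[of "w - m" m] that cell_subset by (auto simp: mem_translated_cell)
  then show ?thesis using assms by blast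
qed

lemma mem_closure_translated_cell: "w \<in> closure (translated_cell \<omega> m) \<longleftrightarrow> w - m \<in> closure \<omega>"
proof -
  have "closure (translated_cell \<omega> m) = (\<lambda>z. m + z) ` closure \<omega>"
    using closure_translation[of m \<omega>] by (simp add: translated_cell_def add.commute)
  then show ?thesis by (auto simp: image_iff intro!: bexI[of _ "w - m"])
qed

lemma domain_translate_aux:
  assumes k: "k \<in> gauss_lattice" and z: "z \<in> \<Omega>" shows "z + k \<in> \<Omega>"
proof -
  let ?U = "\<Union>m\<in>gauss_lattice. closure (translated_cell \<omega> m)"
  obtain e where e: "e > 0" "ball z e \<subseteq> ?U"
    using z unfolding periodic_domain_def mem_interior by blast
  have "ball (z + k) e \<subseteq> ?U"
  proof
    fix w assume "w \<in> ball (z + k) e"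
    then have "w - k \<in> ball z e" by (simp add: dist_norm algebra_simps)
    then obtain m where "m \<in> gauss_lattice" "w - k \<in> closure (translated_cell \<omega> m)"
      using e(2) by blast
    then have "m + k \<in> gauss_lattice" "w \<in> closure (translated_cell \<omega> (m + k))"
      using k by (auto simp: mem_closure_translated_cell algebra_simps intro: lattice_add)
    then show "w \<in> ?U" by blast
  qed
  then show ?thesis using e(1) unfolding periodic_domain_def mem_interior by blast
qed

lemma domain_translate [simp]:
  assumes k: "k \<in> gauss_lattice" shows "z + k \<in> \<Omega> \<longleftrightarrow> z \<in> \<Omega>"
  using domain_translate_aux[OF k, of z] domain_translate_aux[OF lattice_minus[OF k], of "z + k"] by auto

lemma domain_translate_diff [simp]:
  assumes k: "k \<in> gauss_lattice" shows "z - k \<in> \<Omega> \<longleftrightarrow> z \<in> \<Omega>"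
  using domain_translate[OF lattice_minus[OF k]] by simp

lemma closure_unit_square: "closure unit_square = {z. 0 \<le> Re z \<and> Re z \<le> 1 \<and> 0 \<le> Im z \<and> Im z \<le> 1}"
proof -
  have "unit_square = box 0 (Complex 1 1)"
    by (auto simp: unit_square_def in_box_complex_iff)
  moreover have "box 0 (Complex 1 1 :: complex) \<noteq> {}" by (simp add: box_ne_empty Basis_complex_def)
  ultimately have "closure unit_square = cbox 0 (Complex 1 1)" by (metis closure_box)
  then show ?thesis by (simp only: set_eq_iff in_cbox_complex_iff) simp
qed

text \<open>
  Near a point of \<open>\<Omega>\<close> in the closed unit square there are points of the open square, and those can
  only be covered by the closure of the untranslated cell.
\<close>

lemma domain_square_subset_closure:
  assumes w: "w \<in> \<Omega>" "w \<in> closure unit_square"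
  shows "w \<in> closure \<omega>"
proof -
  have "\<exists>y\<in>closure \<omega>. dist y w < e" if "e > 0" for e
  proof -
    let ?U = "\<Union>m\<in>gauss_lattice. closure (translated_cell \<omega> m)"
    obtain d where d: "d > 0" "ball w d \<subseteq> ?U"
      using w(1) unfolding periodic_domain_def mem_interior by blast
    have "0 < min d e" using d(1) that by simp
    then obtain y where y: "y \<in> unit_square" "dist y w < min d e"
      using w(2) unfolding closure_approachable by blast
    then have "y \<in> ball w d" by (simp add: dist_commute)
    then obtain m where m: "m \<in> gauss_lattice" "y - m \<in> closure \<omega>"
      using d(2) by (auto simp: mem_closure_translated_cell)
    then have "y - m \<in> closure unit_square" using closure_mono[OF cell_subset] by blast
    then have "\<bar>Re m\<bar> < 1" "\<bar>Im m\<bar> < 1"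
      using y(1) unfolding closure_unit_square by (auto simp: unit_square_def)
    then have "m = 0" using m(1) by (auto simp: gauss_lattice_def complex_eq_iff elim!: Ints_cases)
    then show ?thesis using m(2) y(2) by auto
  qed
  then have "w \<in> closure (closure \<omega>)" unfolding closure_approachable[of w "closure \<omega>"] by blast
  then show ?thesis by simp
qed

lemma diff_cell_index_mem:
  assumes "z \<in> \<Omega>"
  shows "z - cell_index z \<in> \<Omega>" "z - cell_index z \<in> closure \<omega>"
proof -
  show 1: "z - cell_index z \<in> \<Omega>" using assms by (simp add: cell_index_in_lattice)
  have "z - cell_index z \<in> closure unit_square"
    unfolding closure_unit_square by (auto simp: floor_le_iff le_diff_eq diff_le_eq; linarith)
  then show "z - cell_index z \<in> closure \<omega>" using 1 domain_square_subset_closure by blast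
qed

text \<open>
  This is where the null-set hypothesis enters: integrals over \<open>\<Omega>\<close> become sums over cells.
\<close>

lemma domain_AE_cells: "AE z in lborel. z \<in> \<Omega> \<longrightarrow> (\<exists>m\<in>gauss_lattice. z - m \<in> \<omega>)"
proof -
  have "AE z in lebesgue. z \<notin> \<Omega> - (\<Union>m\<in>gauss_lattice. translated_cell \<omega> m)"
    by (rule AE_not_in) (use null in \<open>simp only: negligible_iff_null_sets\<close>)
  then have "AE z in lebesgue. z \<in> \<Omega> \<longrightarrow> (\<exists>m\<in>gauss_lattice. z - m \<in> \<omega>)"
    by eventually_elim (auto simp: mem_translated_cell)
  then show ?thesis by (simp add: AE_completion_iff)
qed

lemma l2sq_translate_cell:
  assumes m: "m \<in> gauss_lattice" and G: "continuous_on \<Omega> G"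
  shows "l2sq (lebesgue_on \<omega>) (\<lambda>z. G (z + m))
    = (\<integral>\<^sup>+w\<in>translated_cell \<omega> m. ennreal ((cmod (G w))\<^sup>2) \<partial>lborel)"
proof -
  define g where "g = (\<lambda>w. ennreal ((cmod (indicator (translated_cell \<omega> m) w *\<^sub>R G w))\<^sup>2))"
  have "(\<lambda>w. indicator (translated_cell \<omega> m) w *\<^sub>R G w) \<in> borel_measurable borel"
    by (rule borel_measurable_continuous_on_indicator
        [OF borel_open[OF open_translated_cell] continuous_on_subset[OF G translated_cell_subset[OF m]]])
  then have g[measurable]: "g \<in> borel_measurable borel" unfolding g_def by measurable
  have "(\<integral>\<^sup>+w\<in>translated_cell \<omega> m. ennreal ((cmod (G w))\<^sup>2) \<partial>lborel) = (\<integral>\<^sup>+w. g w \<partial>lborel)"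
    by (intro nn_integral_cong) (auto simp: g_def indicator_def)
  also have "\<dots> = (\<integral>\<^sup>+w. g (m + w) \<partial>lborel)"
    using nn_integral_lborel_shift[OF g, of m] by simp
  also have "\<dots> = l2sq (lebesgue_on \<omega>) (\<lambda>z. G (z + m))"
    unfolding l2sq_lebesgue_on[OF open_in_sets_lebesgue[OF open_cell]] g_def
    by (intro nn_integral_cong) (simp add: indicator_def mem_translated_cell add.commute[of m])
  finally show ?thesis ..
qed

lemma l2sq_domain:
  assumes G: "continuous_on \<Omega> G"
  shows "l2sq (lebesgue_on \<Omega>) G = (\<Sum>n. l2sq (lebesgue_on \<omega>) (\<lambda>z. G (z + lattice_enum n)))"
proof -
  define g where "g = (\<lambda>w. ennreal ((cmod (indicator \<Omega> w *\<^sub>R G w))\<^sup>2))"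
  have "(\<lambda>w. indicator \<Omega> w *\<^sub>R G w) \<in> borel_measurable borel"
    by (rule borel_measurable_continuous_on_indicator[OF borel_open[OF open_domain] G])
  then have g[measurable]: "g \<in> borel_measurable borel" unfolding g_def by measurable
  define B where "B = (\<lambda>n. translated_cell \<omega> (lattice_enum n))"
  have B: "disjoint_family B"
    unfolding disjoint_family_on_def B_def
  proof (intro ballI impI)
    fix i j :: nat assume "i \<noteq> j"
    then have "lattice_enum i \<noteq> lattice_enum j"
      using bij_lattice_enum by (auto simp: bij_betw_def dest: injD)
    then show "translated_cell \<omega> (lattice_enum i) \<inter> translated_cell \<omega> (lattice_enum j) = {}"
      by (intro disjoint_translated_cells lattice_enum_in)
  qed
  have "l2sq (lebesgue_on \<Omega>) G = (\<integral>\<^sup>+w\<in>\<Omega>. g w \<partial>lborel)"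
    using open_domain by (subst l2sq_lebesgue_on) (auto simp: g_def indicator_def intro!: nn_integral_cong)
  also have "\<dots> = (\<integral>\<^sup>+w\<in>(\<Union>n. B n). g w \<partial>lborel)"
  proof (rule nn_integral_cong_AE)
    show "AE w in lborel. g w * indicator \<Omega> w = g w * indicator (\<Union>n. B n) w"
      using domain_AE_cells
    proof eventually_elim
      case (elim w)
      have "w \<in> \<Omega> \<longleftrightarrow> w \<in> (\<Union>n. B n)"
      proof
        assume "w \<in> \<Omega>"
        then obtain m where "m \<in> gauss_lattice" "w - m \<in> \<omega>" using elim by blast
        moreover then obtain n where "m = lattice_enum n"
          using bij_lattice_enum by (auto simp: bij_betw_def)
        ultimately show "w \<in> (\<Union>n. B n)" by (auto simp: B_def mem_translated_cell)
      qed (use translated_cell_subset[OF lattice_enum_in] in \<open>auto simp: B_def\<close>)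
      then show ?case by (simp add: indicator_def)
    qed
  qed
  also have "\<dots> = (\<Sum>n. (\<integral>\<^sup>+w\<in>B n. g w \<partial>lborel))"
    by (rule nn_integral_disjoint_family[OF _ _ B]) (auto simp: B_def open_translated_cell)
  also have "\<dots> = (\<Sum>n. l2sq (lebesgue_on \<omega>) (\<lambda>z. G (z + lattice_enum n)))"
  proof (rule suminf_cong)
    fix n
    show "(\<integral>\<^sup>+w\<in>B n. g w \<partial>lborel) = l2sq (lebesgue_on \<omega>) (\<lambda>z. G (z + lattice_enum n))"
      unfolding l2sq_translate_cell[OF lattice_enum_in G]
      using translated_cell_subset[OF lattice_enum_in, of n]
      by (intro nn_integral_cong) (auto simp: g_def B_def indicator_def)
  qed
  finally show ?thesis .
qed

text \<open>
  The same constant works for all points of a disc and all analytic functions, and only finitely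
  many cells are involved: this is what turns convergence on cells into locally uniform convergence.
\<close>

lemma local_bergman_estimate:
  assumes z: "z \<in> \<Omega>"
  obtains r C F where "r > 0" "C \<ge> 0" "cball z r \<subseteq> \<Omega>" "finite F" "F \<subseteq> gauss_lattice"
    "\<forall>G w. G holomorphic_on \<Omega> \<longrightarrow> w \<in> cball z r \<longrightarrow>
       ennreal ((cmod (G w))\<^sup>2) \<le> ennreal C * (\<Sum>k\<in>F. l2sq (lebesgue_on \<omega>) (\<lambda>v. G (v + k)))"
proof -
  obtain e where e: "e > 0" "ball z e \<subseteq> \<Omega>" using open_domain z openE by blast
  define r where "r = e / 2"
  have r: "r > 0" "ball z (2 * r) \<subseteq> \<Omega>" using e by (auto simp: r_def)
  define F where "F = {k \<in> gauss_lattice. cmod k \<le> cmod z + 2 * r + 2}"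
  have cover: "k \<in> F" if "w \<in> ball z (2 * r)" "k \<in> gauss_lattice" "w - k \<in> \<omega>" for w k
  proof -
    \<comment> \<open>a translated cell that meets the disc belongs to a lattice point at bounded distance\<close>
    have "cmod (w - k) \<le> \<bar>Re (w - k)\<bar> + \<bar>Im (w - k)\<bar>" by (rule cmod_le)
    also have "\<dots> \<le> 2" using that(3) cell_subset by (auto simp: unit_square_def)
    finally have "cmod (w - k) \<le> 2" .
    moreover have "cmod k \<le> cmod z + cmod (w - z) + cmod (w - k)"
      using norm_triangle_ineq[of "z + (w - z)" "k - w"] norm_triangle_ineq[of z "w - z"]
      by (simp add: norm_minus_commute)
    ultimately have "cmod k \<le> cmod z + 2 * r + 2" using that(1) by (simp add: dist_norm norm_minus_commute)
    then show ?thesis using that(2) by (simp add: F_def)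
  qed
  have est: "ennreal ((cmod (G w))\<^sup>2) \<le> ennreal (1 / (pi * r\<^sup>2)) * (\<Sum>k\<in>F. l2sq (lebesgue_on \<omega>) (\<lambda>v. G (v + k)))"
    if G: "G holomorphic_on \<Omega>" and w: "w \<in> cball z r" for G w
  proof -
    have sub: "ball w r \<subseteq> ball z (2 * r)"
    proof
      fix x assume "x \<in> ball w r"
      then show "x \<in> ball z (2 * r)" using w dist_triangle[of z x w] by simp
    qed
    define g where "g = (\<lambda>w. ennreal ((cmod (indicator \<Omega> w *\<^sub>R G w))\<^sup>2))"
    have cG: "continuous_on \<Omega> G" using G holomorphic_on_imp_continuous_on by blast
    have "(\<lambda>w. indicator \<Omega> w *\<^sub>R G w) \<in> borel_measurable borel"
      by (rule borel_measurable_continuous_on_indicator[OF borel_open[OF open_domain] cG])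
    then have g[measurable]: "g \<in> borel_measurable borel" unfolding g_def by measurable
    have [measurable]: "translated_cell \<omega> k \<in> sets borel" for k by (simp add: open_translated_cell)
    have "ennreal ((cmod (G w))\<^sup>2) \<le> ennreal (1 / (pi * r\<^sup>2)) * (\<integral>\<^sup>+x\<in>ball w r. ennreal ((cmod (G x))\<^sup>2) \<partial>lborel)"
      using holomorphic_on_subset[OF G] sub r by (intro bergman_ball) auto
    also have "(\<integral>\<^sup>+x\<in>ball w r. ennreal ((cmod (G x))\<^sup>2) \<partial>lborel)
        \<le> (\<integral>\<^sup>+x. (\<Sum>k\<in>F. g x * indicator (translated_cell \<omega> k) x) \<partial>lborel)"
    proof (rule nn_integral_mono_AE)
      show "AE x in lborel. ennreal ((cmod (G x))\<^sup>2) * indicator (ball w r) x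
          \<le> (\<Sum>k\<in>F. g x * indicator (translated_cell \<omega> k) x)"
        using domain_AE_cells
      proof eventually_elim
        case (elim x)
        show ?case
        proof (cases "x \<in> ball w r")
          case True
          then have x: "x \<in> ball z (2 * r)" "x \<in> \<Omega>" using sub r by auto
          then obtain k where k: "k \<in> gauss_lattice" "x - k \<in> \<omega>" using elim by blast
          then have "k \<in> F" using cover x by blast
          then have "g x * indicator (translated_cell \<omega> k) x \<le> (\<Sum>k\<in>F. g x * indicator (translated_cell \<omega> k) x)"
            using finite_lattice_bounded unfolding F_def by (intro member_le_sum) auto
          then show ?thesis using True k x by (simp add: mem_translated_cell g_def)
        qed simp
      qed
    qed
    also have "\<dots> = (\<Sum>k\<in>F. \<integral>\<^sup>+x. g x * indicator (translated_cell \<omega> k) x \<partial>lborel)"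
      by (rule nn_integral_sum) measurable
    also have "\<dots> = (\<Sum>k\<in>F. l2sq (lebesgue_on \<omega>) (\<lambda>v. G (v + k)))"
    proof (rule sum.cong[OF refl])
      fix k assume "k \<in> F"
      then have k: "k \<in> gauss_lattice" by (simp add: F_def)
      show "(\<integral>\<^sup>+x. g x * indicator (translated_cell \<omega> k) x \<partial>lborel) = l2sq (lebesgue_on \<omega>) (\<lambda>v. G (v + k))"
        unfolding l2sq_translate_cell[OF k cG] using translated_cell_subset[OF k]
        by (intro nn_integral_cong) (auto simp: g_def indicator_def)
    qed
    finally show ?thesis by (simp add: mult_left_mono)
  qed
  show thesis
  proof (rule that[of r "1 / (pi * r\<^sup>2)" F])
    have "cball z r \<subseteq> ball z (2 * r)" using r by auto
    then show "cball z r \<subseteq> \<Omega>" using r by auto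
    show "finite F" unfolding F_def by (rule finite_lattice_bounded)
  qed (use r est F_def in auto)
qed

end

section \<open>Bloch functions\<close>

lemma l2sq_fatou:
  assumes [measurable]: "\<And>j::nat. u j \<in> borel_measurable M"
    and lim: "AE x in M. (\<lambda>j. u j x) \<longlonglongrightarrow> v x"
  shows "l2sq M v \<le> liminf (\<lambda>j. l2sq M (u j))"
proof -
  have "l2sq M v \<le> (\<integral>\<^sup>+x. liminf (\<lambda>j. ennreal ((cmod (u j x))\<^sup>2)) \<partial>M)"
    unfolding l2sq_def
  proof (rule nn_integral_mono_AE)
    show "AE x in M. ennreal ((cmod (v x))\<^sup>2) \<le> liminf (\<lambda>j. ennreal ((cmod (u j x))\<^sup>2))"
      using lim
    proof eventually_elim
      case (elim x)
      have "(\<lambda>j. ennreal ((cmod (u j x))\<^sup>2)) \<longlonglongrightarrow> ennreal ((cmod (v x))\<^sup>2)"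
        by (intro tendsto_intros elim)
      then show ?case using lim_imp_Liminf trivial_limit_sequentially by fastforce
    qed
  qed
  also have "\<dots> \<le> liminf (\<lambda>j. l2sq M (u j))"
    unfolding l2sq_def by (rule nn_integral_liminf) measurable
  finally show ?thesis .
qed

lemma liminf_le_of_eventually_le:
  assumes "eventually (\<lambda>j::nat. a j \<le> (c :: ennreal)) sequentially"
  shows "liminf a \<le> c"
proof -
  have "liminf a \<le> limsup a" by (rule Liminf_le_Limsup) simp
  also have "\<dots> \<le> c" by (rule Limsup_bounded[OF assms])
  finally show ?thesis .
qed

lemma tendsto_of_l2sq_bound:
  assumes C: "\<And>n. ennreal ((cmod (u n - a))\<^sup>2) \<le> ennreal C * e n" "C \<ge> 0" and e: "e \<longlonglongrightarrow> (0 :: ennreal)"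
  shows "u \<longlonglongrightarrow> a"
proof -
  have "(\<lambda>n. ennreal C * e n) \<longlonglongrightarrow> ennreal C * 0"
    by (rule ennreal_tendsto_cmult[OF _ e]) simp
  then have lim: "(\<lambda>n. ennreal C * e n) \<longlonglongrightarrow> 0" by simp
  have "(\<lambda>n. ennreal ((cmod (u n - a))\<^sup>2)) \<longlonglongrightarrow> 0"
    by (rule tendsto_sandwich[OF always_eventually always_eventually tendsto_const lim])
      (simp_all add: C)
  then have "(\<lambda>n. (cmod (u n - a))\<^sup>2) \<longlonglongrightarrow> 0"
    using tendsto_ennrealD[of "\<lambda>n. (cmod (u n - a))\<^sup>2" 0 sequentially] by simp
  then have "(\<lambda>n. sqrt ((cmod (u n - a))\<^sup>2)) \<longlonglongrightarrow> sqrt 0" by (intro tendsto_intros)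
  then show ?thesis by (simp add: tendsto_norm_zero_iff LIM_zero_iff)
qed

definition phase :: "real \<times> real \<Rightarrow> complex \<Rightarrow> complex" where
  "phase \<eta> m = exp (\<i> * of_real (fst \<eta> * Re m + snd \<eta> * Im m))"

lemma phase_add: "phase \<eta> (m + k) = phase \<eta> m * phase \<eta> k"
  by (simp add: phase_def exp_add[symmetric] algebra_simps)

lemma cmod_phase [simp]: "cmod (phase \<eta> m) = 1"
  by (simp add: phase_def)

lemma phase_0 [simp]: "phase \<eta> 0 = 1" by (simp add: phase_def)

lemma phase_minus: "phase \<eta> (- m) * phase \<eta> m = 1"
  using phase_add[of \<eta> "- m" m] by simp

lemma cnj_phase: "cnj (phase \<eta> m) = phase \<eta> (- m)"
  by (simp add: phase_def exp_cnj algebra_simps)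

text \<open>
  The identity theorem: a relation between \<open>h\<close> and its translate spreads from a set accumulating at
  \<open>p\<close> to a neighbourhood of \<open>p\<close>. Below the set is a side of the unit square, and \<open>p\<close> may be a
  corner.
\<close>

lemma shift_relation_near:
  assumes U: "open U" and h: "h holomorphic_on U" and p: "p \<in> U" "p + k \<in> U"
    and T: "p islimpt T" "\<And>w. w \<in> T \<Longrightarrow> w \<in> U \<Longrightarrow> h (w + k) = c * h w"
  obtains e where "e > 0" "ball p e \<subseteq> U" "\<And>w. w \<in> ball p e \<Longrightarrow> h (w + k) = c * h w"
proof -
  obtain e1 e2 where e: "e1 > 0" "ball p e1 \<subseteq> U" "e2 > 0" "ball (p + k) e2 \<subseteq> U"
    using U p openE by metis
  define e where "e = min e1 e2"
  have sub: "ball p e \<subseteq> U" "(\<lambda>w. w + k) ` ball p e \<subseteq> U"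
  proof -
    show "ball p e \<subseteq> U" using e by (auto simp: e_def)
    have "w + k \<in> ball (p + k) e2" if "w \<in> ball p e" for w
      using that by (simp add: e_def dist_norm)
    then show "(\<lambda>w. w + k) ` ball p e \<subseteq> U" using e by auto
  qed
  have "h (w + k) - c * h w = 0" if w: "w \<in> ball p e" for w
  proof (rule analytic_continuation[where f = "\<lambda>w. h (w + k) - c * h w" and S = "ball p e"
        and U = "T \<inter> ball p e" and \<xi> = p])
    show "(\<lambda>w. h (w + k) - c * h w) holomorphic_on ball p e"
      using sub holomorphic_on_subset[OF h sub(1)]
      by (intro holomorphic_intros holomorphic_on_compose_gen[of "\<lambda>w. w + k" _ h U, unfolded o_def] h) auto
    show "p islimpt T \<inter> ball p e"
    proof (rule islimpt_Int_eventually[OF T(1)])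
      show "eventually (\<lambda>y. y \<in> ball p e) (at p)"
        using e by (intro eventually_at_in_open') (auto simp: e_def)
    qed
  qed (use T(2) sub e w in \<open>auto simp: e_def\<close>)
  then show thesis using that[of e] e sub by (auto simp: e_def)
qed

lemma nearby_in_unit_interval:
  fixes t e :: real
  assumes "0 \<le> t" "t \<le> 1" "e > 0"
  obtains s where "0 < s" "s < 1" "s \<noteq> t" "\<bar>s - t\<bar> < e"
proof (cases "t \<le> 1 / 2")
  case True
  show ?thesis by (rule that[of "t + min (e / 2) (1 / 4)"]) (use True assms in \<open>auto simp: min_def abs_if\<close>)
next
  case False
  show ?thesis by (rule that[of "t - min (e / 2) (1 / 4)"]) (use False assms in \<open>auto simp: min_def abs_if\<close>)
qed

lemma islimpt_unit_side:
  assumes "0 \<le> t" "t \<le> 1" and \<xi>: "cmod \<xi> = 1"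
  shows "(\<zeta> + of_real t * \<xi>) islimpt (\<lambda>s. \<zeta> + of_real s * \<xi>) ` {0<..<1::real}"
  unfolding islimpt_approachable
proof (intro allI impI)
  fix e :: real assume e: "e > 0"
  obtain s where s: "0 < s" "s < 1" "s \<noteq> t" "\<bar>s - t\<bar> < e"
    using nearby_in_unit_interval[OF assms(1,2) e] .
  have "dist (\<zeta> + of_real s * \<xi>) (\<zeta> + of_real t * \<xi>) = cmod ((of_real s - of_real t) * \<xi>)"
    by (simp add: dist_norm algebra_simps)
  also have "\<dots> = \<bar>s - t\<bar>" using \<xi> by (simp add: norm_mult flip: of_real_diff)
  finally have d: "dist (\<zeta> + of_real s * \<xi>) (\<zeta> + of_real t * \<xi>) = \<bar>s - t\<bar>" .
  then have "\<zeta> + of_real s * \<xi> \<noteq> \<zeta> + of_real t * \<xi>" using s by (metis dist_self abs_eq_0 right_minus_eq)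
  then show "\<exists>x'\<in>(\<lambda>s. \<zeta> + of_real s * \<xi>) ` {0<..<1}. x' \<noteq> \<zeta> + of_real t * \<xi> \<and> dist x' (\<zeta> + of_real t * \<xi>) < e"
    using s d by (intro bexI[of _ "\<zeta> + of_real s * \<xi>"]) auto
qed

context cell_setting
begin

text \<open>
  The quasi-periodic functions on \<open>\<Omega>\<close>, known as Bloch functions with quasimomentum \<open>\<eta>\<close>.
\<close>

definition bloch :: "real \<times> real \<Rightarrow> (complex \<Rightarrow> complex) \<Rightarrow> bool" where
  "bloch \<eta> H \<longleftrightarrow> H holomorphic_on \<Omega> \<and> (\<forall>z\<in>\<Omega>. \<forall>m\<in>gauss_lattice. H (z + m) = phase \<eta> m * H z)"

lemma holomorphic_translate:
  assumes "G holomorphic_on \<Omega>" "k \<in> gauss_lattice"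
  shows "(\<lambda>z. G (z + k)) holomorphic_on \<Omega>"
  using assms by (intro holomorphic_on_compose_gen[of "\<lambda>w. w + k" _ G \<Omega>, unfolded o_def] holomorphic_intros) auto

lemma cell_measurable:
  assumes "G holomorphic_on \<Omega>"
  shows "G \<in> borel_measurable (lebesgue_on \<omega>)"
  using holomorphic_measurable_lebesgue_on[OF holomorphic_on_subset[OF assms cell_subset_domain] open_cell] .

lemma cell_measurable_translate:
  assumes "G holomorphic_on \<Omega>" "k \<in> gauss_lattice"
  shows "(\<lambda>z. G (z + k)) \<in> borel_measurable (lebesgue_on \<omega>)"
  by (rule cell_measurable[OF holomorphic_translate[OF assms]])

text \<open>
  By the local Bergman estimate the sequence is uniformly Cauchy near each point.
\<close>

lemma holomorphic_limit:
  assumes hol: "\<And>j::nat. G j holomorphic_on \<Omega>"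
    and cauchy: "\<And>k \<epsilon>. k \<in> gauss_lattice \<Longrightarrow> \<epsilon> > 0 \<Longrightarrow>
       \<exists>J. \<forall>i\<ge>J. \<forall>j\<ge>J. l2sq (lebesgue_on \<omega>) (\<lambda>v. G i (v + k) - G j (v + k)) \<le> ennreal \<epsilon>"
  obtains H where "H holomorphic_on \<Omega>" "\<And>z. z \<in> \<Omega> \<Longrightarrow> (\<lambda>j. G j z) \<longlonglongrightarrow> H z"
proof -
  define H where "H = (\<lambda>z. lim (\<lambda>j. G j z))"
  have loc: "\<exists>d>0. cball z d \<subseteq> \<Omega> \<and> uniform_limit (cball z d) G H sequentially" if z: "z \<in> \<Omega>" for z
  proof -
    obtain r C F where r: "r > 0" "C \<ge> 0" "cball z r \<subseteq> \<Omega>" "finite F" "F \<subseteq> gauss_lattice"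
      and est: "\<forall>G w. G holomorphic_on \<Omega> \<longrightarrow> w \<in> cball z r \<longrightarrow>
       ennreal ((cmod (G w))\<^sup>2) \<le> ennreal C * (\<Sum>k\<in>F. l2sq (lebesgue_on \<omega>) (\<lambda>v. G (v + k)))"
      using local_bergman_estimate[OF z] by blast
    have "uniformly_Cauchy_on (cball z r) G"
      unfolding uniformly_Cauchy_on_def dist_norm
    proof (intro allI impI)
      fix e :: real assume e: "e > 0"
      define \<epsilon> where "\<epsilon> = (e / 2)\<^sup>2 / (C * card F + 1)"
      have pos: "C * card F + 1 > 0" using r by (intro add_nonneg_pos) auto
      then have \<epsilon>: "\<epsilon> > 0" using e by (simp add: \<epsilon>_def)
      have "\<forall>k\<in>F. \<exists>J. \<forall>i\<ge>J. \<forall>j\<ge>J. l2sq (lebesgue_on \<omega>) (\<lambda>v. G i (v + k) - G j (v + k)) \<le> ennreal \<epsilon>"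
        using cauchy \<epsilon> r by blast
      then obtain J where J: "\<And>k i j. k \<in> F \<Longrightarrow> i \<ge> J k \<Longrightarrow> j \<ge> J k \<Longrightarrow>
          l2sq (lebesgue_on \<omega>) (\<lambda>v. G i (v + k) - G j (v + k)) \<le> ennreal \<epsilon>"
        by metis
      define M where "M = (\<Sum>k\<in>F. J k)"
      have M: "J k \<le> M" if "k \<in> F" for k unfolding M_def using that r by (intro member_le_sum) auto
      show "\<exists>M. \<forall>w\<in>cball z r. \<forall>m\<ge>M. \<forall>n\<ge>M. cmod (G m w - G n w) < e"
      proof (intro exI ballI allI impI)
        fix w m n assume w: "w \<in> cball z r" and mn: "M \<le> m" "M \<le> n"
        have "ennreal ((cmod (G m w - G n w))\<^sup>2)
            \<le> ennreal C * (\<Sum>k\<in>F. l2sq (lebesgue_on \<omega>) (\<lambda>v. G m (v + k) - G n (v + k)))"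
          using est w by (auto intro!: holomorphic_intros hol)
        also have "\<dots> \<le> ennreal C * (\<Sum>k\<in>F. ennreal \<epsilon>)"
          using M mn by (intro mult_left_mono sum_mono J) (auto intro: order_trans)
        also have "\<dots> = ennreal (C * card F * \<epsilon>)"
          using r \<epsilon> by (simp add: ennreal_of_nat_eq_real_of_nat ennreal_mult'' mult.assoc)
        finally have "(cmod (G m w - G n w))\<^sup>2 \<le> C * card F * \<epsilon>"
          using r \<epsilon> by (subst (asm) ennreal_le_iff) auto
        also have "\<dots> \<le> (e / 2)\<^sup>2"
          using pos \<epsilon> unfolding \<epsilon>_def by (simp add: field_simps)
        finally have "cmod (G m w - G n w) \<le> e / 2" using e by (simp add: power2_le_iff_abs_le)
        then show "cmod (G m w - G n w) < e" using e by simp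
      qed
    qed
    then have "uniform_limit (cball z r) G H sequentially"
      unfolding H_def using Cauchy_uniformly_convergent uniformly_convergent_uniform_limit_iff by blast
    then show ?thesis using r by blast
  qed
  show thesis
  proof (rule that)
    show "H holomorphic_on \<Omega>"
      by (rule holomorphic_uniform_sequence[OF open_domain hol loc])
    fix z assume "z \<in> \<Omega>"
    then obtain d where "d > 0" "uniform_limit (cball z d) G H sequentially" using loc by blast
    then show "(\<lambda>j. G j z) \<longlonglongrightarrow> H z" by (intro tendsto_uniform_limitI) auto
  qed
qed

text \<open>
  The only possible extension multiplies \<open>h\<close> on the translated cell \<open>\<omega> + m\<close> by \<open>phase \<eta> m\<close>; analyticity
  has to be checked only across the sides of the unit square. There the boundary conditions, spread
  to a neighbourhood by the identity theorem, say that the extension agrees with \<open>h\<close>. At a corner, two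
  such relations are chained.
\<close>

lemma bloch_of_extension:
  assumes U: "open U" "closure \<omega> \<inter> \<Omega> \<subseteq> U" "U \<subseteq> \<Omega>" and h: "h holomorphic_on U"
    and h1: "\<And>y. y \<in> {0<..<1} \<Longrightarrow> Complex 0 y \<in> \<Omega> \<Longrightarrow> h (Complex 1 y) = exp (\<i> * of_real (fst \<eta>)) * h (Complex 0 y)"
    and h2: "\<And>x. x \<in> {0<..<1} \<Longrightarrow> Complex x 0 \<in> \<Omega> \<Longrightarrow> h (Complex x 1) = exp (\<i> * of_real (snd \<eta>)) * h (Complex x 0)"
  obtains H where "bloch \<eta> H" "\<And>z. z \<in> \<omega> \<Longrightarrow> H z = h z"
proof -
  define H where "H = (\<lambda>w. phase \<eta> (cell_index w) * h (w - cell_index w))"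
  have U': "w \<in> U" if "w \<in> \<Omega>" "w \<in> closure unit_square" for w
    using domain_square_subset_closure[OF that] that U by blast
  have p1: "phase \<eta> 1 = exp (\<i> * of_real (fst \<eta>))" and p2: "phase \<eta> \<i> = exp (\<i> * of_real (snd \<eta>))"
    by (auto simp: phase_def)
  have quasi: "H (z + m) = phase \<eta> m * H z" if "m \<in> gauss_lattice" for z m
    using that by (simp add: H_def cell_index_add phase_add)
  have shift1: "\<exists>e>0. ball p e \<subseteq> U \<and> (\<forall>w\<in>ball p e. h (w + 1) = phase \<eta> 1 * h w)"
    if p: "p \<in> \<Omega>" "Re p = 0" "0 \<le> Im p" "Im p \<le> 1" for p
  proof -
    have peq: "p = 0 + of_real (Im p) * \<i>" using p by (simp add: complex_eq_iff)
    have pU: "p \<in> U" "p + 1 \<in> U" using p by (auto intro!: U' simp: closure_unit_square lattice_intros)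
    have lim: "p islimpt (\<lambda>s. 0 + of_real s * \<i>) ` {0<..<1::real}"
      by (subst peq, rule islimpt_unit_side) (use p in auto)
    have rel: "h (w + 1) = phase \<eta> 1 * h w"
      if "w \<in> (\<lambda>s. 0 + of_real s * \<i>) ` {0<..<1::real}" "w \<in> U" for w
    proof -
      have "0 < Im w" "Im w < 1" "Complex 0 (Im w) = w" "Complex 1 (Im w) = w + 1"
        using that by (auto simp: complex_eq_iff)
      then show ?thesis using h1[of "Im w"] that U p1 by auto
    qed
    show ?thesis
      by (rule shift_relation_near[OF U(1) h pU lim rel]) auto
  qed
  have shift2: "\<exists>e>0. ball p e \<subseteq> U \<and> (\<forall>w\<in>ball p e. h (w + \<i>) = phase \<eta> \<i> * h w)"
    if p: "p \<in> \<Omega>" "Im p = 0" "0 \<le> Re p" "Re p \<le> 1" for p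
  proof -
    have peq: "p = 0 + of_real (Re p) * 1" using p by (simp add: complex_eq_iff)
    have pU: "p \<in> U" "p + \<i> \<in> U" using p by (auto intro!: U' simp: closure_unit_square lattice_intros)
    have lim: "p islimpt (\<lambda>s. 0 + of_real s * 1) ` {0<..<1::real}"
      by (subst peq, rule islimpt_unit_side) (use p in auto)
    have rel: "h (w + \<i>) = phase \<eta> \<i> * h w"
      if "w \<in> (\<lambda>s. 0 + of_real s * 1) ` {0<..<1::real}" "w \<in> U" for w
    proof -
      have "0 < Re w" "Re w < 1" "Complex (Re w) 0 = w" "Complex (Re w) 1 = w + \<i>"
        using that by (auto simp: complex_eq_iff)
      then show ?thesis using h2[of "Re w"] that U p2 by auto
    qed
    show ?thesis
      by (rule shift_relation_near[OF U(1) h pU lim rel]) auto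
  qed
  have near: "\<exists>e>0. ball p e \<subseteq> U \<and> (\<forall>w\<in>ball p e. H w = h w)"
    if p: "p \<in> \<Omega>" "0 \<le> Re p" "Re p < 1" "0 \<le> Im p" "Im p < 1" for p
  proof -
    have pU: "p \<in> U" using p by (intro U') (auto simp: closure_unit_square)
    then obtain e0 where e0: "e0 > 0" "ball p e0 \<subseteq> U" using U(1) openE by blast
    \<comment> \<open>within these distances of \<open>p\<close> the integer part of a coordinate stays \<open>0\<close>, or drops to \<open>-1\<close> if \<open>p\<close> is on that side\<close>
    define d1 where "d1 = (if Re p = 0 then 1 - Re p else min (Re p) (1 - Re p))"
    define d2 where "d2 = (if Im p = 0 then 1 - Im p else min (Im p) (1 - Im p))"
    have d: "d1 > 0" "d2 > 0" using p by (auto simp: d1_def d2_def)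
    have "\<exists>e1>0. Re p = 0 \<longrightarrow> (\<forall>w\<in>ball p e1. h (w + 1) = phase \<eta> 1 * h w)"
    proof (cases "Re p = 0")
      case True
      from shift1[OF p(1) True p(4) less_imp_le[OF p(5)]] show ?thesis by blast
    qed (use zero_less_one in blast)
    then obtain e1 where e1: "e1 > 0" "Re p = 0 \<Longrightarrow> \<forall>w\<in>ball p e1. h (w + 1) = phase \<eta> 1 * h w"
      by blast
    have "\<exists>e2>0. Im p = 0 \<longrightarrow> (\<forall>w\<in>ball p e2. h (w + \<i>) = phase \<eta> \<i> * h w)"
    proof (cases "Im p = 0")
      case True
      from shift2[OF p(1) True p(2) less_imp_le[OF p(3)]] show ?thesis by blast
    qed (use zero_less_one in blast)
    then obtain e2 where e2: "e2 > 0" "Im p = 0 \<Longrightarrow> \<forall>w\<in>ball p e2. h (w + \<i>) = phase \<eta> \<i> * h w"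
      by blast
    have "\<exists>e3>0. p = 0 \<longrightarrow> (\<forall>w\<in>ball (p + 1) e3. h (w + \<i>) = phase \<eta> \<i> * h w)"
    proof (cases "p = 0")
      case True
      then have "p + 1 \<in> \<Omega>" using domain_translate[OF lattice_1] p(1) by blast
      from shift2[OF this] True show ?thesis by auto
    qed (use zero_less_one in blast)
    then obtain e3 where e3: "e3 > 0" "p = 0 \<Longrightarrow> \<forall>w\<in>ball (p + 1) e3. h (w + \<i>) = phase \<eta> \<i> * h w"
      by blast
    define e where "e = min (min e0 (min d1 d2)) (min e1 (min e2 e3))"
    have e: "e > 0" "e \<le> e0" "e \<le> d1" "e \<le> d2" "e \<le> e1" "e \<le> e2" "e \<le> e3"
      using e0 d e1 e2 e3 by (auto simp: e_def)
    have "H w = h w" if w: "w \<in> ball p e" for w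
    proof -
      have "\<bar>Re (w - p)\<bar> < e" "\<bar>Im (w - p)\<bar> < e"
        using w abs_Re_le_cmod[of "w - p"] abs_Im_le_cmod[of "w - p"] by (auto simp: dist_norm norm_minus_commute)
      then have Re: "\<bar>Re w - Re p\<bar> < d1" and Im: "\<bar>Im w - Im p\<bar> < d2" using e by auto
      have fR: "\<lfloor>Re w\<rfloor> = 0 \<or> \<lfloor>Re w\<rfloor> = -1 \<and> Re p = 0"
        using Re p unfolding d1_def floor_eq_iff by (auto split: if_splits)
      have fI: "\<lfloor>Im w\<rfloor> = 0 \<or> \<lfloor>Im w\<rfloor> = -1 \<and> Im p = 0"
        using Im p unfolding d2_def floor_eq_iff by (auto split: if_splits)
      consider "cell_index w = 0" | "cell_index w = -1" "Re p = 0" | "cell_index w = -\<i>" "Im p = 0"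
        | "cell_index w = - (1 + \<i>)" "p = 0"
        using fR fI by (auto simp: complex_eq_iff)
      then show ?thesis
      proof cases
        case 1
        then show ?thesis by (simp add: H_def)
      next
        case 2
        then have "h (w + 1) = phase \<eta> 1 * h w" using e1 w e by auto
        then show ?thesis using 2 phase_minus[of \<eta> 1] by (simp add: H_def mult.assoc[symmetric])
      next
        case 3
        then have "h (w + \<i>) = phase \<eta> \<i> * h w" using e2 w e by auto
        then show ?thesis using 3 phase_minus[of \<eta> \<i>] by (simp add: H_def mult.assoc[symmetric])
      next
        case 4
        then have "h (w + 1) = phase \<eta> 1 * h w" using e1 w e by auto
        moreover have "w + 1 \<in> ball (p + 1) e3" using w e by (simp add: dist_norm)
        then have "h (w + 1 + \<i>) = phase \<eta> \<i> * h (w + 1)" using e3 4 by auto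
        ultimately have "h (w + (1 + \<i>)) = phase \<eta> (1 + \<i>) * h w"
          by (simp add: phase_add add.assoc mult_ac)
        then show ?thesis using 4 phase_minus[of \<eta> "1 + \<i>"]
          by (simp only: H_def diff_minus_eq_add mult.assoc[symmetric]) simp
      qed
    qed
    then show ?thesis using e e0 by (intro exI[of _ e]) auto
  qed
  have "H field_differentiable at z" if z: "z \<in> \<Omega>" for z
  proof -
    define n where "n = cell_index z"
    have n: "n \<in> gauss_lattice" by (simp add: n_def cell_index_in_lattice)
    have "0 \<le> Re (z - n)" "Re (z - n) < 1" "0 \<le> Im (z - n)" "Im (z - n) < 1"
      unfolding n_def by (auto; linarith)+
    then obtain e where e: "e > 0" "ball (z - n) e \<subseteq> U" "\<And>w. w \<in> ball (z - n) e \<Longrightarrow> H w = h w"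
      using near[of "z - n"] z n by auto
    have "H holomorphic_on ball (z - n) e"
      using holomorphic_on_subset[OF h e(2)] e(3) by (metis holomorphic_transform)
    then have "(\<lambda>w. phase \<eta> n * H (w - n)) holomorphic_on ball z e"
      by (intro holomorphic_intros holomorphic_on_compose_gen[of "\<lambda>w. w - n" _ H "ball (z - n) e", unfolded o_def])
         (auto simp: dist_norm)
    moreover have "phase \<eta> n * H (w - n) = H w" for w using quasi[OF n, of "w - n"] by simp
    ultimately have "H holomorphic_on ball z e" by simp
    then show ?thesis using e(1) by (intro holomorphic_on_imp_differentiable_at[of _ "ball z e"]) auto
  qed
  then have "bloch \<eta> H"
    using quasi by (auto simp: bloch_def holomorphic_on_def field_differentiable_at_within)
  moreover have "H z = h z" if "z \<in> \<omega>" for z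
    using cell_index_cell[of z 0] that cell_subset by (auto simp: H_def lattice_0)
  ultimately show thesis using that by blast
qed

lemma A2_eta_ext_iff: "f \<in> A2_eta_ext \<omega> \<eta> \<longleftrightarrow> f \<in> A2 \<omega> \<and> (\<exists>H. bloch \<eta> H \<and> (\<forall>z\<in>\<omega>. H z = f z))"
proof
  assume "f \<in> A2_eta_ext \<omega> \<eta>"
  then show "f \<in> A2 \<omega> \<and> (\<exists>H. bloch \<eta> H \<and> (\<forall>z\<in>\<omega>. H z = f z))"
    unfolding A2_eta_ext_def
  proof (elim CollectE conjE exE, intro conjI)
    fix U h
    assume "open U" "closure \<omega> \<inter> \<Omega> \<subseteq> U" "U \<subseteq> \<Omega>" "h holomorphic_on U" and hf: "\<forall>z\<in>\<omega>. h z = f z"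
      and "\<forall>y\<in>{0<..<1}. Complex 0 y \<in> \<Omega> \<longrightarrow> h (Complex 1 y) = exp (\<i> * of_real (fst \<eta>)) * h (Complex 0 y)"
      and "\<forall>x\<in>{0<..<1}. Complex x 0 \<in> \<Omega> \<longrightarrow> h (Complex x 1) = exp (\<i> * of_real (snd \<eta>)) * h (Complex x 0)"
    then obtain H where "bloch \<eta> H" "\<And>z. z \<in> \<omega> \<Longrightarrow> H z = h z"
      using bloch_of_extension[of U h \<eta>] by blast
    then show "\<exists>H. bloch \<eta> H \<and> (\<forall>z\<in>\<omega>. H z = f z)" using hf by auto
  qed
next
  assume "f \<in> A2 \<omega> \<and> (\<exists>H. bloch \<eta> H \<and> (\<forall>z\<in>\<omega>. H z = f z))"
  then obtain H where f: "f \<in> A2 \<omega>" and H: "bloch \<eta> H" "\<forall>z\<in>\<omega>. H z = f z" by blast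
  have "H (Complex 1 y) = exp (\<i> * of_real (fst \<eta>)) * H (Complex 0 y)" if "Complex 0 y \<in> \<Omega>" for y
  proof -
    have "Complex 1 y = Complex 0 y + 1" by (simp add: complex_eq_iff)
    then show ?thesis using H(1) that lattice_1 by (simp add: bloch_def phase_def)
  qed
  moreover have "H (Complex x 1) = exp (\<i> * of_real (snd \<eta>)) * H (Complex x 0)" if "Complex x 0 \<in> \<Omega>" for x
  proof -
    have "Complex x 1 = Complex x 0 + \<i>" by (simp add: complex_eq_iff)
    then show ?thesis using H(1) that lattice_i by (simp add: bloch_def phase_def)
  qed
  ultimately show "f \<in> A2_eta_ext \<omega> \<eta>"
    unfolding A2_eta_ext_def using f H open_domain
    by (auto simp: bloch_def intro!: exI[of _ \<Omega>] exI[of _ H])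
qed

text \<open>
  Restrictions of Bloch functions form a closed space, since all translates of the cell carry the same
  norm: approximation on \<open>\<omega>\<close> makes the approximating Bloch functions Cauchy on every cell.
\<close>

lemma A2_eta_iff: "f \<in> A2_eta \<omega> \<eta> \<longleftrightarrow> f \<in> A2 \<omega> \<and> (\<exists>H. bloch \<eta> H \<and> (\<forall>z\<in>\<omega>. H z = f z))"
proof
  assume "f \<in> A2 \<omega> \<and> (\<exists>H. bloch \<eta> H \<and> (\<forall>z\<in>\<omega>. H z = f z))"
  then have "f \<in> A2_eta_ext \<omega> \<eta>" "f \<in> A2 \<omega>" by (auto simp: A2_eta_ext_iff)
  then show "f \<in> A2_eta \<omega> \<eta>" unfolding A2_eta_def by (auto simp: L2_norm_def intro!: bexI[of _ f])
next
  assume "f \<in> A2_eta \<omega> \<eta>"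
  then have f: "f \<in> A2 \<omega>" and "\<exists>h\<in>A2_eta_ext \<omega> \<eta>. L2_norm \<omega> (\<lambda>z. f z - h z) < 1 / Suc n" for n
    by (auto simp: A2_eta_def)
  then have "\<forall>n. \<exists>h. h \<in> A2_eta_ext \<omega> \<eta> \<and> L2_norm \<omega> (\<lambda>z. f z - h z) < 1 / Suc n" by blast
  then obtain h where h: "\<And>n. h n \<in> A2_eta_ext \<omega> \<eta>" "\<And>n. L2_norm \<omega> (\<lambda>z. f z - h n z) < 1 / Suc n"
    by metis
  then have "\<forall>n. \<exists>H. bloch \<eta> H \<and> (\<forall>z\<in>\<omega>. H z = h n z)" by (auto simp: A2_eta_ext_iff)
  then obtain H where H: "\<And>n. bloch \<eta> (H n)" "\<And>n z. z \<in> \<omega> \<Longrightarrow> H n z = h n z" by metis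
  have fm: "f \<in> borel_measurable (lebesgue_on \<omega>)" "f holomorphic_on \<omega>" using f by (auto simp: A2_def L2_def)
  have hA2: "h n \<in> A2 \<omega>" for n using h(1) by (simp add: A2_eta_ext_iff)
  have Hh: "H n holomorphic_on \<Omega>" for n using H by (simp add: bloch_def)
  define e where "e = (\<lambda>n. l2sq (lebesgue_on \<omega>) (\<lambda>z. f z - H n z))"
  have e_le: "e n \<le> ennreal ((1 / Suc n)\<^sup>2)" for n
  proof -
    have "(\<lambda>z. f z - h n z) \<in> borel_measurable (lebesgue_on \<omega>)"
      using f hA2[of n] by (auto simp: A2_def L2_def)
    moreover have "l2sq (lebesgue_on \<omega>) (\<lambda>z. f z - h n z) \<le> 2 * l2sq (lebesgue_on \<omega>) f + 2 * l2sq (lebesgue_on \<omega>) (h n)"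
      using f hA2[of n] by (intro l2sq_diff_le) (auto simp: A2_def L2_def)
    then have "l2sq (lebesgue_on \<omega>) (\<lambda>z. f z - h n z) < \<infinity>"
      using f hA2[of n] by (auto simp: A2_def L2_iff ennreal_mult_less_top elim!: le_less_trans)
    ultimately have "(\<lambda>z. f z - h n z) \<in> L2 \<omega>" by (simp add: L2_iff)
    then have "l2sq (lebesgue_on \<omega>) (\<lambda>z. f z - h n z) = ennreal ((L2_norm \<omega> (\<lambda>z. f z - h n z))\<^sup>2)"
      using L2_norm_sq by simp
    also have "\<dots> \<le> ennreal ((1 / Suc n)\<^sup>2)"
      using h(2)[of n] by (intro ennreal_leI power_mono) (auto simp: L2_norm_def)
    also have "l2sq (lebesgue_on \<omega>) (\<lambda>z. f z - h n z) = e n"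
      unfolding e_def l2sq_def using H by (intro nn_integral_cong) auto
    finally show ?thesis .
  qed
  have e0: "e \<longlonglongrightarrow> 0"
  proof (rule tendsto_sandwich[OF always_eventually always_eventually tendsto_const])
    have "(\<lambda>n. (1 / Suc n)\<^sup>2) \<longlonglongrightarrow> 0\<^sup>2" by (intro tendsto_intros LIMSEQ_Suc[OF lim_1_over_n])
    then show "(\<lambda>n. ennreal ((1 / Suc n)\<^sup>2)) \<longlonglongrightarrow> 0"
      using tendsto_ennrealI[of "\<lambda>n. (1 / Suc n)\<^sup>2" 0] by simp
  qed (simp, rule allI, rule e_le)
  obtain K where K: "K holomorphic_on \<Omega>" "\<And>z. z \<in> \<Omega> \<Longrightarrow> (\<lambda>j. H j z) \<longlonglongrightarrow> K z"
  proof (rule holomorphic_limit[OF Hh])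
    fix k \<epsilon> assume k: "k \<in> gauss_lattice" and \<epsilon>: "(\<epsilon>::real) > 0"
    have "eventually (\<lambda>n. e n < ennreal (\<epsilon> / 4)) sequentially"
      using order_tendstoD(2)[OF e0, of "ennreal (\<epsilon> / 4)"] \<epsilon> by simp
    then obtain J where J: "\<And>n. n \<ge> J \<Longrightarrow> e n \<le> ennreal (\<epsilon> / 4)"
      unfolding eventually_sequentially using less_imp_le by blast
    have "l2sq (lebesgue_on \<omega>) (\<lambda>v. H i (v + k) - H j (v + k)) \<le> ennreal \<epsilon>" if "i \<ge> J" "j \<ge> J" for i j
    proof -
      have "l2sq (lebesgue_on \<omega>) (\<lambda>v. H i (v + k) - H j (v + k)) = l2sq (lebesgue_on \<omega>) (\<lambda>v. (f v - H j v) - (f v - H i v))"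
        unfolding l2sq_def
      proof (rule nn_integral_cong)
        fix v assume "v \<in> space (lebesgue_on \<omega>)"
        then have "v \<in> \<Omega>" using cell_subset_domain by auto
        then have "H i (v + k) - H j (v + k) = phase \<eta> k * (H i v - H j v)"
          using H(1) k by (simp add: bloch_def right_diff_distrib)
        then show "ennreal ((cmod (H i (v + k) - H j (v + k)))\<^sup>2) = ennreal ((cmod ((f v - H j v) - (f v - H i v)))\<^sup>2)"
          by (simp add: norm_mult)
      qed
      also have "\<dots> \<le> 2 * e j + 2 * e i"
        unfolding e_def by (intro l2sq_diff_le borel_measurable_diff fm cell_measurable Hh)
      also have "\<dots> \<le> 2 * ennreal (\<epsilon> / 4) + 2 * ennreal (\<epsilon> / 4)"
        using J that by (intro add_mono mult_left_mono) auto
      also have "\<dots> = ennreal \<epsilon>"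
        using \<epsilon> by (simp flip: ennreal_numeral ennreal_mult'' ennreal_plus)
      finally show ?thesis .
    qed
    then show "\<exists>J. \<forall>i\<ge>J. \<forall>j\<ge>J. l2sq (lebesgue_on \<omega>) (\<lambda>v. H i (v + k) - H j (v + k)) \<le> ennreal \<epsilon>" by blast
  qed blast
  have "K z = f z" if z: "z \<in> \<omega>" for z
  proof -
    obtain C where C: "C \<ge> 0" "\<forall>G. G holomorphic_on \<omega> \<longrightarrow> ennreal ((cmod (G z))\<^sup>2) \<le> ennreal C * l2sq (lebesgue_on \<omega>) G"
      using bergman_estimate[OF open_cell z] by blast
    have "ennreal ((cmod (H n z - f z))\<^sup>2) \<le> ennreal C * e n" for n
      unfolding e_def l2sq_minus_commute[of _ f]
      by (rule C(2)[rule_format]) (intro holomorphic_intros fm holomorphic_on_subset[OF Hh cell_subset_domain])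
    then have "(\<lambda>n. H n z) \<longlonglongrightarrow> f z" using C e0 by (intro tendsto_of_l2sq_bound[where e = e])
    then show ?thesis using K(2)[of z] z cell_subset_domain LIMSEQ_unique by blast
  qed
  moreover have "bloch \<eta> K"
    unfolding bloch_def
  proof (intro conjI ballI K)
    fix z m assume zm: "z \<in> \<Omega>" "m \<in> gauss_lattice"
    then have "(\<lambda>j. H j (z + m)) \<longlonglongrightarrow> K (z + m)" by (intro K) simp
    moreover have "(\<lambda>j. H j (z + m)) = (\<lambda>j. phase \<eta> m * H j z)" using H(1) zm by (auto simp: bloch_def)
    moreover have "(\<lambda>j. phase \<eta> m * H j z) \<longlonglongrightarrow> phase \<eta> m * K z" using zm by (intro tendsto_intros K)
    ultimately show "K (z + m) = phase \<eta> m * K z" using LIMSEQ_unique by metis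
  qed
  ultimately show "f \<in> A2 \<omega> \<and> (\<exists>H. bloch \<eta> H \<and> (\<forall>z\<in>\<omega>. H z = f z))" using f by blast
qed

end

section \<open>Fourier series in the quasimomentum\<close>

lemma measurable_cnj [measurable (raw)]:
  "f \<in> borel_measurable M \<Longrightarrow> (\<lambda>x. cnj (f x)) \<in> borel_measurable M"
  by (rule measurable_compose[OF _ borel_measurable_continuous_onI[OF continuous_on_cnj[OF continuous_on_id]]])

abbreviation "QQ \<equiv> lebesgue_on quasimomenta"

lemma quasimomenta_cbox: "quasimomenta = cbox (-pi, -pi) (pi, pi)"
  by (auto simp: quasimomenta_def cbox_Pair_eq)

lemma quasimomenta_lebesgue [measurable, simp]: "quasimomenta \<in> sets lebesgue"
  by (simp add: quasimomenta_cbox)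

lemma finite_measure_QQ: "finite_measure QQ"
  unfolding quasimomenta_cbox by (intro finite_measure_lebesgue_on lmeasurable_cbox)

lemma continuous_on_phase: "continuous_on A (\<lambda>\<eta>. phase \<eta> m)"
  unfolding phase_def by (intro continuous_intros)

lemma phase_measurable [measurable]: "(\<lambda>\<eta>. phase \<eta> m) \<in> borel_measurable QQ"
  by (intro continuous_imp_measurable_on_sets_lebesgue continuous_on_phase) simp

lemma integrable_phase_mult:
  assumes "integrable QQ h"
  shows "integrable QQ (\<lambda>\<eta>. phase \<eta> m * h \<eta>)"
  by (rule Bochner_Integration.integrable_bound[OF assms]) (use assms in \<open>auto simp: norm_mult\<close>)

lemma integrable_phase: "integrable QQ (\<lambda>\<eta>. phase \<eta> m)"
  using integrable_phase_mult[of "\<lambda>_. 1"] finite_measure.integrable_const[OF finite_measure_QQ, of "1::complex"] by simp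

lemma integral_exp_int:
  "integral {-pi..pi} (\<lambda>x. exp (\<i> * of_real (real_of_int a * x))) = (if a = 0 then 2 * of_real pi else 0)"
proof (cases "a = 0")
  case False
  have "((\<lambda>x. exp (\<i> * of_real (real_of_int a * x))) has_integral
      (exp (\<i> * of_real (real_of_int a * pi)) / (\<i> * of_int a)
        - exp (\<i> * of_real (real_of_int a * (- pi))) / (\<i> * of_int a))) {-pi..pi}"
  proof (rule fundamental_theorem_of_calculus)
    fix x :: real
    have "((\<lambda>z. exp (\<i> * (of_int a * z)) / (\<i> * of_int a)) has_field_derivative exp (\<i> * (of_int a * of_real x))) (at (of_real x))"
      using False by (auto intro!: derivative_eq_intros simp: algebra_simps)
    from has_vector_derivative_real_field[OF this]
    show "((\<lambda>x. exp (\<i> * of_real (real_of_int a * x)) / (\<i> * of_int a)) has_vector_derivative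
      exp (\<i> * of_real (real_of_int a * x))) (at x within {-pi..pi})"
      by (simp add: has_vector_derivative_at_within)
  qed simp
  moreover have "exp (\<i> * of_real (real_of_int a * pi)) = exp (\<i> * of_real (real_of_int a * (- pi)))"
    by (subst exp_eq) (auto intro!: exI[of _ a] simp: algebra_simps)
  ultimately show ?thesis using False by (simp add: integral_unique)
qed (simp add: scaleR_conv_of_real)

lemma integral_phase:
  assumes "m \<in> gauss_lattice"
  shows "(LINT \<eta>|QQ. phase \<eta> m) = (if m = 0 then 4 * of_real pi ^ 2 else 0)"
proof -
  obtain a b where ab: "Re m = of_int a" "Im m = of_int b"
    using assms by (auto simp: gauss_lattice_def elim!: Ints_cases)
  have "(LINT \<eta>|QQ. phase \<eta> m) = integral (cbox (-pi, -pi) (pi, pi)) (\<lambda>\<eta>. phase \<eta> m)"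
    using lebesgue_integral_eq_integral[OF integrable_phase] by (simp add: quasimomenta_cbox)
  also have "\<dots> = integral (cbox (-pi) pi) (\<lambda>x. integral (cbox (-pi) pi) (\<lambda>y. phase (x, y) m))"
    by (rule integral_prod_continuous[OF continuous_on_phase])
  also have "\<dots> = integral {-pi..pi} (\<lambda>x. exp (\<i> * of_real (real_of_int a * x))) *
      integral {-pi..pi} (\<lambda>x. exp (\<i> * of_real (real_of_int b * x)))"
    by (simp add: phase_def ab exp_add ring_distribs mult.commute)
  also have "\<dots> = (if m = 0 then 4 * of_real pi ^ 2 else 0)"
    unfolding integral_exp_int using ab by (auto simp: complex_eq_iff power2_eq_square)
  finally show ?thesis .
qed

text \<open>
  The characters of the defining series, normalised in \<open>L\<^sup>2\<close> of the square of side \<open>2\<pi>\<close>.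
\<close>

definition mode :: "complex \<Rightarrow> real \<times> real \<Rightarrow> complex" where
  "mode m \<eta> = phase \<eta> (- m) / of_real (2 * pi)"

lemma mode_measurable [measurable]: "mode m \<in> borel_measurable QQ"
  unfolding mode_def by measurable

lemma cmod_mode: "cmod (mode m \<eta>) = 1 / (2 * pi)"
  by (simp add: mode_def norm_divide)

lemma mode_orthonormal:
  assumes "m \<in> gauss_lattice" "k \<in> gauss_lattice"
  shows "(LINT \<eta>|QQ. mode m \<eta> * cnj (mode k \<eta>)) = (if m = k then 1 else 0)"
proof -
  have "mode m \<eta> * cnj (mode k \<eta>) = 1 / (4 * of_real pi ^ 2) * phase \<eta> (k - m)" for \<eta>
    by (simp add: mode_def cnj_phase power2_eq_square phase_add[symmetric])
  then show ?thesis
    using integral_phase[OF lattice_diff[OF assms(2,1)]] by simp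
qed

lemma integrable_mult_of_squares:
  fixes u v :: "'a \<Rightarrow> complex"
  assumes [measurable]: "u \<in> borel_measurable M" "v \<in> borel_measurable M"
    and "integrable M (\<lambda>\<eta>. (cmod (u \<eta>))\<^sup>2)" "integrable M (\<lambda>\<eta>. (cmod (v \<eta>))\<^sup>2)"
  shows "integrable M (\<lambda>\<eta>. u \<eta> * v \<eta>)"
proof (rule Bochner_Integration.integrable_bound[where f = "\<lambda>\<eta>. (cmod (u \<eta>))\<^sup>2 + (cmod (v \<eta>))\<^sup>2"])
  show "AE \<eta> in M. norm (u \<eta> * v \<eta>) \<le> norm ((cmod (u \<eta>))\<^sup>2 + (cmod (v \<eta>))\<^sup>2)"
  proof (rule AE_I2)
    fix \<eta>
    have "cmod (u \<eta>) * cmod (v \<eta>) \<le> 2 * cmod (u \<eta>) * cmod (v \<eta>)"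
      using zero_le_mult_iff[of "cmod (u \<eta>)" "cmod (v \<eta>)"] by simp
    also have "\<dots> \<le> (cmod (u \<eta>))\<^sup>2 + (cmod (v \<eta>))\<^sup>2" by (rule sum_squares_bound)
    finally show "norm (u \<eta> * v \<eta>) \<le> norm ((cmod (u \<eta>))\<^sup>2 + (cmod (v \<eta>))\<^sup>2)" by (simp add: norm_mult)
  qed
qed (use assms in auto)

lemma integral_trig_sq:
  assumes F: "finite F" "F \<subseteq> gauss_lattice"
  shows "integrable QQ (\<lambda>\<eta>. (cmod (\<Sum>m\<in>F. c m * mode m \<eta>))\<^sup>2)"
    and "(LINT \<eta>|QQ. (cmod (\<Sum>m\<in>F. c m * mode m \<eta>))\<^sup>2) = (\<Sum>m\<in>F. (cmod (c m))\<^sup>2)"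
proof -
  let ?S = "\<lambda>\<eta>. \<Sum>m\<in>F. c m * mode m \<eta>"
  have bd: "cmod (?S \<eta>) \<le> (\<Sum>m\<in>F. cmod (c m) * (1 / (2 * pi)))" for \<eta>
    by (rule order_trans[OF norm_sum]) (simp add: norm_mult cmod_mode)
  show int: "integrable QQ (\<lambda>\<eta>. (cmod (?S \<eta>))\<^sup>2)"
    by (rule finite_measure.integrable_const_bound[OF finite_measure_QQ,
        where B = "(\<Sum>m\<in>F. cmod (c m) * (1 / (2 * pi)))\<^sup>2"]) (use bd in \<open>auto intro!: power_mono AE_I2\<close>)
  have im: "integrable QQ (\<lambda>\<eta>. mode m \<eta> * cnj (mode k \<eta>))" for m k
    by (rule finite_measure.integrable_const_bound[OF finite_measure_QQ, where B = "(1 / (2 * pi))\<^sup>2"])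
       (auto simp: norm_mult cmod_mode power2_eq_square)
  have "of_real (LINT \<eta>|QQ. (cmod (?S \<eta>))\<^sup>2) = (LINT \<eta>|QQ. complex_of_real ((cmod (?S \<eta>))\<^sup>2))"
    by (rule integral_complex_of_real[symmetric])
  also have "\<dots> = (LINT \<eta>|QQ. ?S \<eta> * cnj (?S \<eta>))"
    by (simp only: complex_norm_square)
  also have "\<dots> = (LINT \<eta>|QQ. (\<Sum>m\<in>F. \<Sum>k\<in>F. c m * cnj (c k) * (mode m \<eta> * cnj (mode k \<eta>))))"
    by (simp add: sum_product mult_ac)
  also have "\<dots> = (\<Sum>m\<in>F. \<Sum>k\<in>F. c m * cnj (c k) * (LINT \<eta>|QQ. mode m \<eta> * cnj (mode k \<eta>)))"
    by (simp add: im)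
  also have "\<dots> = (\<Sum>m\<in>F. \<Sum>k\<in>F. if k = m then c m * cnj (c k) else 0)"
    using F by (intro sum.cong refl) (auto simp: mode_orthonormal subset_eq)
  also have "\<dots> = (\<Sum>m\<in>F. c m * cnj (c m))" using F by simp
  also have "\<dots> = of_real (\<Sum>m\<in>F. (cmod (c m))\<^sup>2)"
    by (simp only: of_real_sum complex_norm_square)
  finally show "(LINT \<eta>|QQ. (cmod (?S \<eta>))\<^sup>2) = (\<Sum>m\<in>F. (cmod (c m))\<^sup>2)"
    by (simp only: of_real_eq_iff)
qed

lemma l2sq_trig:
  assumes F: "finite F" "F \<subseteq> gauss_lattice"
  shows "l2sq QQ (\<lambda>\<eta>. \<Sum>m\<in>F. c m * mode m \<eta>) = ennreal (\<Sum>m\<in>F. (cmod (c m))\<^sup>2)"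
  unfolding l2sq_def using integral_trig_sq[OF F] by (subst nn_integral_eq_integral) auto

lemma integrable_of_l2sq_QQ:
  assumes [measurable]: "h \<in> borel_measurable QQ" and "l2sq QQ h < \<infinity>"
  shows "integrable QQ (\<lambda>\<eta>. (cmod (h \<eta>))\<^sup>2)" "integrable QQ h"
proof -
  show 1: "integrable QQ (\<lambda>\<eta>. (cmod (h \<eta>))\<^sup>2)"
    using assms by (subst integrable_iff_bounded) (auto simp: l2sq_def)
  show "integrable QQ h"
    using integrable_mult_of_squares[OF assms(1) borel_measurable_const 1, of 1]
      finite_measure.integrable_const[OF finite_measure_QQ, of "1::real"] by simp
qed

lemma cmod_diff_power2: "(cmod (a - b))\<^sup>2 = (cmod a)\<^sup>2 - 2 * Re (a * cnj b) + (cmod b)\<^sup>2"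
  by (simp add: cmod_power2) (simp add: power2_eq_square algebra_simps)

lemma bessel_QQ:
  assumes [measurable]: "h \<in> borel_measurable QQ" and h: "l2sq QQ h < \<infinity>"
    and F: "finite F" "F \<subseteq> gauss_lattice"
    and c: "\<And>m. m \<in> F \<Longrightarrow> c m = (LINT \<eta>|QQ. h \<eta> * cnj (mode m \<eta>))"
  shows "ennreal (\<Sum>m\<in>F. (cmod (c m))\<^sup>2) \<le> l2sq QQ h"
proof -
  define S where "S = (\<lambda>\<eta>. \<Sum>m\<in>F. c m * mode m \<eta>)"
  have S2: "integrable QQ (\<lambda>\<eta>. (cmod (S \<eta>))\<^sup>2)"
    "(LINT \<eta>|QQ. (cmod (S \<eta>))\<^sup>2) = (\<Sum>m\<in>F. (cmod (c m))\<^sup>2)"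
    using integral_trig_sq[OF F, of c] by (simp_all add: S_def)
  note ih = integrable_of_l2sq_QQ[OF assms(1,2)]
  have [measurable]: "S \<in> borel_measurable QQ" unfolding S_def by measurable
  have im: "integrable QQ (\<lambda>\<eta>. h \<eta> * cnj (mode m \<eta>))" for m
    by (rule Bochner_Integration.integrable_bound[OF integrable_mult_right[OF ih(2), of "1 / (2 * pi)"]])
      (auto simp: norm_mult cmod_mode norm_divide)
  have ihS: "integrable QQ (\<lambda>\<eta>. h \<eta> * cnj (S \<eta>))"
  proof (rule integrable_mult_of_squares[OF assms(1) _ ih(1)])
    show "integrable QQ (\<lambda>\<eta>. (cmod (cnj (S \<eta>)))\<^sup>2)"
      using S2(1) by (simp only: complex_mod_cnj)
  qed measurable
  have hS: "(LINT \<eta>|QQ. h \<eta> * cnj (S \<eta>)) = of_real (\<Sum>m\<in>F. (cmod (c m))\<^sup>2)"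
  proof -
    have "(LINT \<eta>|QQ. h \<eta> * cnj (S \<eta>)) = (LINT \<eta>|QQ. (\<Sum>m\<in>F. cnj (c m) * (h \<eta> * cnj (mode m \<eta>))))"
      by (simp add: S_def sum_distrib_left mult_ac)
    also have "\<dots> = (\<Sum>m\<in>F. cnj (c m) * (LINT \<eta>|QQ. h \<eta> * cnj (mode m \<eta>)))" by (simp add: im)
    also have "\<dots> = (\<Sum>m\<in>F. cnj (c m) * c m)" by (intro sum.cong refl) (simp add: c)
    also have "\<dots> = of_real (\<Sum>m\<in>F. (cmod (c m))\<^sup>2)"
      by (simp only: of_real_sum complex_norm_square mult.commute)
    finally show ?thesis .
  qed
  have expand: "(cmod (h \<eta> - S \<eta>))\<^sup>2 = (cmod (h \<eta>))\<^sup>2 - 2 * Re (h \<eta> * cnj (S \<eta>)) + (cmod (S \<eta>))\<^sup>2" for \<eta>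
    by (rule cmod_diff_power2)
  have "0 \<le> (LINT \<eta>|QQ. (cmod (h \<eta> - S \<eta>))\<^sup>2)" by simp
  also have "\<dots> = (LINT \<eta>|QQ. (cmod (h \<eta>))\<^sup>2) - 2 * Re (LINT \<eta>|QQ. h \<eta> * cnj (S \<eta>)) + (LINT \<eta>|QQ. (cmod (S \<eta>))\<^sup>2)"
    unfolding expand integral_Re[OF ihS, symmetric] using ih S2(1) integrable_Re[OF ihS]
    by (simp del: times_complex.sel)
  also have "\<dots> = (LINT \<eta>|QQ. (cmod (h \<eta>))\<^sup>2) - (\<Sum>m\<in>F. (cmod (c m))\<^sup>2)"
    unfolding hS S2(2) by simp
  finally have "(\<Sum>m\<in>F. (cmod (c m))\<^sup>2) \<le> (LINT \<eta>|QQ. (cmod (h \<eta>))\<^sup>2)" by simp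
  then have "ennreal (\<Sum>m\<in>F. (cmod (c m))\<^sup>2) \<le> ennreal (LINT \<eta>|QQ. (cmod (h \<eta>))\<^sup>2)" by (rule ennreal_leI)
  also have "\<dots> = l2sq QQ h" unfolding l2sq_def using ih(1) by (subst nn_integral_eq_integral) auto
  finally show ?thesis .
qed

text \<open>
  The sets with vanishing integral form a Dynkin system containing the open sets, hence all Borel
  sets, in particular \<open>{x. g x > 0}\<close>.
\<close>

lemma AE_zero_if_open_integrals_zero_borel:
  fixes g :: "'a::euclidean_space \<Rightarrow> real"
  assumes [measurable]: "g \<in> borel_measurable borel" and g: "integrable lborel g"
    and open0: "\<And>V. open V \<Longrightarrow> (LINT x:V|lborel. g x) = 0"
  shows "AE x in lborel. g x \<le> 0"
proof -
  have si: "set_integrable lborel A g" if "A \<in> sets borel" for A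
    unfolding set_integrable_def by (rule integrable_mult_indicator[OF _ g]) (use that in simp)
  have all: "(LINT x:B|lborel. g x) = 0" if "B \<in> sets borel" for B
  proof -
    have "Int_stable {S :: 'a set. open S}" by (auto simp: Int_stable_def)
    moreover have "{S :: 'a set. open S} \<subseteq> Pow UNIV" by auto
    moreover have "B \<in> sigma_sets UNIV {S. open S}" using that by (simp add: sets_borel)
    ultimately show ?thesis
    proof (induction rule: sigma_sets_induct_disjoint[consumes 3, case_names basic empty compl union])
      case (basic A)
      then show ?case by (simp add: open0)
    next
      case empty
      then show ?case by (simp add: set_lebesgue_integral_def)
    next
      case (compl A)
      have [measurable]: "A \<in> sets borel" using compl by (simp add: sets_borel)
      have "(LINT x:UNIV|lborel. g x) = (LINT x:A|lborel. g x) + (LINT x:UNIV - A|lborel. g x)"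
        by (subst set_integral_Un[symmetric]) (auto intro!: si)
      then show ?case using compl open0[of UNIV] by simp
    next
      case (union A)
      have "A i \<in> sets lborel" for i using union by (auto simp: sets_borel)
      then have "(LINT x:(\<Union>i. A i)|lborel. g x) = (\<Sum>i. (LINT x:A i|lborel. g x))"
        using union(1) g
        by (intro lebesgue_integral_countable_add)
          (auto simp: disjoint_family_on_def intro!: si)
      then show ?case using union by simp
    qed
  qed
  define B where "B = {x. g x > 0}"
  have [measurable]: "B \<in> sets borel" unfolding B_def by measurable
  have "(LINT x|lborel. indicator B x *\<^sub>R g x) = 0"
    using all[of B] by (simp add: set_lebesgue_integral_def)
  moreover have "integrable lborel (\<lambda>x. indicator B x *\<^sub>R g x)"
    using si[of B] unfolding set_integrable_def by simp
  moreover have "AE x in lborel. 0 \<le> indicator B x *\<^sub>R g x"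
    by (rule AE_I2) (simp add: B_def indicator_def)
  ultimately have "AE x in lborel. indicator B x *\<^sub>R g x = 0"
    using integral_nonneg_eq_0_iff_AE by blast
  then show ?thesis by eventually_elim (auto simp: B_def indicator_def split: if_splits)
qed

lemma AE_zero_if_open_integrals_zero:
  fixes u :: "'a::euclidean_space \<Rightarrow> real"
  assumes u: "integrable lebesgue u"
    and open0: "\<And>V. open V \<Longrightarrow> (LINT x|lebesgue. indicator V x * u x) = 0"
  shows "AE x in lebesgue. u x = 0"
proof -
  obtain g where g[measurable]: "g \<in> borel_measurable lborel" and ae: "AE x in lborel. u x = g x"
    using completion_ex_borel_measurable_real[of u lborel] u by auto
  have ae': "AE x in lebesgue. u x = g x" using ae by (simp add: AE_completion)
  have gl: "g \<in> borel_measurable lebesgue" using g measurable_completion by blast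
  have "integrable lebesgue g" using u integrable_cong_AE[OF _ gl ae'] by auto
  then have gi: "integrable lborel g" using integrable_completion g by blast
  have V0: "(LINT x:V|lborel. g x) = 0" if V: "open V" for V
  proof -
    have [measurable]: "V \<in> sets borel" using V by simp
    have "(LINT x:V|lborel. g x) = (LINT x|lebesgue. indicator V x * g x)"
      unfolding set_lebesgue_integral_def by (subst integral_completion) auto
    also have "\<dots> = (LINT x|lebesgue. indicator V x * u x)"
    proof (rule integral_cong_AE)
      show "AE x in lebesgue. indicator V x * g x = indicator V x * u x" using ae' by eventually_elim auto
    qed (use gl u V in \<open>auto intro!: borel_measurable_times borel_measurable_indicator\<close>)
    finally show ?thesis using open0[OF V] by simp
  qed
  have "AE x in lborel. g x \<le> 0" by (rule AE_zero_if_open_integrals_zero_borel) (use gi V0 in auto)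
  moreover have "AE x in lborel. - g x \<le> 0"
    by (rule AE_zero_if_open_integrals_zero_borel) (use gi V0 in \<open>auto simp: set_lebesgue_integral_def\<close>)
  ultimately have "AE x in lborel. u x = 0" using ae by eventually_elim auto
  then show ?thesis by (simp add: AE_completion)
qed

inductive trig_poly :: "(real \<times> real \<Rightarrow> complex) \<Rightarrow> bool" where
  monom: "m \<in> gauss_lattice \<Longrightarrow> trig_poly (\<lambda>\<eta>. c * phase \<eta> m)"
| add: "trig_poly p \<Longrightarrow> trig_poly q \<Longrightarrow> trig_poly (\<lambda>\<eta>. p \<eta> + q \<eta>)"

lemma trig_poly_monom_mult:
  assumes "trig_poly q" "m \<in> gauss_lattice"
  shows "trig_poly (\<lambda>\<eta>. c * phase \<eta> m * q \<eta>)"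
  using assms
proof induction
  case (monom k d)
  then have "trig_poly (\<lambda>\<eta>. (c * d) * phase \<eta> (m + k))" by (intro trig_poly.monom lattice_add)
  then show ?case by (simp add: phase_add mult_ac)
next
  case (add p q)
  then show ?case using trig_poly.add by (simp add: ring_distribs)
qed

lemma trig_poly_mult: "trig_poly p \<Longrightarrow> trig_poly q \<Longrightarrow> trig_poly (\<lambda>\<eta>. p \<eta> * q \<eta>)"
proof (induction rule: trig_poly.induct)
  case (monom m c)
  then show ?case using trig_poly_monom_mult by simp
next
  case (add p1 p2)
  then show ?case using trig_poly.add by (simp add: ring_distribs)
qed

lemma trig_poly_scale: "trig_poly p \<Longrightarrow> trig_poly (\<lambda>\<eta>. c * p \<eta>)"
  using trig_poly_monom_mult[of p 0 c] by (simp add: lattice_0)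

lemma trig_poly_const: "trig_poly (\<lambda>\<eta>. c)"
  using trig_poly.monom[OF lattice_0, of c] by simp

text \<open>
  The quotient map from the square to the torus, on which periodic functions live; there the
  Stone-Weierstrass theorem applies.
\<close>

definition torus :: "real \<times> real \<Rightarrow> complex \<times> complex" where
  "torus \<eta> = (phase \<eta> 1, phase \<eta> \<i>)"

lemma continuous_on_torus: "continuous_on A torus"
  unfolding torus_def by (intro continuous_intros continuous_on_phase)

lemma trig_poly_real_polynomial:
  assumes "real_polynomial_function p"
  shows "trig_poly (\<lambda>\<eta>. of_real (p (torus \<eta>)))"
  using assms
proof (induction rule: real_polynomial_function.induct)
  case (linear f)
  interpret bounded_linear f by fact
  have ReIm: "trig_poly (\<lambda>\<eta>. of_real (Re (phase \<eta> m)))" "trig_poly (\<lambda>\<eta>. of_real (Im (phase \<eta> m)))"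
    if m: "m \<in> gauss_lattice" for m
  proof -
    have "of_real (Re (phase \<eta> m)) = (1/2) * phase \<eta> m + (1/2) * phase \<eta> (- m)" for \<eta>
      by (simp add: complex_eq_iff flip: cnj_phase)
    then show "trig_poly (\<lambda>\<eta>. of_real (Re (phase \<eta> m)))"
      using trig_poly.add[OF trig_poly.monom[OF m, of "1/2"] trig_poly.monom[OF lattice_minus[OF m], of "1/2"]] by simp
    have "of_real (Im (phase \<eta> m)) = (-\<i>/2) * phase \<eta> m + (\<i>/2) * phase \<eta> (- m)" for \<eta>
      by (simp add: complex_eq_iff flip: cnj_phase)
    then show "trig_poly (\<lambda>\<eta>. of_real (Im (phase \<eta> m)))"
      using trig_poly.add[OF trig_poly.monom[OF m, of "-\<i>/2"] trig_poly.monom[OF lattice_minus[OF m], of "\<i>/2"]] by simp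
  qed
  have feq: "f (u, v) = Re u * f (1, 0) + Im u * f (\<i>, 0) + (Re v * f (0, 1) + Im v * f (0, \<i>))" for u v
  proof -
    have "(u, v) = Re u *\<^sub>R (1, 0) + Im u *\<^sub>R (\<i>, 0) + (Re v *\<^sub>R (0, 1) + Im v *\<^sub>R (0, \<i>))"
      by (simp add: complex_eq_iff)
    then show ?thesis by (simp only: add scale real_scaleR_def)
  qed
  have "(\<lambda>\<eta>. complex_of_real (f (torus \<eta>))) = (\<lambda>\<eta>.
      complex_of_real (f (1, 0)) * of_real (Re (phase \<eta> 1)) + complex_of_real (f (\<i>, 0)) * of_real (Im (phase \<eta> 1)) +
      (complex_of_real (f (0, 1)) * of_real (Re (phase \<eta> \<i>)) + complex_of_real (f (0, \<i>)) * of_real (Im (phase \<eta> \<i>))))"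
    by (rule ext) (simp only: torus_def feq[of "phase _ 1" "phase _ \<i>"], simp add: mult.commute)
  then show ?case
    by (simp only:) (intro trig_poly.add trig_poly_scale ReIm lattice_1 lattice_i)
next
  case (const c)
  then show ?case by (simp add: trig_poly_const)
next
  case (add f g)
  then show ?case using trig_poly.add by simp
next
  case (mult f g)
  then show ?case using trig_poly_mult by simp
qed

lemma mem_box_real_pair:
  "\<eta> \<in> box (a, b) (c, d :: real) \<longleftrightarrow> (a :: real) < fst \<eta> \<and> fst \<eta> < c \<and> b < snd \<eta> \<and> snd \<eta> < d"
  by (cases \<eta>) (auto simp: mem_box Basis_prod_def)

text \<open>
  Only opposite sides of the square are identified, so a point of the open square has no partner.
\<close>

lemma torus_inj:
  assumes "\<eta> \<in> box (-pi, -pi) (pi, pi)" "\<eta>' \<in> quasimomenta" "torus \<eta> = torus \<eta>'"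
  shows "\<eta> = \<eta>'"
proof -
  have one: "x = y" if xy: "exp (\<i> * of_real x) = exp (\<i> * of_real y)" "-pi < x" "x < pi" "-pi \<le> y" "y \<le> pi" for x y
  proof -
    obtain n where "\<i> * of_real x = \<i> * of_real y + (of_int (2 * n) * pi) * \<i>"
      using xy(1) unfolding exp_eq by blast
    then have "\<i> * of_real x = \<i> * of_real (y + 2 * of_int n * pi)" by (simp add: algebra_simps)
    then have n: "x = y + 2 * of_int n * pi" by (simp only: mult_cancel_left of_real_eq_iff) simp
    then have "of_int n * (2 * pi) = x - y" by simp
    then have "\<bar>of_int n * (2 * pi)\<bar> < 2 * pi" using xy by linarith
    then have "\<bar>real_of_int n\<bar> * (2 * pi) < 1 * (2 * pi)" by (simp add: abs_mult)
    then have "\<bar>real_of_int n\<bar> < 1" by (subst (asm) mult_less_cancel_right_pos) auto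
    then show ?thesis using n by simp
  qed
  have "fst \<eta> = fst \<eta>'" "snd \<eta> = snd \<eta>'"
    using assms by (auto simp: torus_def phase_def quasimomenta_def mem_box_real_pair intro!: one)
  then show ?thesis by (simp add: prod_eq_iff)
qed

text \<open>
  If all Fourier coefficients vanish, so do the integrals against trigonometric polynomials, and by
  Stone-Weierstrass those against continuous functions on the torus. The indicator function of an
  open subset \<open>V\<close> of the open square is a bounded pointwise limit of such functions: take
  \<open>min 1 (n d)\<close> with \<open>d\<close> the distance to the image of the complement of \<open>V\<close>.
\<close>

lemma fourier_uniqueness:
  fixes h :: "real \<times> real \<Rightarrow> complex"
  assumes h: "integrable QQ h"
    and zero: "\<And>m. m \<in> gauss_lattice \<Longrightarrow> (LINT \<eta>|QQ. phase \<eta> m * h \<eta>) = 0"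
  shows "AE \<eta> in QQ. h \<eta> = 0"
proof -
  have [measurable]: "h \<in> borel_measurable QQ" using h by simp
  have trig0: "integrable QQ (\<lambda>\<eta>. p \<eta> * h \<eta>) \<and> (LINT \<eta>|QQ. p \<eta> * h \<eta>) = 0" if "trig_poly p" for p
    using that
  proof induction
    case (monom m c)
    then show ?case using zero integrable_phase_mult[OF h, of m] by (simp add: mult.assoc)
  next
    case (add p q)
    then show ?case by (simp add: ring_distribs)
  qed
  have torus_meas: "(\<lambda>\<eta>. \<phi> (torus \<eta>)) \<in> borel_measurable QQ"
    if "continuous_on UNIV \<phi>" for \<phi> :: "complex \<times> complex \<Rightarrow> real"
    by (intro continuous_imp_measurable_on_sets_lebesgue continuous_on_compose2[OF that continuous_on_torus]) auto
  have cont0: "(LINT \<eta>|QQ. of_real (\<phi> (torus \<eta>)) * h \<eta>) = 0"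
    if \<phi>: "continuous_on UNIV \<phi>" and bd: "\<And>x. \<bar>\<phi> x\<bar> \<le> 1" for \<phi> :: "complex \<times> complex \<Rightarrow> real"
  proof -
    note [measurable] = torus_meas[OF \<phi>]
    have i1: "integrable QQ (\<lambda>\<eta>. of_real (\<phi> (torus \<eta>)) * h \<eta>)"
      by (rule Bochner_Integration.integrable_bound[OF h]) (auto simp: norm_mult mult_left_le_one_le bd)
    have bound: "cmod (LINT \<eta>|QQ. of_real (\<phi> (torus \<eta>)) * h \<eta>) \<le> 0 + e" if e: "e > 0" for e
    proof -
      define I where "I = (LINT \<eta>|QQ. cmod (h \<eta>))"
      have I: "I \<ge> 0" by (simp add: I_def)
      define d where "d = e / (I + 1)"
      have d: "d > 0" using e I by (simp add: d_def)
      have "compact (torus ` quasimomenta)"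
        unfolding quasimomenta_cbox by (intro compact_continuous_image continuous_on_torus) simp
      then obtain g where g: "real_polynomial_function g"
        and gd: "\<And>x. x \<in> torus ` quasimomenta \<Longrightarrow> \<bar>\<phi> x - g x\<bar> < d"
        using Stone_Weierstrass_real_polynomial_function[OF _ continuous_on_subset[OF \<phi>] d] by blast
      note t = trig0[OF trig_poly_real_polynomial[OF g]]
      have "(LINT \<eta>|QQ. of_real (\<phi> (torus \<eta>)) * h \<eta>)
          = (LINT \<eta>|QQ. of_real (\<phi> (torus \<eta>)) * h \<eta> - of_real (g (torus \<eta>)) * h \<eta>)"
        using t i1 by simp
      also have "cmod \<dots> \<le> (LINT \<eta>|QQ. d * cmod (h \<eta>))"
      proof (rule Bochner_Integration.integral_norm_bound_integral)
        fix \<eta> assume "\<eta> \<in> space QQ"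
        then have "\<bar>\<phi> (torus \<eta>) - g (torus \<eta>)\<bar> \<le> d" using gd[of "torus \<eta>"] by simp
        moreover have "of_real (\<phi> (torus \<eta>)) * h \<eta> - of_real (g (torus \<eta>)) * h \<eta>
            = of_real (\<phi> (torus \<eta>) - g (torus \<eta>)) * h \<eta>" by (simp add: algebra_simps)
        ultimately show "norm (of_real (\<phi> (torus \<eta>)) * h \<eta> - of_real (g (torus \<eta>)) * h \<eta>) \<le> d * cmod (h \<eta>)"
          by (simp only: norm_mult norm_of_real) (simp add: mult_right_mono)
      qed (use t i1 h in auto)
      also have "\<dots> = d * I" by (simp add: I_def)
      also have "\<dots> \<le> e" using e I by (simp add: d_def field_simps)
      finally show ?thesis by simp
    qed
    have "cmod (LINT \<eta>|QQ. of_real (\<phi> (torus \<eta>)) * h \<eta>) \<le> 0"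
      by (rule field_le_epsilon[OF bound])
    then show ?thesis by simp
  qed
  define B where "B = box (-pi, -pi) (pi, pi :: real)"
  have open0: "(LINT \<eta>|QQ. of_real (indicator (V \<inter> B) \<eta>) * h \<eta>) = 0" if V: "open V" for V
  proof -
    define K where "K = torus ` (quasimomenta - (V \<inter> B))"
    have "compact (quasimomenta - (V \<inter> B))"
      unfolding quasimomenta_cbox B_def using V by (intro compact_diff) auto
    then have cK: "closed K" unfolding K_def by (intro compact_imp_closed compact_continuous_image continuous_on_torus)
    have "(pi, pi) \<in> quasimomenta - (V \<inter> B)" by (auto simp: quasimomenta_def B_def mem_box_real_pair)
    then have neK: "K \<noteq> {}" unfolding K_def by blast
    \<comment> \<open>injectivity of the quotient map keeps the image of the complement away from \<open>V\<close>\<close>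
    have dist0: "infdist (torus \<eta>) K = 0 \<longleftrightarrow> \<eta> \<notin> V \<inter> B" if \<eta>: "\<eta> \<in> quasimomenta" for \<eta>
    proof -
      have "infdist (torus \<eta>) K = 0 \<longleftrightarrow> torus \<eta> \<in> K" using in_closed_iff_infdist_zero[OF cK neK] by simp
      also have "\<dots> \<longleftrightarrow> \<eta> \<notin> V \<inter> B"
        using torus_inj \<eta> unfolding K_def B_def by blast
      finally show ?thesis .
    qed
    define \<phi> where "\<phi> = (\<lambda>n x. min 1 (real n * infdist x K))"
    have \<phi>: "continuous_on UNIV (\<phi> n)" "\<bar>\<phi> n x\<bar> \<le> 1" for n x
      unfolding \<phi>_def by (auto intro!: continuous_intros simp: infdist_nonneg)
    have "(\<lambda>n. LINT \<eta>|QQ. of_real (\<phi> n (torus \<eta>)) * h \<eta>) \<longlonglongrightarrow> (LINT \<eta>|QQ. of_real (indicator (V \<inter> B) \<eta>) * h \<eta>)"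
    proof (rule integral_dominated_convergence[where w = "\<lambda>\<eta>. cmod (h \<eta>)"])
      have "V \<inter> B \<in> sets lebesgue" using V by (auto simp: B_def)
      then have "V \<inter> B \<inter> quasimomenta \<in> sets QQ" by (auto simp: sets_restrict_space)
      then have "(\<lambda>\<eta>. indicator (V \<inter> B) \<eta> :: real) \<in> borel_measurable QQ"
        by (subst borel_measurable_indicator_iff) simp
      then show "(\<lambda>\<eta>. of_real (indicator (V \<inter> B) \<eta>) * h \<eta>) \<in> borel_measurable QQ" by measurable
      show "(\<lambda>\<eta>. of_real (\<phi> n (torus \<eta>)) * h \<eta>) \<in> borel_measurable QQ" for n
        using torus_meas[OF \<phi>(1)[of n]] by measurable
      show "AE \<eta> in QQ. (\<lambda>n. of_real (\<phi> n (torus \<eta>)) * h \<eta>) \<longlonglongrightarrow> of_real (indicator (V \<inter> B) \<eta>) * h \<eta>"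
      proof (rule AE_I2)
        fix \<eta> assume "\<eta> \<in> space QQ"
        then have \<eta>: "\<eta> \<in> quasimomenta" by simp
        have "(\<lambda>n. \<phi> n (torus \<eta>)) \<longlonglongrightarrow> indicator (V \<inter> B) \<eta>"
        proof (cases "\<eta> \<in> V \<inter> B")
          case True
          then have pos: "infdist (torus \<eta>) K > 0" using dist0[OF \<eta>] infdist_nonneg[of "torus \<eta>" K] by linarith
          obtain n0 where n0: "1 \<le> real n0 * infdist (torus \<eta>) K"
            using reals_Archimedean3[OF pos] less_imp_le by blast
          have "\<phi> n (torus \<eta>) = 1" if "n \<ge> n0" for n
          proof -
            have "real n0 * infdist (torus \<eta>) K \<le> real n * infdist (torus \<eta>) K"
              using that pos by (intro mult_right_mono) auto
            then show ?thesis using n0 by (simp add: \<phi>_def)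
          qed
          then show ?thesis using True
            by (intro tendsto_eventually) (auto simp: eventually_sequentially)
        next
          case False
          then show ?thesis using dist0[OF \<eta>] by (simp add: \<phi>_def)
        qed
        then show "(\<lambda>n. of_real (\<phi> n (torus \<eta>)) * h \<eta>) \<longlonglongrightarrow> of_real (indicator (V \<inter> B) \<eta>) * h \<eta>"
          by (intro tendsto_intros)
      qed
      show "AE \<eta> in QQ. norm (of_real (\<phi> n (torus \<eta>)) * h \<eta>) \<le> cmod (h \<eta>)" for n
        using \<phi>(2) by (auto simp: norm_mult mult_left_le_one_le)
    qed (use h in auto)
    moreover have "(\<lambda>n. LINT \<eta>|QQ. of_real (\<phi> n (torus \<eta>)) * h \<eta>) \<longlonglongrightarrow> 0"
      by (simp add: cont0[OF \<phi>])
    ultimately show ?thesis by (rule LIMSEQ_unique)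
  qed
  define h' where "h' = (\<lambda>\<eta>. if \<eta> \<in> quasimomenta then h \<eta> else 0)"
  have h': "integrable lebesgue h'" unfolding h'_def using h by (subst Lebesgue_Measure.integrable_restrict_UNIV) auto
  have bd0: "AE \<eta> in lebesgue. \<eta> \<in> quasimomenta \<longrightarrow> \<eta> \<in> B"
  proof -
    have "negligible (quasimomenta - B)"
      unfolding quasimomenta_cbox B_def by (rule negligible_frontier_interval)
    then have "AE \<eta> in lebesgue. \<eta> \<notin> quasimomenta - B"
      unfolding negligible_iff_null_sets by (rule AE_not_in)
    then show ?thesis by eventually_elim auto
  qed
  have V0: "(LINT \<eta>|lebesgue. of_real (indicator V \<eta>) * h' \<eta>) = 0" if V: "open V" for V
  proof -
    have mV: "(\<lambda>\<eta>. indicator W \<eta> :: real) \<in> borel_measurable lebesgue" if "open W" for W :: "(real \<times> real) set"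
      using that by (intro borel_measurable_indicator) simp
    have "(LINT \<eta>|lebesgue. of_real (indicator V \<eta>) * h' \<eta>) = (LINT \<eta>|lebesgue. of_real (indicator (V \<inter> B) \<eta>) * h' \<eta>)"
    proof (rule integral_cong_AE)
      show "AE \<eta> in lebesgue. of_real (indicator V \<eta>) * h' \<eta> = of_real (indicator (V \<inter> B) \<eta>) * h' \<eta>"
        using bd0 by eventually_elim (auto simp: h'_def indicator_def)
      have "open (V \<inter> B)" using V by (auto simp: B_def)
      note [measurable] = mV[OF \<open>open (V \<inter> B)\<close>] mV[OF V]
      have [measurable]: "h' \<in> borel_measurable lebesgue" using h' by simp
      show "(\<lambda>\<eta>. of_real (indicator V \<eta>) * h' \<eta>) \<in> borel_measurable lebesgue"
        "(\<lambda>\<eta>. of_real (indicator (V \<inter> B) \<eta>) * h' \<eta>) \<in> borel_measurable lebesgue" by measurable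
    qed
    also have "\<dots> = (LINT \<eta>|lebesgue. (if \<eta> \<in> quasimomenta then of_real (indicator (V \<inter> B) \<eta>) * h \<eta> else 0))"
      by (intro Bochner_Integration.integral_cong) (auto simp: h'_def)
    also have "\<dots> = (LINT \<eta>|QQ. of_real (indicator (V \<inter> B) \<eta>) * h \<eta>)"
      by (rule Lebesgue_Measure.integral_restrict_UNIV) simp
    finally show ?thesis using open0[OF V] by simp
  qed
  have iV: "integrable lebesgue (\<lambda>\<eta>. of_real (indicator V \<eta>) * h' \<eta>)" if "open V" for V
    using integrable_mult_indicator[OF _ h', of V] that by (simp add: scaleR_conv_of_real)
  have "AE \<eta> in lebesgue. Re (h' \<eta>) = 0"
  proof (rule AE_zero_if_open_integrals_zero)
    fix V :: "(real \<times> real) set" assume V: "open V"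
    have "(LINT x|lebesgue. indicator V x * Re (h' x)) = (LINT x|lebesgue. Re (of_real (indicator V x) * h' x))" by simp
    also have "\<dots> = Re (LINT x|lebesgue. of_real (indicator V x) * h' x)" by (rule integral_Re[OF iV[OF V]])
    finally show "(LINT x|lebesgue. indicator V x * Re (h' x)) = 0" using V0[OF V] by simp
  qed (use h' in auto)
  moreover have "AE \<eta> in lebesgue. Im (h' \<eta>) = 0"
  proof (rule AE_zero_if_open_integrals_zero)
    fix V :: "(real \<times> real) set" assume V: "open V"
    have "(LINT x|lebesgue. indicator V x * Im (h' x)) = (LINT x|lebesgue. Im (of_real (indicator V x) * h' x))" by simp
    also have "\<dots> = Im (LINT x|lebesgue. of_real (indicator V x) * h' x)" by (rule integral_Im[OF iV[OF V]])
    finally show "(LINT x|lebesgue. indicator V x * Im (h' x)) = 0" using V0[OF V] by simp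
  qed (use h' in auto)
  ultimately have "AE \<eta> in lebesgue. \<eta> \<in> quasimomenta \<longrightarrow> h \<eta> = 0"
    by eventually_elim (auto simp: h'_def complex_eq_iff)
  then show ?thesis by (simp add: AE_restrict_space_iff)
qed

section \<open>Jointly measurable versions of Bochner functions\<close>

lemma l2sq_finite_iff:
  assumes [measurable]: "u \<in> borel_measurable M"
  shows "l2sq M u < \<infinity> \<longleftrightarrow> integrable M (\<lambda>x. (cmod (u x))\<^sup>2)"
  unfolding l2sq_def by (subst integrable_iff_bounded) auto

lemma l2sq_lincomb_le:
  assumes [measurable]: "u \<in> borel_measurable M" "v \<in> borel_measurable M"
  shows "l2sq M (\<lambda>x. a * u x + b * v x)
    \<le> 2 * (ennreal ((cmod a)\<^sup>2) * l2sq M u) + 2 * (ennreal ((cmod b)\<^sup>2) * l2sq M v)"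
  using l2sq_add_le[of "\<lambda>x. a * u x" M "\<lambda>x. b * v x"] by (simp add: l2sq_scale)

lemma QQ_measurable_AE:
  fixes f g :: "real \<times> real \<Rightarrow> 'b::euclidean_space"
  assumes f: "f \<in> borel_measurable QQ" and ae: "AE \<eta> in QQ. f \<eta> = g \<eta>"
  shows "g \<in> borel_measurable QQ"
proof -
  have ae': "AE \<eta> in lebesgue. (if \<eta> \<in> quasimomenta then f \<eta> else 0) = (if \<eta> \<in> quasimomenta then g \<eta> else 0)"
    using ae by (simp add: AE_restrict_space_iff)
  have "(\<lambda>\<eta>. if \<eta> \<in> quasimomenta then f \<eta> else 0) \<in> borel_measurable lebesgue"
    by (rule borel_measurable_if_I[OF f]) simp
  from borel_measurable_AE[OF this ae'] show ?thesis by (rule borel_measurable_if_D)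
qed

lemma A2_subset_L2: "A2 D \<subseteq> L2 D" by (auto simp: A2_def)

lemma Bochner_L2_mono: "X \<subseteq> Y \<Longrightarrow> Bochner_L2 D X \<subseteq> Bochner_L2 D Y"
  unfolding Bochner_L2_def by (auto elim!: eventually_mono) blast

lemma L2_lincomb:
  assumes "u \<in> L2 D" "v \<in> L2 D" shows "(\<lambda>z. a * u z + b * v z) \<in> L2 D"
  using assms l2sq_lincomb_le[of u "lebesgue_on D" v a b]
  by (auto simp: L2_iff ennreal_mult_less_top elim!: le_less_trans)

lemma A2_lincomb:
  assumes "u \<in> A2 D" "v \<in> A2 D" shows "(\<lambda>z. a * u z + b * v z) \<in> A2 D"
  using assms L2_lincomb[of u D v a b] by (auto simp: A2_def intro!: holomorphic_intros)

lemma L2_diff: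
  assumes "u \<in> L2 D" "v \<in> L2 D" shows "(\<lambda>z. u z - v z) \<in> L2 D"
  using L2_lincomb[OF assms, of 1 "-1"] by simp

context cell_setting
begin

abbreviation "MM \<equiv> lebesgue_on \<omega>"

lemma cell_lmeasurable: "\<omega> \<in> lmeasurable"
proof -
  have "\<omega> \<subseteq> cbox 0 (Complex 1 1)"
    using cell_subset by (auto simp: unit_square_def in_cbox_complex_iff less_imp_le)
  then have "bounded \<omega>" using bounded_subset bounded_cbox by blast
  then show ?thesis using open_cell lmeasurable_open by blast
qed

lemma finite_measure_MM: "finite_measure MM"
  by (rule finite_measure_lebesgue_on[OF cell_lmeasurable])

lemma pair_sigma_finite_MM_QQ: "pair_sigma_finite MM QQ"
  using finite_measure_MM finite_measure_QQ
  by (simp add: pair_sigma_finite_def finite_measure.axioms(1))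

sublocale MQ: pair_sigma_finite MM QQ by (rule pair_sigma_finite_MM_QQ)

definition pair_sq :: "(complex \<times> real \<times> real \<Rightarrow> complex) \<Rightarrow> ennreal" where
  "pair_sq u = (\<integral>\<^sup>+\<eta>. l2sq MM (\<lambda>z. u (z, \<eta>)) \<partial>QQ)"

text \<open>
  Elements of the Bochner spaces are only measurable in \<open>\<eta>\<close> with values in \<open>L\<^sup>2\<close>. Exchanging the
  integrals over \<open>z\<close> and \<open>\<eta>\<close> needs a function measurable in both variables. For almost every \<open>\<eta>\<close> it
  must agree at every \<open>z\<close>, since the values of analytic functions at points matter.
\<close>

definition joint_version :: "(complex \<times> real \<times> real \<Rightarrow> complex) \<Rightarrow> (complex \<times> real \<times> real \<Rightarrow> complex) \<Rightarrow> bool" where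
  "joint_version u u' \<longleftrightarrow> u' \<in> borel_measurable (MM \<Otimes>\<^sub>M QQ) \<and> (AE \<eta> in QQ. \<forall>z\<in>\<omega>. u (z, \<eta>) = u' (z, \<eta>))"

lemma l2sq_MM_cong: "(\<And>z. z \<in> \<omega> \<Longrightarrow> f z = g z) \<Longrightarrow> l2sq MM f = l2sq MM g"
  unfolding l2sq_def by (intro nn_integral_cong) simp

lemma joint_version_self: "u \<in> borel_measurable (MM \<Otimes>\<^sub>M QQ) \<Longrightarrow> joint_version u u"
  by (simp add: joint_version_def)

lemma joint_version_lincomb:
  assumes "joint_version u u'" "joint_version v v'"
  shows "joint_version (\<lambda>p. a * u p + b * v p) (\<lambda>p. a * u' p + b * v' p)"
proof -
  have [measurable]: "u' \<in> borel_measurable (MM \<Otimes>\<^sub>M QQ)" "v' \<in> borel_measurable (MM \<Otimes>\<^sub>M QQ)"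
    and ae: "AE \<eta> in QQ. \<forall>z\<in>\<omega>. u (z, \<eta>) = u' (z, \<eta>)" "AE \<eta> in QQ. \<forall>z\<in>\<omega>. v (z, \<eta>) = v' (z, \<eta>)"
    using assms by (auto simp: joint_version_def)
  from ae have "AE \<eta> in QQ. \<forall>z\<in>\<omega>. a * u (z, \<eta>) + b * v (z, \<eta>) = a * u' (z, \<eta>) + b * v' (z, \<eta>)"
    by eventually_elim simp
  then show ?thesis unfolding joint_version_def by simp
qed

lemma joint_version_diff:
  assumes "joint_version u u'" "joint_version v v'" shows "joint_version (\<lambda>p. u p - v p) (\<lambda>p. u' p - v' p)"
  using joint_version_lincomb[OF assms, of 1 "-1"] by simp

lemma pair_sq_version:
  assumes "joint_version u u'" shows "pair_sq u = l2sq (MM \<Otimes>\<^sub>M QQ) u'"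
proof -
  have [measurable]: "u' \<in> borel_measurable (MM \<Otimes>\<^sub>M QQ)" and ae: "AE \<eta> in QQ. \<forall>z\<in>\<omega>. u (z, \<eta>) = u' (z, \<eta>)"
    using assms by (auto simp: joint_version_def)
  have "pair_sq u = (\<integral>\<^sup>+\<eta>. l2sq MM (\<lambda>z. u' (z, \<eta>)) \<partial>QQ)"
    unfolding pair_sq_def by (rule nn_integral_cong_AE) (use ae in \<open>eventually_elim, auto intro: l2sq_MM_cong\<close>)
  also have "\<dots> = l2sq (MM \<Otimes>\<^sub>M QQ) u'"
    unfolding l2sq_def by (rule MQ.nn_integral_snd) measurable
  finally show ?thesis .
qed

lemma pair_sq_version_swap:
  assumes "joint_version u u'" shows "pair_sq u = (\<integral>\<^sup>+z. l2sq QQ (\<lambda>\<eta>. u' (z, \<eta>)) \<partial>MM)"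
proof -
  have [measurable]: "u' \<in> borel_measurable (MM \<Otimes>\<^sub>M QQ)" using assms by (auto simp: joint_version_def)
  show ?thesis
    unfolding pair_sq_version[OF assms] l2sq_def
    by (rule MQ.M2.nn_integral_fst[symmetric]) measurable
qed

lemma pair_sq_lincomb_le:
  assumes "joint_version u u'" "joint_version v v'"
  shows "pair_sq (\<lambda>p. a * u p + b * v p)
    \<le> 2 * (ennreal ((cmod a)\<^sup>2) * pair_sq u) + 2 * (ennreal ((cmod b)\<^sup>2) * pair_sq v)"
  unfolding pair_sq_version[OF assms(1)] pair_sq_version[OF assms(2)] pair_sq_version[OF joint_version_lincomb[OF assms]]
  by (rule l2sq_lincomb_le) (use assms in \<open>auto simp: joint_version_def\<close>)

lemma pair_sq_diff_le:
  assumes "joint_version u u'" "joint_version v v'"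
  shows "pair_sq (\<lambda>p. u p - v p) \<le> 2 * pair_sq u + 2 * pair_sq v"
  using pair_sq_lincomb_le[OF assms, of 1 "-1"] by simp

lemma joint_version_slice_measurable:
  assumes "joint_version u u'"
  shows "AE \<eta> in QQ. (\<lambda>z. u (z, \<eta>)) \<in> borel_measurable MM"
proof -
  have [measurable]: "u' \<in> borel_measurable (MM \<Otimes>\<^sub>M QQ)" and ae: "AE \<eta> in QQ. \<forall>z\<in>\<omega>. u (z, \<eta>) = u' (z, \<eta>)"
    using assms by (auto simp: joint_version_def)
  have "AE \<eta> in QQ. \<eta> \<in> space QQ" by (rule AE_space)
  with ae show ?thesis
  proof eventually_elim
    case (elim \<eta>)
    then have "(\<lambda>z. u' (z, \<eta>)) \<in> borel_measurable MM" by simp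
    moreover have "(\<lambda>z. u (z, \<eta>)) \<in> borel_measurable MM \<longleftrightarrow> (\<lambda>z. u' (z, \<eta>)) \<in> borel_measurable MM"
      using elim by (intro measurable_cong) simp
    ultimately show ?case by simp
  qed
qed

text \<open>
  \<open>Bochner_norm\<close> is an integral with default value \<open>0\<close>; finiteness of \<open>pair_sq\<close> guarantees that it
  is the true norm.
\<close>

lemma joint_version_norm_sq:
  assumes u: "joint_version u u'" and fin: "pair_sq u < \<infinity>"
  shows "integrable QQ (\<lambda>\<eta>. (L2_norm \<omega> (\<lambda>z. u (z, \<eta>)))\<^sup>2)"
    and "ennreal ((Bochner_norm \<omega> u)\<^sup>2) = pair_sq u"
    and "AE \<eta> in QQ. (\<lambda>z. u (z, \<eta>)) \<in> L2 \<omega>"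
proof -
  have m[measurable]: "u' \<in> borel_measurable (MM \<Otimes>\<^sub>M QQ)" and ae: "AE \<eta> in QQ. \<forall>z\<in>\<omega>. u (z, \<eta>) = u' (z, \<eta>)"
    using u by (auto simp: joint_version_def)
  have lm[measurable]: "(\<lambda>\<eta>. l2sq MM (\<lambda>z. u' (z, \<eta>))) \<in> borel_measurable QQ"
    unfolding l2sq_def by measurable
  have pair: "pair_sq u = (\<integral>\<^sup>+\<eta>. l2sq MM (\<lambda>z. u' (z, \<eta>)) \<partial>QQ)"
    unfolding pair_sq_def by (rule nn_integral_cong_AE) (use ae in \<open>eventually_elim, auto intro: l2sq_MM_cong\<close>)
  have finAE: "AE \<eta> in QQ. l2sq MM (\<lambda>z. u' (z, \<eta>)) \<noteq> \<infinity>"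
    using fin unfolding pair by (intro nn_integral_PInf_AE) auto
  show L2: "AE \<eta> in QQ. (\<lambda>z. u (z, \<eta>)) \<in> L2 \<omega>"
    using ae finAE joint_version_slice_measurable[OF u]
  proof eventually_elim
    case (elim \<eta>)
    have "l2sq MM (\<lambda>z. u (z, \<eta>)) = l2sq MM (\<lambda>z. u' (z, \<eta>))" using elim by (intro l2sq_MM_cong) simp
    then show ?case using elim by (simp add: L2_iff less_top)
  qed
  have eq: "AE \<eta> in QQ. enn2real (l2sq MM (\<lambda>z. u' (z, \<eta>))) = (L2_norm \<omega> (\<lambda>z. u (z, \<eta>)))\<^sup>2"
    using ae L2
  proof eventually_elim
    case (elim \<eta>)
    have "l2sq MM (\<lambda>z. u (z, \<eta>)) = l2sq MM (\<lambda>z. u' (z, \<eta>))" using elim by (intro l2sq_MM_cong) simp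
    then show ?case using elim L2_norm_sq[of "\<lambda>z. u (z, \<eta>)" \<omega>] by (metis enn2real_ennreal zero_le_power2)
  qed
  have meas: "(\<lambda>\<eta>. (L2_norm \<omega> (\<lambda>z. u (z, \<eta>)))\<^sup>2) \<in> borel_measurable QQ"
    by (rule QQ_measurable_AE[OF _ eq]) measurable
  have nn: "(\<integral>\<^sup>+\<eta>. ennreal ((L2_norm \<omega> (\<lambda>z. u (z, \<eta>)))\<^sup>2) \<partial>QQ) = pair_sq u"
    unfolding pair_sq_def
  proof (rule nn_integral_cong_AE)
    show "AE \<eta> in QQ. ennreal ((L2_norm \<omega> (\<lambda>z. u (z, \<eta>)))\<^sup>2) = l2sq MM (\<lambda>z. u (z, \<eta>))"
      using L2 by eventually_elim (rule L2_norm_sq)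
  qed
  show int: "integrable QQ (\<lambda>\<eta>. (L2_norm \<omega> (\<lambda>z. u (z, \<eta>)))\<^sup>2)"
    using meas nn fin by (subst integrable_iff_bounded) auto
  have "ennreal (LINT \<eta>|QQ. (L2_norm \<omega> (\<lambda>z. u (z, \<eta>)))\<^sup>2) = pair_sq u"
    using nn nn_integral_eq_integral[OF int] by simp
  then show "ennreal ((Bochner_norm \<omega> u)\<^sup>2) = pair_sq u"
    by (simp add: Bochner_norm_def)
qed

lemma Bochner_inner_version:
  assumes u: "joint_version u u'" "pair_sq u < \<infinity>" and v: "joint_version v v'" "pair_sq v < \<infinity>"
  shows "Bochner_inner \<omega> u v = (LINT p|(MM \<Otimes>\<^sub>M QQ). u' p * cnj (v' p))"
proof -
  have [measurable]: "u' \<in> borel_measurable (MM \<Otimes>\<^sub>M QQ)" "v' \<in> borel_measurable (MM \<Otimes>\<^sub>M QQ)"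
    and ae: "AE \<eta> in QQ. \<forall>z\<in>\<omega>. u (z, \<eta>) = u' (z, \<eta>)" "AE \<eta> in QQ. \<forall>z\<in>\<omega>. v (z, \<eta>) = v' (z, \<eta>)"
    using u v by (auto simp: joint_version_def)
  have "integrable (MM \<Otimes>\<^sub>M QQ) (\<lambda>p. u' p * cnj (v' p))"
  proof (rule integrable_mult_of_squares)
    show "integrable (MM \<Otimes>\<^sub>M QQ) (\<lambda>p. (cmod (u' p))\<^sup>2)"
      using u pair_sq_version[OF u(1)] l2sq_finite_iff[of u' "MM \<Otimes>\<^sub>M QQ"] by simp
    show "integrable (MM \<Otimes>\<^sub>M QQ) (\<lambda>p. (cmod (cnj (v' p)))\<^sup>2)"
      using v pair_sq_version[OF v(1)] l2sq_finite_iff[of v' "MM \<Otimes>\<^sub>M QQ"] by simp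
  qed measurable
  then have int: "integrable (MM \<Otimes>\<^sub>M QQ) (\<lambda>(z, \<eta>). u' (z, \<eta>) * cnj (v' (z, \<eta>)))"
    by (simp add: split_beta')
  define I where "I = (\<lambda>\<eta>. LINT z|MM. u' (z, \<eta>) * cnj (v' (z, \<eta>)))"
  have Im: "I \<in> borel_measurable QQ" using MQ.integrable_snd[OF int] unfolding I_def by simp
  have eq: "AE \<eta> in QQ. I \<eta> = L2_inner \<omega> (\<lambda>z. u (z, \<eta>)) (\<lambda>z. v (z, \<eta>))"
    using ae
  proof eventually_elim
    case (elim \<eta>)
    then show ?case unfolding I_def L2_inner_def by (intro Bochner_Integration.integral_cong) auto
  qed
  have "Bochner_inner \<omega> u v = (LINT \<eta>|QQ. I \<eta>)"
    unfolding Bochner_inner_def using eq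
    by (intro integral_cong_AE QQ_measurable_AE[OF Im eq] Im) (auto elim!: eventually_mono)
  also have "\<dots> = (LINT p|(MM \<Otimes>\<^sub>M QQ). u' p * cnj (v' p))"
    unfolding I_def using MQ.integral_snd[OF int] by (simp add: split_beta')
  finally show ?thesis .
qed

text \<open>
  Strong measurability of an \<open>A2 \<omega>\<close>-valued function.
\<close>

definition approximable :: "(complex \<times> real \<times> real \<Rightarrow> complex) \<Rightarrow> bool" where
  "approximable g \<longleftrightarrow> (\<exists>s :: nat \<Rightarrow> real \<times> real \<Rightarrow> complex \<Rightarrow> complex.
     (\<forall>n. finite (s n ` quasimomenta) \<and> s n ` quasimomenta \<subseteq> A2 \<omega> \<and>
       (\<forall>h. {\<eta> \<in> quasimomenta. s n \<eta> = h} \<in> sets lebesgue)) \<and>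
     (AE \<eta> in QQ. (\<lambda>n. L2_norm \<omega> (\<lambda>z. s n \<eta> z - g (z, \<eta>))) \<longlonglongrightarrow> 0))"

lemma Bochner_A2_iff:
  "g \<in> Bochner_L2 \<omega> (A2 \<omega>) \<longleftrightarrow> (AE \<eta> in QQ. (\<lambda>z. g (z, \<eta>)) \<in> A2 \<omega>) \<and> approximable g \<and>
     integrable QQ (\<lambda>\<eta>. (L2_norm \<omega> (\<lambda>z. g (z, \<eta>)))\<^sup>2)"
  by (simp add: Bochner_L2_def approximable_def)

lemma simple_measurable_pair:
  fixes s :: "real \<times> real \<Rightarrow> complex \<Rightarrow> complex"
  assumes fin: "finite (s ` quasimomenta)" and A2: "s ` quasimomenta \<subseteq> A2 \<omega>"
    and lev: "\<And>h. {\<eta> \<in> quasimomenta. s \<eta> = h} \<in> sets lebesgue"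
  shows "(\<lambda>(z, \<eta>). s \<eta> z) \<in> borel_measurable (MM \<Otimes>\<^sub>M QQ)"
proof -
  let ?E = "\<lambda>h. {\<eta> \<in> quasimomenta. s \<eta> = h}"
  have "(\<lambda>p. \<Sum>h\<in>s ` quasimomenta. h (fst p) * indicator (?E h) (snd p)) \<in> borel_measurable (MM \<Otimes>\<^sub>M QQ)"
  proof (rule borel_measurable_sum)
    fix h assume "h \<in> s ` quasimomenta"
    then have [measurable]: "h \<in> borel_measurable MM" using A2 by (auto simp: A2_def L2_def)
    have "?E h \<in> sets QQ" using lev by (subst sets_restrict_space_iff) auto
    then have [measurable]: "(\<lambda>\<eta>. indicator (?E h) \<eta> :: complex) \<in> borel_measurable QQ"
      by (rule borel_measurable_indicator)
    show "(\<lambda>p. h (fst p) * indicator (?E h) (snd p)) \<in> borel_measurable (MM \<Otimes>\<^sub>M QQ)"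
      by measurable
  qed
  moreover have "(\<Sum>h\<in>s ` quasimomenta. h (fst p) * indicator (?E h) (snd p)) = (\<lambda>(z, \<eta>). s \<eta> z) p"
    if "p \<in> space (MM \<Otimes>\<^sub>M QQ)" for p
  proof -
    define z \<eta> where "z = fst p" and "\<eta> = snd p"
    then have p: "p = (z, \<eta>)" "\<eta> \<in> quasimomenta" using that by (auto simp: space_pair_measure)
    have "(\<Sum>h\<in>s ` quasimomenta. h z * indicator (?E h) \<eta>) = (\<Sum>h\<in>s ` quasimomenta. if h = s \<eta> then h z else 0)"
      using p by (intro sum.cong refl) (auto simp: indicator_def)
    also have "\<dots> = s \<eta> z" using fin p by simp
    finally show ?thesis using p by simp
  qed
  ultimately show ?thesis by (subst (asm) measurable_cong) auto
qed

text \<open>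
  By Bergman's inequality the simple functions, which are jointly measurable, converge at every
  point of the cell and not only in norm.
\<close>

lemma approximable_version:
  assumes A2: "AE \<eta> in QQ. (\<lambda>z. g (z, \<eta>)) \<in> A2 \<omega>" and g: "approximable g"
  obtains g' where "joint_version g g'"
proof -
  obtain s :: "nat \<Rightarrow> real \<times> real \<Rightarrow> complex \<Rightarrow> complex" where
    s: "\<And>n. finite (s n ` quasimomenta)" "\<And>n. s n ` quasimomenta \<subseteq> A2 \<omega>"
      "\<And>n h. {\<eta> \<in> quasimomenta. s n \<eta> = h} \<in> sets lebesgue"
    and lim: "AE \<eta> in QQ. (\<lambda>n. L2_norm \<omega> (\<lambda>z. s n \<eta> z - g (z, \<eta>))) \<longlonglongrightarrow> 0"
    using g unfolding approximable_def by blast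
  define S where "S = (\<lambda>n. \<lambda>(z, \<eta>). s n \<eta> z)"
  have [measurable]: "S n \<in> borel_measurable (MM \<Otimes>\<^sub>M QQ)" for n
    unfolding S_def by (rule simple_measurable_pair[OF s])
  have "AE \<eta> in QQ. \<eta> \<in> space QQ" by (rule AE_space)
  with A2 lim have "AE \<eta> in QQ. \<forall>z\<in>\<omega>. g (z, \<eta>) = lim (\<lambda>n. S n (z, \<eta>))"
  proof eventually_elim
    case (elim \<eta>)
    show ?case
    proof
      fix z assume z: "z \<in> \<omega>"
      obtain C where C: "C \<ge> 0" "\<forall>G. G holomorphic_on \<omega> \<longrightarrow> ennreal ((cmod (G z))\<^sup>2) \<le> ennreal C * l2sq MM G"
        using bergman_estimate[OF open_cell z] by blast
      have sA2: "s n \<eta> \<in> A2 \<omega>" for n using s(2) elim by auto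
      have "(\<lambda>n. ennreal ((L2_norm \<omega> (\<lambda>z. s n \<eta> z - g (z, \<eta>)))\<^sup>2)) \<longlonglongrightarrow> ennreal (0\<^sup>2)"
        using elim by (intro tendsto_intros)
      then have lim0: "(\<lambda>n. ennreal ((L2_norm \<omega> (\<lambda>z. s n \<eta> z - g (z, \<eta>)))\<^sup>2)) \<longlonglongrightarrow> 0" by simp
      have "(\<lambda>n. s n \<eta> z) \<longlonglongrightarrow> g (z, \<eta>)"
      proof (rule tendsto_of_l2sq_bound[OF _ C(1) lim0])
        fix n
        have "(\<lambda>z. s n \<eta> z - g (z, \<eta>)) \<in> L2 \<omega>"
          using sA2[of n] elim A2_subset_L2 by (intro L2_diff) auto
        then have "ennreal ((L2_norm \<omega> (\<lambda>z. s n \<eta> z - g (z, \<eta>)))\<^sup>2) = l2sq MM (\<lambda>z. s n \<eta> z - g (z, \<eta>))"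
          by (rule L2_norm_sq)
        moreover have "(\<lambda>z. s n \<eta> z - g (z, \<eta>)) holomorphic_on \<omega>"
          using sA2[of n] elim by (auto simp: A2_def intro!: holomorphic_intros)
        ultimately show "ennreal ((cmod (s n \<eta> z - g (z, \<eta>)))\<^sup>2)
          \<le> ennreal C * ennreal ((L2_norm \<omega> (\<lambda>z. s n \<eta> z - g (z, \<eta>)))\<^sup>2)"
          using C(2)[rule_format, of "\<lambda>z. s n \<eta> z - g (z, \<eta>)"] by simp
      qed
      then show "g (z, \<eta>) = lim (\<lambda>n. S n (z, \<eta>))" by (simp add: S_def limI)
    qed
  qed
  moreover have "(\<lambda>p. lim (\<lambda>n. S n p)) \<in> borel_measurable (MM \<Otimes>\<^sub>M QQ)"
    by (rule borel_measurable_lim_metric) measurable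
  ultimately have "joint_version g (\<lambda>p. lim (\<lambda>n. S n p))" by (simp add: joint_version_def)
  then show thesis by (rule that)
qed

lemma Bochner_A2_version:
  assumes "g \<in> Bochner_L2 \<omega> (A2 \<omega>)"
  obtains g' where "joint_version g g'" "pair_sq g < \<infinity>"
proof -
  have A2: "AE \<eta> in QQ. (\<lambda>z. g (z, \<eta>)) \<in> A2 \<omega>" and ap: "approximable g"
    and int: "integrable QQ (\<lambda>\<eta>. (L2_norm \<omega> (\<lambda>z. g (z, \<eta>)))\<^sup>2)"
    using assms by (auto simp: Bochner_A2_iff)
  obtain g' where g': "joint_version g g'" using approximable_version[OF A2 ap] .
  have "pair_sq g = (\<integral>\<^sup>+\<eta>. ennreal ((L2_norm \<omega> (\<lambda>z. g (z, \<eta>)))\<^sup>2) \<partial>QQ)"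
    unfolding pair_sq_def
  proof (rule nn_integral_cong_AE)
    show "AE \<eta> in QQ. l2sq MM (\<lambda>z. g (z, \<eta>)) = ennreal ((L2_norm \<omega> (\<lambda>z. g (z, \<eta>)))\<^sup>2)"
      using A2
    proof eventually_elim
      case (elim \<eta>)
      then show ?case using L2_norm_sq[OF subsetD[OF A2_subset_L2]] by metis
    qed
  qed
  also have "\<dots> < \<infinity>" using int by (simp add: integrable_iff_bounded)
  finally show thesis using that g' by blast
qed

lemma Bochner_A2_I:
  assumes A2: "AE \<eta> in QQ. (\<lambda>z. g (z, \<eta>)) \<in> A2 \<omega>" and ap: "approximable g" and fin: "pair_sq g < \<infinity>"
  shows "g \<in> Bochner_L2 \<omega> (A2 \<omega>)"
proof -
  obtain g' where g': "joint_version g g'" using approximable_version[OF A2 ap] .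
  show ?thesis unfolding Bochner_A2_iff using A2 ap joint_version_norm_sq(1)[OF g' fin] by blast
qed

lemma L2_norm_lincomb_tendsto:
  assumes u: "\<And>n. u n \<in> L2 \<omega>" "(\<lambda>n. L2_norm \<omega> (u n)) \<longlonglongrightarrow> 0"
    and v: "\<And>n. v n \<in> L2 \<omega>" "(\<lambda>n. L2_norm \<omega> (v n)) \<longlonglongrightarrow> 0"
  shows "(\<lambda>n. L2_norm \<omega> (\<lambda>z. a * u n z + b * v n z)) \<longlonglongrightarrow> 0"
proof -
  let ?r = "\<lambda>n. 2 * ((cmod a)\<^sup>2 * (L2_norm \<omega> (u n))\<^sup>2) + 2 * ((cmod b)\<^sup>2 * (L2_norm \<omega> (v n))\<^sup>2)"
  have le: "(L2_norm \<omega> (\<lambda>z. a * u n z + b * v n z))\<^sup>2 \<le> ?r n" for n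
  proof -
    have "ennreal ((L2_norm \<omega> (\<lambda>z. a * u n z + b * v n z))\<^sup>2) = l2sq MM (\<lambda>z. a * u n z + b * v n z)"
      by (rule L2_norm_sq[OF L2_lincomb[OF u(1) v(1)]])
    also have "\<dots> \<le> 2 * (ennreal ((cmod a)\<^sup>2) * l2sq MM (u n)) + 2 * (ennreal ((cmod b)\<^sup>2) * l2sq MM (v n))"
      using u(1)[of n] v(1)[of n] by (intro l2sq_lincomb_le) (auto simp: L2_def)
    also have "\<dots> = ennreal (?r n)"
      by (simp add: L2_norm_sq[OF u(1), symmetric] L2_norm_sq[OF v(1), symmetric]
          flip: ennreal_numeral ennreal_mult'' ennreal_plus)
    finally show ?thesis by (subst (asm) ennreal_le_iff) auto
  qed
  have "?r \<longlonglongrightarrow> 2 * ((cmod a)\<^sup>2 * 0\<^sup>2) + 2 * ((cmod b)\<^sup>2 * 0\<^sup>2)"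
    by (intro tendsto_intros u v)
  then have r0: "?r \<longlonglongrightarrow> 0" by simp
  have "(\<lambda>n. (L2_norm \<omega> (\<lambda>z. a * u n z + b * v n z))\<^sup>2) \<longlonglongrightarrow> 0"
    by (rule tendsto_sandwich[OF always_eventually always_eventually tendsto_const r0]) (simp_all add: le)
  then have "(\<lambda>n. sqrt ((L2_norm \<omega> (\<lambda>z. a * u n z + b * v n z))\<^sup>2)) \<longlonglongrightarrow> sqrt 0"
    by (intro tendsto_intros)
  then show ?thesis by (simp add: L2_norm_def)
qed

lemma Bochner_A2_lincomb:
  assumes g: "g \<in> Bochner_L2 \<omega> (A2 \<omega>)" and h: "h \<in> Bochner_L2 \<omega> (A2 \<omega>)"
  shows "(\<lambda>p. a * g p + b * h p) \<in> Bochner_L2 \<omega> (A2 \<omega>)"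
proof (rule Bochner_A2_I)
  have gA: "AE \<eta> in QQ. (\<lambda>z. g (z, \<eta>)) \<in> A2 \<omega>" and hA: "AE \<eta> in QQ. (\<lambda>z. h (z, \<eta>)) \<in> A2 \<omega>"
    and ag: "approximable g" and ah: "approximable h" using g h by (auto simp: Bochner_A2_iff)
  obtain s :: "nat \<Rightarrow> real \<times> real \<Rightarrow> complex \<Rightarrow> complex" where
    s: "\<And>n. finite (s n ` quasimomenta)" "\<And>n. s n ` quasimomenta \<subseteq> A2 \<omega>"
      "\<And>n k. {\<eta> \<in> quasimomenta. s n \<eta> = k} \<in> sets lebesgue"
      "AE \<eta> in QQ. (\<lambda>n. L2_norm \<omega> (\<lambda>z. s n \<eta> z - g (z, \<eta>))) \<longlonglongrightarrow> 0"
    using ag unfolding approximable_def by blast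
  obtain t :: "nat \<Rightarrow> real \<times> real \<Rightarrow> complex \<Rightarrow> complex" where
    t: "\<And>n. finite (t n ` quasimomenta)" "\<And>n. t n ` quasimomenta \<subseteq> A2 \<omega>"
      "\<And>n k. {\<eta> \<in> quasimomenta. t n \<eta> = k} \<in> sets lebesgue"
      "AE \<eta> in QQ. (\<lambda>n. L2_norm \<omega> (\<lambda>z. t n \<eta> z - h (z, \<eta>))) \<longlonglongrightarrow> 0"
    using ah unfolding approximable_def by blast
  show "AE \<eta> in QQ. (\<lambda>z. a * g (z, \<eta>) + b * h (z, \<eta>)) \<in> A2 \<omega>"
    using gA hA by eventually_elim (rule A2_lincomb)
  define c where "c = (\<lambda>u v :: complex \<Rightarrow> complex. \<lambda>z. a * u z + b * v z)"
  define w where "w = (\<lambda>n \<eta>. c (s n \<eta>) (t n \<eta>))"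
  have "w n ` quasimomenta \<subseteq> (\<lambda>(u, v). c u v) ` (s n ` quasimomenta \<times> t n ` quasimomenta)" for n
    by (auto simp: w_def)
  then have fin: "finite (w n ` quasimomenta)" for n
    by (rule finite_subset) (intro finite_imageI finite_cartesian_product s t)
  have wA: "w n ` quasimomenta \<subseteq> A2 \<omega>" for n
  proof
    fix u assume "u \<in> w n ` quasimomenta"
    then obtain \<eta> where \<eta>: "\<eta> \<in> quasimomenta" "u = w n \<eta>" by blast
    then have "s n \<eta> \<in> A2 \<omega>" "t n \<eta> \<in> A2 \<omega>" using s(2)[of n] t(2)[of n] by blast+
    then show "u \<in> A2 \<omega>" unfolding \<eta> w_def c_def by (rule A2_lincomb)
  qed
  have lev: "{\<eta> \<in> quasimomenta. w n \<eta> = k} \<in> sets lebesgue" for n k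
  proof -
    have "{\<eta> \<in> quasimomenta. w n \<eta> = k} = (\<Union>(u, v)\<in>{(u, v) \<in> s n ` quasimomenta \<times> t n ` quasimomenta. c u v = k}.
        {\<eta> \<in> quasimomenta. s n \<eta> = u} \<inter> {\<eta> \<in> quasimomenta. t n \<eta> = v})"
      by (auto simp: w_def)
    also have "\<dots> \<in> sets lebesgue"
    proof (rule sets.finite_UN)
      show "finite {(u, v) \<in> s n ` quasimomenta \<times> t n ` quasimomenta. c u v = k}"
        by (rule finite_subset[of _ "s n ` quasimomenta \<times> t n ` quasimomenta"]) (use s t in auto)
    qed (use s(3) t(3) in auto)
    finally show ?thesis .
  qed
  have "AE \<eta> in QQ. \<eta> \<in> space QQ" by (rule AE_space)
  with s(4) t(4) gA hA have "AE \<eta> in QQ. (\<lambda>n. L2_norm \<omega> (\<lambda>z. w n \<eta> z - (a * g (z, \<eta>) + b * h (z, \<eta>)))) \<longlonglongrightarrow> 0"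
  proof eventually_elim
    case (elim \<eta>)
    have "s n \<eta> \<in> L2 \<omega>" "t n \<eta> \<in> L2 \<omega>" "(\<lambda>z. g (z, \<eta>)) \<in> L2 \<omega>" "(\<lambda>z. h (z, \<eta>)) \<in> L2 \<omega>" for n
      using elim s(2)[of n] t(2)[of n] A2_subset_L2[of \<omega>] by auto
    then have "(\<lambda>n. L2_norm \<omega> (\<lambda>z. a * (s n \<eta> z - g (z, \<eta>)) + b * (t n \<eta> z - h (z, \<eta>)))) \<longlonglongrightarrow> 0"
      using elim by (intro L2_norm_lincomb_tendsto L2_diff)
    then show ?case by (simp add: w_def c_def algebra_simps)
  qed
  then show "approximable (\<lambda>p. a * g p + b * h p)"
    unfolding approximable_def using fin wA lev by (intro exI[of _ w]) simp
  obtain g' h' where r: "joint_version g g'" "pair_sq g < \<infinity>" "joint_version h h'" "pair_sq h < \<infinity>"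
    using Bochner_A2_version[OF g] Bochner_A2_version[OF h] by metis
  show "pair_sq (\<lambda>p. a * g p + b * h p) < \<infinity>"
    using pair_sq_lincomb_le[OF r(1,3), of a b] r(2,4)
    by (auto simp: ennreal_mult_less_top elim!: le_less_trans)
qed

end

section \<open>Partial sums of the Floquet series\<close>

text \<open>
  The integral of \<open>\<Sum>j. 4 ^ j * u j\<close> is finite, so for almost every point this sum is finite, and its
  value bounds each term.
\<close>

lemma AE_geometric_bound:
  fixes u :: "nat \<Rightarrow> 'a \<Rightarrow> ennreal"
  assumes [measurable]: "\<And>j. u j \<in> borel_measurable M"
    and le: "\<And>j. j \<ge> i \<Longrightarrow> (\<integral>\<^sup>+x. u j x \<partial>M) \<le> ennreal ((1 / 16) ^ j)"
  shows "AE x in M. \<exists>K\<ge>0. \<forall>j\<ge>i. u j x \<le> ennreal (K * (1 / 4) ^ j)"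
proof -
  define v where "v = (\<lambda>j x. ennreal (4 ^ (j + i)) * u (j + i) x)"
  have [measurable]: "v j \<in> borel_measurable M" for j unfolding v_def by measurable
  have "(\<integral>\<^sup>+x. (\<Sum>j. v j x) \<partial>M) = (\<Sum>j. \<integral>\<^sup>+x. v j x \<partial>M)"
    by (rule nn_integral_suminf) measurable
  also have "\<dots> \<le> (\<Sum>j. ennreal ((1 / 4) ^ j))"
  proof (rule suminf_le)
    fix j
    have "(\<integral>\<^sup>+x. v j x \<partial>M) = ennreal (4 ^ (j + i)) * (\<integral>\<^sup>+x. u (j + i) x \<partial>M)"
      unfolding v_def by (rule nn_integral_cmult) measurable
    also have "\<dots> \<le> ennreal (4 ^ (j + i)) * ennreal ((1 / 16) ^ (j + i))"
      by (intro mult_left_mono le) auto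
    also have "\<dots> = ennreal ((4 * (1 / 16)) ^ (j + i))"
      by (simp only: power_mult_distrib ennreal_mult'' zero_le_power zero_le_divide_1_iff zero_le_numeral)
    also have "\<dots> \<le> ennreal ((1 / 4) ^ j)"
      by (intro ennreal_leI) (simp add: power_decreasing)
    finally show "(\<integral>\<^sup>+x. v j x \<partial>M) \<le> ennreal ((1 / 4) ^ j)" .
  qed auto
  also have "\<dots> = ennreal (\<Sum>j. (1 / 4) ^ j)"
    by (rule suminf_ennreal2) (auto intro: summable_geometric)
  finally have "(\<integral>\<^sup>+x. (\<Sum>j. v j x) \<partial>M) \<noteq> \<infinity>" by (auto simp: top_unique)
  then have "AE x in M. (\<Sum>j. v j x) \<noteq> \<infinity>" by (intro nn_integral_PInf_AE) measurable
  then show ?thesis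
  proof eventually_elim
    case (elim x)
    then obtain K where K: "K \<ge> 0" "(\<Sum>j. v j x) = ennreal K" by (cases "\<Sum>j. v j x") auto
    have "u j x \<le> ennreal (K * (1 / 4) ^ j)" if "j \<ge> i" for j
    proof -
      have "v (j - i) x \<le> (\<Sum>j. v j x)"
        using sum_le_suminf[of "\<lambda>j. v j x" "{j - i}"] by simp
      then have "ennreal (4 ^ j) * u j x \<le> ennreal K" using that K by (simp add: v_def)
      then have le: "ennreal ((1 / 4) ^ j) * (ennreal (4 ^ j) * u j x) \<le> ennreal ((1 / 4) ^ j) * ennreal K"
        by (intro mult_left_mono) auto
      have one: "ennreal ((1 / 4) ^ j) * ennreal (4 ^ j) = 1"
        by (simp add: power_mult_distrib[symmetric] flip: ennreal_mult'')
      have "u j x = ennreal ((1 / 4) ^ j) * (ennreal (4 ^ j) * u j x)"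
        by (simp only: mult.assoc[symmetric] one mult_1)
      also note le
      also have "ennreal ((1 / 4) ^ j) * ennreal K = ennreal (K * (1 / 4) ^ j)"
        using K(1) by (subst ennreal_mult''[symmetric]) (simp_all add: mult.commute)
      finally show ?thesis .
    qed
    then show ?case using K by blast
  qed
qed

lemma ennreal_tendsto_0I:
  assumes "\<And>e. e > 0 \<Longrightarrow> eventually (\<lambda>x. f x \<le> ennreal e) F"
  shows "(f \<longlongrightarrow> (0::ennreal)) F"
proof (rule order_tendstoI)
  fix a :: ennreal assume "0 < a"
  have "\<exists>e>0. ennreal e < a"
  proof (cases a)
    case (real r)
    then have "r / 2 > 0 \<and> ennreal (r / 2) < a" using \<open>0 < a\<close> by (auto simp: ennreal_less_iff)
    then show ?thesis by blast
  next
    case top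
    then show ?thesis by (intro exI[of _ 1]) auto
  qed
  then obtain e where e: "0 < e" "ennreal e < a" by blast
  show "eventually (\<lambda>x. f x < a) F"
    using assms[OF e(1)] by eventually_elim (use e(2) in auto)
qed simp

definition shift_set :: "complex \<Rightarrow> complex set \<Rightarrow> complex set" where
  "shift_set k A = (\<lambda>m. m + k) ` A"

lemma shift_set_lattice: "A \<subseteq> gauss_lattice \<Longrightarrow> k \<in> gauss_lattice \<Longrightarrow> shift_set k A \<subseteq> gauss_lattice"
  by (auto simp: shift_set_def intro: lattice_add)

lemma finite_shift_set: "finite A \<Longrightarrow> finite (shift_set k A)"
  by (simp add: shift_set_def)

lemma shift_set_add: "shift_set k (shift_set l A) = shift_set (l + k) A"
  by (auto simp: shift_set_def image_image add.assoc)

lemma shift_set_0 [simp]: "shift_set 0 A = A" by (simp add: shift_set_def)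

lemma mode_shift: "mode m \<eta> = phase \<eta> k * mode (m + k) \<eta>"
  using phase_add[of \<eta> k "- (m + k)"] by (simp add: mode_def)

lemma floquet_partial_sum_eq:
  "floquet_partial_sum A f (z, \<eta>) = (\<Sum>m\<in>A. mode m \<eta> * f (z + m))"
proof -
  have "exp (- \<i> * of_real (fst \<eta>) * of_real (Re m) - \<i> * of_real (snd \<eta>) * of_real (Im m)) = phase \<eta> (- m)" for m
    unfolding phase_def by (rule arg_cong[of _ _ exp]) (simp add: algebra_simps)
  then show ?thesis
    by (cases \<eta>) (simp add: floquet_partial_sum_def mode_def sum_distrib_left)
qed

text \<open>
  Quasi-periodicity holds for partial sums up to a shift of the index set.
\<close>

lemma floquet_partial_sum_shift:
  "floquet_partial_sum A f (z + k, \<eta>) = phase \<eta> k * floquet_partial_sum (shift_set k A) f (z, \<eta>)"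
proof -
  have "floquet_partial_sum (shift_set k A) f (z, \<eta>) = (\<Sum>m\<in>A. mode (m + k) \<eta> * f (z + (m + k)))"
    unfolding floquet_partial_sum_eq shift_set_def by (subst sum.reindex) (auto simp: inj_on_def)
  moreover have "mode m \<eta> * f (z + k + m) = phase \<eta> k * (mode (m + k) \<eta> * f (z + (m + k)))" for m
    by (subst mode_shift[of m \<eta> k]) (simp add: mult.assoc add_ac)
  ultimately show ?thesis
    by (simp add: floquet_partial_sum_eq sum_distrib_left)
qed

lemma floquet_partial_sum_diff:
  assumes "finite A" "finite B"
  shows "floquet_partial_sum A f p - floquet_partial_sum B f p
    = floquet_partial_sum (A - B) f p - floquet_partial_sum (B - A) f p"
proof -
  obtain z \<eta> where Pair: "p = (z, \<eta>)" by (metis surj_pair)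
  have "(\<Sum>m\<in>A. g m) = (\<Sum>m\<in>A - B. g m) + (\<Sum>m\<in>A \<inter> B. g m)"
    "(\<Sum>m\<in>B. g m) = (\<Sum>m\<in>B - A. g m) + (\<Sum>m\<in>A \<inter> B. g m)" for g :: "complex \<Rightarrow> complex"
    using sum.Int_Diff[OF assms(1), of g B] sum.Int_Diff[OF assms(2), of g A]
    by (simp_all add: Int_commute add.commute)
  then show ?thesis unfolding Pair floquet_partial_sum_eq by simp
qed

context cell_setting
begin

definition coef_sq :: "(complex \<Rightarrow> complex) \<Rightarrow> complex \<Rightarrow> ennreal" where
  "coef_sq f m = l2sq MM (\<lambda>z. f (z + m))"

definition small_tail :: "(complex \<Rightarrow> complex) \<Rightarrow> complex set \<Rightarrow> real \<Rightarrow> bool" where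
  "small_tail f A \<epsilon> \<longleftrightarrow> (\<forall>F. finite F \<longrightarrow> F \<subseteq> gauss_lattice \<longrightarrow> F \<inter> A = {} \<longrightarrow> (\<Sum>m\<in>F. coef_sq f m) \<le> ennreal \<epsilon>)"

lemma small_tail_mono: "small_tail f A \<epsilon> \<Longrightarrow> A \<subseteq> B \<Longrightarrow> small_tail f B \<epsilon>"
  unfolding small_tail_def by blast

lemma A2_D:
  assumes "f \<in> A2 \<Omega>"
  shows "f holomorphic_on \<Omega>" "continuous_on \<Omega> f" "l2sq (lebesgue_on \<Omega>) f < \<infinity>"
  using assms by (auto simp: A2_def L2_iff holomorphic_on_imp_continuous_on)

lemma sum_coef_sq_le:
  assumes f: "continuous_on \<Omega> f" and F: "finite F" "F \<subseteq> gauss_lattice"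
  shows "(\<Sum>m\<in>F. coef_sq f m) \<le> l2sq (lebesgue_on \<Omega>) f"
proof -
  have inj: "inj lattice_enum" and rng: "range lattice_enum = gauss_lattice"
    using bij_lattice_enum by (auto simp: bij_betw_def)
  define I where "I = lattice_enum -` F"
  have I: "finite I" unfolding I_def using F inj by (intro finite_vimageI)
  have "F = lattice_enum ` I" using F rng by (auto simp: I_def)
  then have "(\<Sum>m\<in>F. coef_sq f m) = (\<Sum>n\<in>I. coef_sq f (lattice_enum n))"
    using inj by (simp add: sum.reindex inj_on_subset[OF inj])
  also have "\<dots> \<le> (\<Sum>n. coef_sq f (lattice_enum n))"
    using I by (intro sum_le_suminf) auto
  finally show ?thesis unfolding l2sq_domain[OF f] coef_sq_def .
qed

lemma coef_sq_sums:
  assumes f: "continuous_on \<Omega> f"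
  shows "(\<lambda>N. \<Sum>m\<in>lattice_enum ` {..<N}. coef_sq f m) \<longlonglongrightarrow> l2sq (lebesgue_on \<Omega>) f"
proof -
  have inj: "inj lattice_enum" using bij_lattice_enum by (auto simp: bij_betw_def)
  have "(\<lambda>N. \<Sum>n<N. coef_sq f (lattice_enum n)) \<longlonglongrightarrow> l2sq (lebesgue_on \<Omega>) f"
    unfolding l2sq_domain[OF f] coef_sq_def by (intro summable_LIMSEQ) auto
  then show ?thesis using inj by (simp add: sum.reindex inj_on_subset[OF inj])
qed

lemma small_tail_exists:
  assumes f: "f \<in> A2 \<Omega>" and \<epsilon>: "\<epsilon> > 0"
  obtains A where "finite A" "A \<subseteq> gauss_lattice" "small_tail f A \<epsilon>"
proof -
  note f = A2_D[OF f]
  let ?X = "l2sq (lebesgue_on \<Omega>) f"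
  let ?s = "\<lambda>N. \<Sum>m\<in>lattice_enum ` {..<N}. coef_sq f m"
  have "(\<lambda>N. ?s N + ennreal \<epsilon>) \<longlonglongrightarrow> ?X + ennreal \<epsilon>"
    by (intro tendsto_intros coef_sq_sums f)
  moreover have "?X < ?X + ennreal \<epsilon>" using f(3) \<epsilon> by (simp add: ennreal_add_left_cancel_less[of _ 0, simplified] less_top)
  ultimately have "eventually (\<lambda>N. ?X < ?s N + ennreal \<epsilon>) sequentially" by (rule order_tendstoD)
  then obtain N where N: "?X < ?s N + ennreal \<epsilon>" by (auto simp: eventually_sequentially)
  define A where "A = lattice_enum ` {..<N}"
  have A: "finite A" "A \<subseteq> gauss_lattice" using lattice_enum_in by (auto simp: A_def)
  have "(\<Sum>m\<in>F. coef_sq f m) \<le> ennreal \<epsilon>"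
    if F: "finite F" "F \<subseteq> gauss_lattice" "F \<inter> A = {}" for F
  proof -
    have "(\<Sum>m\<in>A. coef_sq f m) + (\<Sum>m\<in>F. coef_sq f m) = (\<Sum>m\<in>A \<union> F. coef_sq f m)"
      using A F by (subst sum.union_disjoint) auto
    also have "\<dots> \<le> ?X" using A F by (intro sum_coef_sq_le f) auto
    also have "\<dots> \<le> (\<Sum>m\<in>A. coef_sq f m) + ennreal \<epsilon>" using N by (simp add: A_def less_imp_le)
    finally have "(\<Sum>m\<in>A. coef_sq f m) + (\<Sum>m\<in>F. coef_sq f m) \<le> (\<Sum>m\<in>A. coef_sq f m) + ennreal \<epsilon>" .
    moreover have "(\<Sum>m\<in>A. coef_sq f m) < \<infinity>"
      using sum_coef_sq_le[OF f(2) A] f(3) by (rule le_less_trans)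
    ultimately show ?thesis by (auto simp: ennreal_add_left_cancel_le)
  qed
  then show thesis using that A unfolding small_tail_def by blast
qed

lemma partial_sum_measurable:
  assumes f: "f holomorphic_on \<Omega>" and A: "A \<subseteq> gauss_lattice"
  shows "floquet_partial_sum A f \<in> borel_measurable (MM \<Otimes>\<^sub>M QQ)"
proof -
  have "(\<lambda>p. \<Sum>m\<in>A. mode m (snd p) * f (fst p + m)) \<in> borel_measurable (MM \<Otimes>\<^sub>M QQ)"
  proof (rule borel_measurable_sum)
    fix m assume "m \<in> A"
    then have [measurable]: "(\<lambda>z. f (z + m)) \<in> borel_measurable MM"
      using A by (intro cell_measurable_translate f) auto
    show "(\<lambda>p. mode m (snd p) * f (fst p + m)) \<in> borel_measurable (MM \<Otimes>\<^sub>M QQ)" by measurable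
  qed
  moreover have "floquet_partial_sum A f = (\<lambda>p. \<Sum>m\<in>A. mode m (snd p) * f (fst p + m))"
    by (rule ext) (metis floquet_partial_sum_eq surjective_pairing)
  ultimately show ?thesis by simp
qed

lemma partial_sum_holomorphic:
  assumes f: "f holomorphic_on \<Omega>" and A: "A \<subseteq> gauss_lattice"
  shows "(\<lambda>z. floquet_partial_sum A f (z, \<eta>)) holomorphic_on \<Omega>"
  unfolding floquet_partial_sum_eq using A by (intro holomorphic_intros holomorphic_translate f) auto

text \<open>
  Tonelli and orthonormality of the modes.
\<close>

lemma pair_sq_partial_sum:
  assumes f: "f holomorphic_on \<Omega>" and F: "finite F" "F \<subseteq> gauss_lattice"
  shows "pair_sq (floquet_partial_sum F f) = (\<Sum>m\<in>F. coef_sq f m)"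
proof -
  have meas: "(\<lambda>z. f (z + m)) \<in> borel_measurable MM" if "m \<in> F" for m
    using that F by (intro cell_measurable_translate f) auto
  have "pair_sq (floquet_partial_sum F f) = (\<integral>\<^sup>+z. l2sq QQ (\<lambda>\<eta>. \<Sum>m\<in>F. f (z + m) * mode m \<eta>) \<partial>MM)"
    unfolding pair_sq_version_swap[OF joint_version_self[OF partial_sum_measurable[OF f F(2)]]] floquet_partial_sum_eq
    by (simp add: mult.commute)
  also have "\<dots> = (\<integral>\<^sup>+z. (\<Sum>m\<in>F. ennreal ((cmod (f (z + m)))\<^sup>2)) \<partial>MM)"
    unfolding l2sq_trig[OF F] by (simp add: sum_ennreal)
  also have "\<dots> = (\<Sum>m\<in>F. coef_sq f m)"
    unfolding coef_sq_def l2sq_def using meas by (intro nn_integral_sum) simp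
  finally show ?thesis .
qed

lemma pair_sq_partial_sum_diff_le:
  assumes f: "f holomorphic_on \<Omega>" and A: "finite A" "A \<subseteq> gauss_lattice" and B: "finite B" "B \<subseteq> gauss_lattice"
    and tail: "small_tail f A \<epsilon>" "small_tail f B \<epsilon>" and \<epsilon>: "\<epsilon> \<ge> 0"
  shows "pair_sq (\<lambda>p. floquet_partial_sum A f p - floquet_partial_sum B f p) \<le> ennreal (4 * \<epsilon>)"
proof -
  have AB: "finite (A - B)" "A - B \<subseteq> gauss_lattice" "finite (B - A)" "B - A \<subseteq> gauss_lattice" using A B by auto
  have "pair_sq (\<lambda>p. floquet_partial_sum A f p - floquet_partial_sum B f p)
      \<le> 2 * pair_sq (floquet_partial_sum (A - B) f) + 2 * pair_sq (floquet_partial_sum (B - A) f)"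
    unfolding floquet_partial_sum_diff[OF A(1) B(1)]
    by (rule pair_sq_diff_le[OF joint_version_self joint_version_self]) (intro partial_sum_measurable f AB)+
  also have "\<dots> \<le> 2 * ennreal \<epsilon> + 2 * ennreal \<epsilon>"
    unfolding pair_sq_partial_sum[OF f AB(1,2)] pair_sq_partial_sum[OF f AB(3,4)]
    using tail AB unfolding small_tail_def by (intro add_mono mult_left_mono) auto
  also have "\<dots> = ennreal (4 * \<epsilon>)"
    using \<epsilon> by (simp flip: ennreal_numeral ennreal_mult'' ennreal_plus)
  finally show ?thesis .
qed

end

section \<open>Existence of the transform\<close>

text \<open>
  The crude triangle inequality loses a factor \<open>2\<close> at each step, against a gain of \<open>1 / 4\<close>; the
  factor \<open>4\<close> is the fixed point of \<open>C = 2 + C / 2\<close>.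
\<close>

lemma l2sq_telescope:
  assumes [measurable]: "\<And>j::nat. u j \<in> borel_measurable M"
    and le: "\<And>j. j \<ge> i \<Longrightarrow> l2sq M (\<lambda>x. u (Suc j) x - u j x) \<le> ennreal (K * (1 / 4) ^ j)"
    and K: "K \<ge> 0" and b: "b \<ge> i"
  shows "l2sq M (\<lambda>x. u (b + n) x - u b x) \<le> ennreal (4 * K * (1 / 4) ^ b)"
  using b
proof (induction n arbitrary: b)
  case 0
  then show ?case by (simp add: l2sq_def)
next
  case (Suc n)
  have "l2sq M (\<lambda>x. u (b + Suc n) x - u b x)
      = l2sq M (\<lambda>x. (u (Suc b + n) x - u (Suc b) x) + (u (Suc b) x - u b x))" by simp
  also have "\<dots> \<le> 2 * l2sq M (\<lambda>x. u (Suc b + n) x - u (Suc b) x) + 2 * l2sq M (\<lambda>x. u (Suc b) x - u b x)"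
    by (rule l2sq_add_le) measurable
  also have "\<dots> \<le> 2 * ennreal (4 * K * (1 / 4) ^ Suc b) + 2 * ennreal (K * (1 / 4) ^ b)"
    using Suc.prems by (intro add_mono mult_left_mono Suc.IH le) auto
  also have "\<dots> = ennreal (2 * (4 * K * (1 / 4) ^ Suc b) + 2 * (K * (1 / 4) ^ b))"
    using K by (simp flip: ennreal_numeral ennreal_mult'' ennreal_plus)
  also have "2 * (4 * K * (1 / 4) ^ Suc b) + 2 * (K * (1 / 4) ^ b) = 4 * K * (1 / 4) ^ b" by simp
  finally show ?case .
qed

lemma geometric_eventually_le:
  assumes "\<epsilon> > 0" shows "\<exists>J\<ge>i. \<forall>b\<ge>J. C * (1 / 4 :: real) ^ b \<le> \<epsilon>"
proof -
  have "(\<lambda>b. C * (1 / 4 :: real) ^ b) \<longlonglongrightarrow> C * 0" by (intro tendsto_intros LIMSEQ_power_zero) auto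
  then have "eventually (\<lambda>b. C * (1 / 4 :: real) ^ b < \<epsilon>) sequentially"
    using assms by (intro order_tendstoD) auto
  then obtain J where J: "\<And>b. b \<ge> J \<Longrightarrow> C * (1 / 4 :: real) ^ b < \<epsilon>" unfolding eventually_sequentially by blast
  show ?thesis by (rule exI[of _ "max i J"]) (use J less_imp_le in auto)
qed

lemma geometric_ennreal_tendsto_0: "(\<lambda>b. ennreal (C * (1 / 4) ^ b)) \<longlonglongrightarrow> 0"
proof -
  have "(\<lambda>b. C * (1 / 4 :: real) ^ b) \<longlonglongrightarrow> C * 0" by (intro tendsto_intros LIMSEQ_power_zero) auto
  then show ?thesis using tendsto_ennrealI[of "\<lambda>b. C * (1 / 4 :: real) ^ b" 0] by simp
qed

text \<open>
  Rounding the values of the modes makes partial sums simple functions of \<open>\<eta>\<close>, uniformly close to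
  the original ones.
\<close>

definition grid_round :: "nat \<Rightarrow> complex \<Rightarrow> complex" where
  "grid_round N w = Complex (of_int \<lfloor>real N * Re w\<rfloor> / real N) (of_int \<lfloor>real N * Im w\<rfloor> / real N)"

lemma grid_round_measurable [measurable]: "grid_round N \<in> borel_measurable borel"
  unfolding grid_round_def Complex_eq by measurable

lemma grid_round_error:
  assumes "N > 0" shows "cmod (grid_round N w - w) \<le> 2 / N"
proof -
  have r: "\<bar>of_int \<lfloor>real N * x\<rfloor> / real N - x\<bar> \<le> 1 / N" for x
  proof -
    have "\<bar>of_int \<lfloor>real N * x\<rfloor> - real N * x\<bar> \<le> 1" by linarith
    then have "\<bar>of_int \<lfloor>real N * x\<rfloor> - real N * x\<bar> / real N \<le> 1 / N" using assms by (intro divide_right_mono) auto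
    moreover have "of_int \<lfloor>real N * x\<rfloor> / real N - x = (of_int \<lfloor>real N * x\<rfloor> - real N * x) / real N"
      using assms by (simp add: field_simps)
    ultimately show ?thesis by (simp add: abs_divide)
  qed
  have "cmod (grid_round N w - w) \<le> \<bar>Re (grid_round N w - w)\<bar> + \<bar>Im (grid_round N w - w)\<bar>" by (rule cmod_le)
  also have "\<dots> \<le> 1 / N + 1 / N" using r[of "Re w"] r[of "Im w"] by (simp add: grid_round_def)
  finally show ?thesis by simp
qed

lemma finite_grid_round: "finite (grid_round N ` {w. cmod w \<le> 1})"
proof (rule finite_subset)
  show "grid_round N ` {w. cmod w \<le> 1} \<subseteq>
      (\<lambda>(a, b). Complex (of_int a / real N) (of_int b / real N)) ` ({- int N..int N} \<times> {- int N..int N})"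
  proof (rule image_subsetI)
    fix w :: complex assume "w \<in> {w. cmod w \<le> 1}"
    then have "\<bar>Re w\<bar> \<le> 1" "\<bar>Im w\<bar> \<le> 1" using abs_Re_le_cmod[of w] abs_Im_le_cmod[of w] by auto
    then have "\<bar>real N * Re w\<bar> \<le> real N" "\<bar>real N * Im w\<bar> \<le> real N"
      by (simp_all add: abs_mult mult_left_le)
    then have "\<lfloor>real N * Re w\<rfloor> \<in> {- int N..int N}" "\<lfloor>real N * Im w\<rfloor> \<in> {- int N..int N}"
      by (auto simp: le_floor_iff floor_le_iff)
    then show "grid_round N w \<in> (\<lambda>(a, b). Complex (of_int a / real N) (of_int b / real N)) ` ({- int N..int N} \<times> {- int N..int N})"
      unfolding grid_round_def
      by (intro image_eqI[of _ _ "(\<lfloor>real N * Re w\<rfloor>, \<lfloor>real N * Im w\<rfloor>)"]) auto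
  qed
qed auto

lemma cmod_sum_power2_le:
  assumes "finite F"
  shows "(cmod (\<Sum>m\<in>F. d m * a m))\<^sup>2 \<le> (\<Sum>m\<in>F. (cmod (d m))\<^sup>2) * (\<Sum>m\<in>F. (cmod (a m))\<^sup>2)"
proof -
  have "cmod (\<Sum>m\<in>F. d m * a m) \<le> (\<Sum>m\<in>F. \<bar>cmod (d m)\<bar> * \<bar>cmod (a m)\<bar>)"
    by (rule order_trans[OF norm_sum]) (simp add: norm_mult)
  also have "\<dots> \<le> L2_set (\<lambda>m. cmod (d m)) F * L2_set (\<lambda>m. cmod (a m)) F" by (rule L2_set_mult_ineq)
  finally have "(cmod (\<Sum>m\<in>F. d m * a m))\<^sup>2 \<le> (L2_set (\<lambda>m. cmod (d m)) F * L2_set (\<lambda>m. cmod (a m)) F)\<^sup>2"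
    by (rule power_mono) simp
  then show ?thesis by (simp add: power_mult_distrib L2_set_def sum_nonneg)
qed

context cell_setting
begin

lemma small_tail_weaken: "small_tail f A \<epsilon> \<Longrightarrow> \<epsilon> \<le> \<epsilon>' \<Longrightarrow> small_tail f A \<epsilon>'"
  unfolding small_tail_def by (meson ennreal_leI order_trans)

text \<open>
  To make the first \<open>j\<close> shifts of \<open>A j\<close> large, join the corresponding backward shifts of one set that
  is large enough.
\<close>

lemma summing_sets:
  assumes f: "f \<in> A2 \<Omega>"
  obtains A :: "nat \<Rightarrow> complex set" where "\<And>j. finite (A j)" "\<And>j. A j \<subseteq> gauss_lattice"
    "\<And>i j. i \<le> j \<Longrightarrow> small_tail f (shift_set (lattice_enum i) (A j)) ((1 / 16) ^ j / 4)"
proof -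
  have "\<forall>j::nat. \<exists>A. finite A \<and> A \<subseteq> gauss_lattice \<and> small_tail f A ((1 / 16) ^ j / 4)"
  proof
    fix j :: nat
    have "(1 / 16 :: real) ^ j / 4 > 0" by simp
    then show "\<exists>A. finite A \<and> A \<subseteq> gauss_lattice \<and> small_tail f A ((1 / 16) ^ j / 4)"
      using small_tail_exists[OF f] by metis
  qed
  then obtain B where B: "\<And>j::nat. finite (B j)" "\<And>j. B j \<subseteq> gauss_lattice" "\<And>j. small_tail f (B j) ((1 / 16) ^ j / 4)"
    by metis
  define A where "A = (\<lambda>j. \<Union>i\<le>j. shift_set (- lattice_enum i) (B j))"
  show thesis
  proof (rule that[of A])
    show "finite (A j)" for j unfolding A_def using B(1) by (auto intro: finite_shift_set)
    show "A j \<subseteq> gauss_lattice" for j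
      unfolding A_def using shift_set_lattice[OF B(2) lattice_minus[OF lattice_enum_in]] by blast
    fix i j :: nat assume "i \<le> j"
    then have "shift_set (lattice_enum i) (shift_set (- lattice_enum i) (B j)) \<subseteq> shift_set (lattice_enum i) (A j)"
      unfolding A_def shift_set_def by blast
    then have "B j \<subseteq> shift_set (lattice_enum i) (A j)" by (simp add: shift_set_add)
    then show "small_tail f (shift_set (lattice_enum i) (A j)) ((1 / 16) ^ j / 4)"
      using B(3) small_tail_mono by blast
  qed
qed

lemma slice_l2sq_measurable:
  assumes "u \<in> borel_measurable (MM \<Otimes>\<^sub>M QQ)"
  shows "(\<lambda>\<eta>. l2sq MM (\<lambda>z. u (z, \<eta>))) \<in> borel_measurable QQ"
  using assms unfolding l2sq_def by measurable

lemma slice_difference_bound: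
  assumes f: "f holomorphic_on \<Omega>"
    and A: "\<And>j::nat. finite (A j)" "\<And>j. A j \<subseteq> gauss_lattice" and B: "\<And>j. finite (B j)" "\<And>j. B j \<subseteq> gauss_lattice"
    and tail: "\<And>j. j \<ge> i \<Longrightarrow> small_tail f (A j) ((1 / 16) ^ j / 4)" "\<And>j. j \<ge> i \<Longrightarrow> small_tail f (B j) ((1 / 16) ^ j / 4)"
  shows "AE \<eta> in QQ. \<exists>K\<ge>0. \<forall>j\<ge>i. l2sq MM (\<lambda>z. floquet_partial_sum (A j) f (z, \<eta>) - floquet_partial_sum (B j) f (z, \<eta>))
    \<le> ennreal (K * (1 / 4) ^ j)"
proof (rule AE_geometric_bound)
  fix j
  have [measurable]: "floquet_partial_sum (A j) f \<in> borel_measurable (MM \<Otimes>\<^sub>M QQ)"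
    "floquet_partial_sum (B j) f \<in> borel_measurable (MM \<Otimes>\<^sub>M QQ)"
    by (intro partial_sum_measurable f A B)+
  show "(\<lambda>\<eta>. l2sq MM (\<lambda>z. floquet_partial_sum (A j) f (z, \<eta>) - floquet_partial_sum (B j) f (z, \<eta>))) \<in> borel_measurable QQ"
    by (rule slice_l2sq_measurable[of "\<lambda>p. floquet_partial_sum (A j) f p - floquet_partial_sum (B j) f p"]) measurable
  assume "j \<ge> i"
  then have "pair_sq (\<lambda>p. floquet_partial_sum (A j) f p - floquet_partial_sum (B j) f p) \<le> ennreal (4 * ((1 / 16) ^ j / 4))"
    by (intro pair_sq_partial_sum_diff_le f A B tail) auto
  then show "(\<integral>\<^sup>+\<eta>. l2sq MM (\<lambda>z. floquet_partial_sum (A j) f (z, \<eta>) - floquet_partial_sum (B j) f (z, \<eta>)) \<partial>QQ)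
      \<le> ennreal ((1 / 16) ^ j)"
    by (simp add: pair_sq_def)
qed

text \<open>
  For a fixed \<open>\<eta>\<close> with geometric bounds, the partial sums are Cauchy on every cell, so they have an
  analytic limit. A partial sum and its shift have the same limit, which makes the limit
  quasi-periodic.
\<close>

lemma partial_sum_limit:
  assumes f: "f holomorphic_on \<Omega>"
    and A: "\<And>j::nat. finite (A j)" "\<And>j. A j \<subseteq> gauss_lattice"
    and step: "\<And>i. \<exists>K\<ge>0. \<forall>j\<ge>i. l2sq MM (\<lambda>z. floquet_partial_sum (shift_set (lattice_enum i) (A (Suc j))) f (z, \<eta>)
        - floquet_partial_sum (shift_set (lattice_enum i) (A j)) f (z, \<eta>)) \<le> ennreal (K * (1 / 4) ^ j)"
    and shifts: "\<And>i i'. \<exists>K\<ge>0. \<forall>j\<ge>max i i'. l2sq MM (\<lambda>z. floquet_partial_sum (shift_set (lattice_enum i) (A j)) f (z, \<eta>)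
        - floquet_partial_sum (shift_set (lattice_enum i') (A j)) f (z, \<eta>)) \<le> ennreal (K * (1 / 4) ^ j)"
  obtains H where "bloch \<eta> H" "\<And>z. z \<in> \<Omega> \<Longrightarrow> (\<lambda>j. floquet_partial_sum (A j) f (z, \<eta>)) \<longlonglongrightarrow> H z"
    "(\<lambda>j. l2sq MM (\<lambda>z. floquet_partial_sum (A j) f (z, \<eta>) - H z)) \<longlonglongrightarrow> 0"
proof -
  define T where "T = (\<lambda>k j z. floquet_partial_sum (shift_set k (A j)) f (z, \<eta>))"
  have enum: "\<exists>i. lattice_enum i = k" if "k \<in> gauss_lattice" for k
    using bij_lattice_enum that unfolding bij_betw_def by (metis rangeE)
  have Thol: "T k j holomorphic_on \<Omega>" if "k \<in> gauss_lattice" for k j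
    unfolding T_def by (intro partial_sum_holomorphic f shift_set_lattice A that)
  have Tmeas: "T k j \<in> borel_measurable MM" if "k \<in> gauss_lattice" for k j
    by (rule cell_measurable[OF Thol[OF that]])
  have Tshift: "T l j (z + k) = phase \<eta> k * T (l + k) j z" for l j z k
    unfolding T_def by (simp add: floquet_partial_sum_shift shift_set_add)
  have cauchy: "\<exists>i K. K \<ge> 0 \<and> (\<forall>b\<ge>i. \<forall>n. l2sq MM (\<lambda>z. T k (b + n) z - T k b z) \<le> ennreal (4 * K * (1 / 4) ^ b))"
    if k: "k \<in> gauss_lattice" for k
  proof -
    obtain i where i: "lattice_enum i = k" using enum[OF k] by blast
    obtain K where "K \<ge> 0" "\<forall>j\<ge>i. l2sq MM (\<lambda>z. T k (Suc j) z - T k j z) \<le> ennreal (K * (1 / 4) ^ j)"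
      using step[of i] unfolding i T_def by blast
    then show ?thesis using l2sq_telescope[of "T k" MM i K] Tmeas[OF k] by blast
  qed
  obtain H where H: "H holomorphic_on \<Omega>" "\<And>z. z \<in> \<Omega> \<Longrightarrow> (\<lambda>j. T 0 j z) \<longlonglongrightarrow> H z"
  proof (rule holomorphic_limit[of "T 0"])
    show "T 0 j holomorphic_on \<Omega>" for j by (rule Thol[OF lattice_0])
    fix k and \<epsilon> :: real assume k: "k \<in> gauss_lattice" and \<epsilon>: "\<epsilon> > 0"
    obtain i K where K: "K \<ge> 0" "\<forall>b\<ge>i. \<forall>n. l2sq MM (\<lambda>z. T k (b + n) z - T k b z) \<le> ennreal (4 * K * (1 / 4) ^ b)"
      using cauchy[OF k] by blast
    obtain J where J: "J \<ge> i" "\<forall>b\<ge>J. 4 * K * (1 / 4 :: real) ^ b \<le> \<epsilon>"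
      using geometric_eventually_le[OF \<epsilon>, of i "4 * K"] by blast
    have le: "l2sq MM (\<lambda>z. T k a z - T k b z) \<le> ennreal \<epsilon>" if "J \<le> b" "b \<le> a" for a b
    proof -
      have "l2sq MM (\<lambda>z. T k (b + (a - b)) z - T k b z) \<le> ennreal (4 * K * (1 / 4) ^ b)"
        by (rule K(2)[rule_format]) (use J(1) that in linarith)
      also have "\<dots> \<le> ennreal \<epsilon>" using J(2) that by (intro ennreal_leI) simp
      finally show ?thesis using that by simp
    qed
    have "l2sq MM (\<lambda>v. T 0 a (v + k) - T 0 b (v + k)) \<le> ennreal \<epsilon>" if "a \<ge> J" "b \<ge> J" for a b
    proof -
      have "l2sq MM (\<lambda>v. T 0 a (v + k) - T 0 b (v + k)) = l2sq MM (\<lambda>z. T k a z - T k b z)"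
        unfolding l2sq_def Tshift add_0 right_diff_distrib[symmetric] norm_mult cmod_phase by simp
      then show ?thesis using le[of b a] le[of a b] that l2sq_minus_commute[of MM "T k a" "T k b"] by (cases "a \<le> b") auto
    qed
    then show "\<exists>J. \<forall>a\<ge>J. \<forall>b\<ge>J. l2sq MM (\<lambda>v. T 0 a (v + k) - T 0 b (v + k)) \<le> ennreal \<epsilon>" by blast
  qed blast
  have shift0: "(\<lambda>j. T k j z - T 0 j z) \<longlonglongrightarrow> 0" if k: "k \<in> gauss_lattice" and z: "z \<in> \<Omega>" for k z
  proof -
    obtain r C F where r: "r > 0" "C \<ge> 0" "cball z r \<subseteq> \<Omega>" "finite F" "F \<subseteq> gauss_lattice"
      and est: "\<forall>G w. G holomorphic_on \<Omega> \<longrightarrow> w \<in> cball z r \<longrightarrow>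
       ennreal ((cmod (G w))\<^sup>2) \<le> ennreal C * (\<Sum>l\<in>F. l2sq MM (\<lambda>v. G (v + l)))"
      using local_bergman_estimate[OF z] by blast
    define e where "e = (\<lambda>j. \<Sum>l\<in>F. l2sq MM (\<lambda>v. T (k + l) j v - T l j v))"
    have "e \<longlonglongrightarrow> (\<Sum>l\<in>F. 0)" unfolding e_def
    proof (rule tendsto_sum)
      fix l assume "l \<in> F"
      then have l: "l \<in> gauss_lattice" using r by blast
      obtain i i' where i: "lattice_enum i = k + l" "lattice_enum i' = l"
        using enum[OF l] enum[OF lattice_add[OF k l]] by blast
      obtain K where K: "\<forall>j\<ge>max i i'. l2sq MM (\<lambda>v. T (k + l) j v - T l j v) \<le> ennreal (K * (1 / 4) ^ j)"
        using shifts[of i i'] unfolding i T_def by blast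
      show "(\<lambda>j. l2sq MM (\<lambda>v. T (k + l) j v - T l j v)) \<longlonglongrightarrow> 0"
      proof (rule tendsto_sandwich[OF always_eventually _ tendsto_const geometric_ennreal_tendsto_0[of K]])
        show "\<forall>\<^sub>F j in sequentially. l2sq MM (\<lambda>v. T (k + l) j v - T l j v) \<le> ennreal (K * (1 / 4) ^ j)"
          unfolding eventually_sequentially using K by blast
      qed simp
    qed
    then have e0: "e \<longlonglongrightarrow> 0" by simp
    show ?thesis
    proof (rule tendsto_of_l2sq_bound[OF _ r(2) e0])
      fix j
      have "(\<lambda>w. T k j w - T 0 j w) holomorphic_on \<Omega>" by (intro holomorphic_intros Thol k lattice_0)
      then have "ennreal ((cmod (T k j z - T 0 j z))\<^sup>2) \<le> ennreal C * (\<Sum>l\<in>F. l2sq MM (\<lambda>v. T k j (v + l) - T 0 j (v + l)))"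
        using est[rule_format, of "\<lambda>w. T k j w - T 0 j w" z] r(1) by simp
      also have "(\<Sum>l\<in>F. l2sq MM (\<lambda>v. T k j (v + l) - T 0 j (v + l))) = e j"
        unfolding e_def l2sq_def Tshift add_0 right_diff_distrib[symmetric] norm_mult cmod_phase by simp
      finally show "ennreal ((cmod (T k j z - T 0 j z - 0))\<^sup>2) \<le> ennreal C * e j" by simp
    qed
  qed
  have "bloch \<eta> H"
    unfolding bloch_def
  proof (intro conjI ballI H)
    fix z k assume z: "z \<in> \<Omega>" and k: "k \<in> gauss_lattice"
    have "(\<lambda>j. (T k j z - T 0 j z) + T 0 j z) \<longlonglongrightarrow> 0 + H z" by (intro tendsto_add shift0 H k z)
    then have "(\<lambda>j. phase \<eta> k * T k j z) \<longlonglongrightarrow> phase \<eta> k * H z" by (intro tendsto_intros) simp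
    moreover have "(\<lambda>j. phase \<eta> k * T k j z) \<longlonglongrightarrow> H (z + k)"
      using H(2)[of "z + k"] z k by (simp add: Tshift)
    ultimately show "H (z + k) = phase \<eta> k * H z" using LIMSEQ_unique by blast
  qed
  moreover have "(\<lambda>j. l2sq MM (\<lambda>z. T 0 j z - H z)) \<longlonglongrightarrow> 0"
  proof -
    obtain i K where K: "K \<ge> 0" "\<forall>b\<ge>i. \<forall>n. l2sq MM (\<lambda>z. T 0 (b + n) z - T 0 b z) \<le> ennreal (4 * K * (1 / 4) ^ b)"
      using cauchy[OF lattice_0] by blast
    have bound: "l2sq MM (\<lambda>z. T 0 b z - H z) \<le> ennreal (4 * K * (1 / 4) ^ b)" if b: "b \<ge> i" for b
    proof -
      have "l2sq MM (\<lambda>z. T 0 b z - H z) = l2sq MM (\<lambda>z. H z - T 0 b z)" by (rule l2sq_minus_commute)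
      also have "\<dots> \<le> liminf (\<lambda>n. l2sq MM (\<lambda>z. T 0 (b + n) z - T 0 b z))"
      proof (rule l2sq_fatou)
        show "(\<lambda>z. T 0 (b + n) z - T 0 b z) \<in> borel_measurable MM" for n
          by (intro borel_measurable_diff Tmeas lattice_0)
        show "AE z in MM. (\<lambda>n. T 0 (b + n) z - T 0 b z) \<longlonglongrightarrow> H z - T 0 b z"
        proof (rule AE_I2)
          fix z assume "z \<in> space MM"
          then have "(\<lambda>j. T 0 j z) \<longlonglongrightarrow> H z" using H(2) cell_subset_domain by auto
          from LIMSEQ_ignore_initial_segment[OF this, of b]
          have "(\<lambda>n. T 0 (b + n) z) \<longlonglongrightarrow> H z" by (simp add: add.commute)
          then show "(\<lambda>n. T 0 (b + n) z - T 0 b z) \<longlonglongrightarrow> H z - T 0 b z" by (intro tendsto_intros)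
        qed
      qed
      also have "\<dots> \<le> ennreal (4 * K * (1 / 4) ^ b)"
        using K(2) b by (intro liminf_le_of_eventually_le always_eventually) blast
      finally show ?thesis .
    qed
    show ?thesis
    proof (rule tendsto_sandwich[OF always_eventually _ tendsto_const geometric_ennreal_tendsto_0[of "4 * K"]])
      show "\<forall>\<^sub>F b in sequentially. l2sq MM (\<lambda>z. T 0 b z - H z) \<le> ennreal (4 * K * (1 / 4) ^ b)"
        unfolding eventually_sequentially using bound by blast
    qed simp
  qed
  ultimately show thesis using that[of H] H(2) by (simp add: T_def)
qed

end

lemma tendsto_ennreal_sqrt_0:
  assumes "((\<lambda>x. ennreal ((u x)\<^sup>2)) \<longlongrightarrow> 0) F"
  shows "(u \<longlongrightarrow> 0) F"
proof -
  have "((\<lambda>x. (u x)\<^sup>2) \<longlongrightarrow> 0) F"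
    using assms tendsto_ennrealD[of "\<lambda>x. (u x)\<^sup>2" 0 F] by simp
  then have "((\<lambda>x. sqrt ((u x)\<^sup>2)) \<longlongrightarrow> sqrt 0) F" by (intro tendsto_intros)
  then show ?thesis by (simp add: tendsto_rabs_zero_iff)
qed

context cell_setting
begin

lemma A2_cell_translate:
  assumes f: "f \<in> A2 \<Omega>" and m: "m \<in> gauss_lattice"
  shows "(\<lambda>z. f (z + m)) \<in> A2 \<omega>"
proof -
  note f = A2_D[OF f]
  have "coef_sq f m \<le> l2sq (lebesgue_on \<Omega>) f" using sum_coef_sq_le[OF f(2), of "{m}"] m by simp
  then have "l2sq MM (\<lambda>z. f (z + m)) < \<infinity>" using f(3) unfolding coef_sq_def by (rule le_less_trans)
  moreover have "(\<lambda>z. f (z + m)) holomorphic_on \<omega>"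
    using holomorphic_on_subset[OF holomorphic_translate[OF f(1) m] cell_subset_domain] .
  ultimately show ?thesis
    using cell_measurable_translate[OF f(1) m] by (simp add: A2_def L2_iff)
qed

lemma A2_sum:
  assumes "finite F" "\<And>m. m \<in> F \<Longrightarrow> u m \<in> A2 \<omega>"
  shows "(\<lambda>z. \<Sum>m\<in>F. d m * u m z) \<in> A2 \<omega>"
  using assms
proof (induction F rule: finite_induct)
  case empty
  show ?case by (simp add: A2_def L2_def)
next
  case (insert x F)
  then have "(\<lambda>z. d x * u x z + 1 * (\<Sum>m\<in>F. d m * u m z)) \<in> A2 \<omega>" by (intro A2_lincomb) auto
  then show ?case using insert by simp
qed

lemma partial_sum_A2:
  assumes f: "f \<in> A2 \<Omega>" and A: "finite A" "A \<subseteq> gauss_lattice"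
  shows "(\<lambda>z. floquet_partial_sum A f (z, \<eta>)) \<in> A2 \<omega>"
  unfolding floquet_partial_sum_eq using A by (intro A2_sum A2_cell_translate f) auto

text \<open>
  The rounding in the \<open>n\<close>-th sum is so fine that its error, added over the index set, tends to \<open>0\<close>.
\<close>

lemma simple_partial_sums:
  assumes f: "f \<in> A2 \<Omega>" and A: "\<And>j::nat. finite (A j)" "\<And>j. A j \<subseteq> gauss_lattice"
  obtains s :: "nat \<Rightarrow> real \<times> real \<Rightarrow> complex \<Rightarrow> complex" where
    "\<forall>n. finite (s n ` quasimomenta)" "\<forall>n \<eta>. s n \<eta> \<in> A2 \<omega>"
    "\<forall>n h. {\<eta> \<in> quasimomenta. s n \<eta> = h} \<in> sets lebesgue"
    "\<forall>\<eta>. (\<lambda>n. l2sq MM (\<lambda>z. s n \<eta> z - floquet_partial_sum (A n) f (z, \<eta>))) \<longlonglongrightarrow> 0"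
proof -
  note fD = A2_D[OF f]
  let ?X = "l2sq (lebesgue_on \<Omega>) f"
  \<comment> \<open>\<open>card (A n)\<close> terms, each with a squared error of at most \<open>4 / N\<^sup>2\<close>\<close>
  define N where "N = (\<lambda>n. (card (A n) + 1) * (n + 1))"
  have N: "N n > 0" for n by (simp add: N_def)
  define q where "q = (\<lambda>n m \<eta>. grid_round (N n) (mode m \<eta>))"
  define \<Phi> where "\<Phi> = (\<lambda>n v z. \<Sum>m\<in>A n. v m * f (z + m))"
  \<comment> \<open>a simple function is determined by the finite vector of rounded modes, which gives its level sets\<close>
  define vec where "vec = (\<lambda>n \<eta>. restrict (\<lambda>m. q n m \<eta>) (A n))"
  define s where "s = (\<lambda>n \<eta>. \<Phi> n (vec n \<eta>))"
  have s_eq: "s n \<eta> z = (\<Sum>m\<in>A n. q n m \<eta> * f (z + m))" for n \<eta> z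
    by (simp add: s_def \<Phi>_def vec_def)
  have mode1: "cmod (mode m \<eta>) \<le> 1" for m \<eta>
    using pi_ge_two by (simp add: cmod_mode)
  have vec_range: "vec n ` quasimomenta \<subseteq> PiE (A n) (\<lambda>_. grid_round (N n) ` {w. cmod w \<le> 1})" for n
    using mode1 by (auto simp: vec_def q_def)
  have fin_vec: "finite (vec n ` quasimomenta)" for n
    by (rule finite_subset[OF vec_range]) (intro finite_PiE A finite_grid_round)
  have fin: "finite (s n ` quasimomenta)" for n
    using finite_imageI[OF fin_vec, of "\<Phi> n" n] by (simp add: image_image s_def)
  have sA2: "s n \<eta> \<in> A2 \<omega>" for n \<eta>
  proof -
    have "(\<lambda>z. \<Sum>m\<in>A n. q n m \<eta> * f (z + m)) \<in> A2 \<omega>"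
      using A by (intro A2_sum A2_cell_translate f) auto
    then show ?thesis by (simp add: s_eq[abs_def])
  qed
  have q_level: "{\<eta> \<in> quasimomenta. q n m \<eta> = c} \<in> sets QQ" for n m c
  proof -
    have "q n m \<in> borel_measurable QQ" unfolding q_def by measurable
    from measurable_sets[OF this, of "{c}"] have "q n m -` {c} \<inter> space QQ \<in> sets QQ" by simp
    moreover have "q n m -` {c} \<inter> space QQ = {\<eta> \<in> quasimomenta. q n m \<eta> = c}" by auto
    ultimately show ?thesis by simp
  qed
  have vec_level: "{\<eta> \<in> quasimomenta. vec n \<eta> = v} \<in> sets QQ" if v: "v \<in> vec n ` quasimomenta" for n v
  proof -
    have "{\<eta> \<in> quasimomenta. vec n \<eta> = v} = quasimomenta \<inter> (\<Inter>m\<in>A n. {\<eta> \<in> quasimomenta. q n m \<eta> = v m})"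
    proof (intro set_eqI iffI)
      fix \<eta> assume "\<eta> \<in> quasimomenta \<inter> (\<Inter>m\<in>A n. {\<eta> \<in> quasimomenta. q n m \<eta> = v m})"
      moreover have "v \<in> extensional (A n)" using v by (auto simp: vec_def)
      ultimately show "\<eta> \<in> {\<eta> \<in> quasimomenta. vec n \<eta> = v}"
        by (auto simp: vec_def extensional_def restrict_def fun_eq_iff)
    qed (auto simp: vec_def)
    also have "\<dots> \<in> sets QQ"
    proof (cases "A n = {}")
      case False
      have "(\<Inter>m\<in>A n. {\<eta> \<in> quasimomenta. q n m \<eta> = v m}) \<in> sets QQ"
        using A(1) False q_level by (intro sets.finite_INT) auto
      then show ?thesis by (intro sets.Int) auto
    qed auto
    finally show ?thesis .
  qed
  have lev: "{\<eta> \<in> quasimomenta. s n \<eta> = h} \<in> sets lebesgue" for n h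
  proof -
    have "{\<eta> \<in> quasimomenta. s n \<eta> = h} = (\<Union>v\<in>{v \<in> vec n ` quasimomenta. \<Phi> n v = h}. {\<eta> \<in> quasimomenta. vec n \<eta> = v})"
      by (auto simp: s_def)
    also have "\<dots> \<in> sets QQ"
      using fin_vec[of n] vec_level by (intro sets.finite_UN) auto
    finally show ?thesis by (subst (asm) sets_restrict_space_iff) auto
  qed
  have lim: "(\<lambda>n. l2sq MM (\<lambda>z. s n \<eta> z - floquet_partial_sum (A n) f (z, \<eta>))) \<longlonglongrightarrow> 0" for \<eta>
  proof -
    have bound: "l2sq MM (\<lambda>z. s n \<eta> z - floquet_partial_sum (A n) f (z, \<eta>)) \<le> ennreal (4 / real (Suc n)) * ?X" for n
    proof -
      define d where "d = (\<lambda>m. q n m \<eta> - mode m \<eta>)"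
      have d: "(\<Sum>m\<in>A n. (cmod (d m))\<^sup>2) \<le> 4 / real (Suc n)"
      proof -
        have "cmod (d m) \<le> 2 / N n" for m unfolding d_def q_def by (rule grid_round_error[OF N])
        then have "(cmod (d m))\<^sup>2 \<le> (2 / N n)\<^sup>2" for m by (intro power_mono) auto
        then have "(\<Sum>m\<in>A n. (cmod (d m))\<^sup>2) \<le> card (A n) * (2 / N n)\<^sup>2"
          using sum_bounded_above[of "A n" "\<lambda>m. (cmod (d m))\<^sup>2" "(2 / N n)\<^sup>2"] by simp
        also have "\<dots> \<le> real (N n) * (2 / N n)\<^sup>2"
          by (intro mult_right_mono) (auto simp: N_def)
        also have "\<dots> = 4 / real (N n)" using N[of n] by (simp add: power2_eq_square)
        also have "\<dots> \<le> 4 / real (Suc n)"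
          by (intro divide_left_mono) (auto simp: N_def simp flip: of_nat_Suc of_nat_mult intro!: mult_pos_pos)
        finally show ?thesis .
      qed
      have meas: "(\<lambda>z. f (z + m)) \<in> borel_measurable MM" if "m \<in> A n" for m
        using that A by (intro cell_measurable_translate fD) auto
      have "l2sq MM (\<lambda>z. s n \<eta> z - floquet_partial_sum (A n) f (z, \<eta>)) = l2sq MM (\<lambda>z. \<Sum>m\<in>A n. d m * f (z + m))"
        by (simp add: s_eq floquet_partial_sum_eq d_def left_diff_distrib sum_subtractf)
      also have "\<dots> \<le> (\<integral>\<^sup>+z. ennreal (4 / real (Suc n)) * (\<Sum>m\<in>A n. ennreal ((cmod (f (z + m)))\<^sup>2)) \<partial>MM)"
        unfolding l2sq_def
      proof (rule nn_integral_mono)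
        fix z
        have "(cmod (\<Sum>m\<in>A n. d m * f (z + m)))\<^sup>2 \<le> (\<Sum>m\<in>A n. (cmod (d m))\<^sup>2) * (\<Sum>m\<in>A n. (cmod (f (z + m)))\<^sup>2)"
          by (rule cmod_sum_power2_le[OF A(1)])
        also have "\<dots> \<le> (4 / real (Suc n)) * (\<Sum>m\<in>A n. (cmod (f (z + m)))\<^sup>2)"
          by (intro mult_right_mono d sum_nonneg) auto
        finally have "ennreal ((cmod (\<Sum>m\<in>A n. d m * f (z + m)))\<^sup>2)
            \<le> ennreal ((4 / real (Suc n)) * (\<Sum>m\<in>A n. (cmod (f (z + m)))\<^sup>2))" by (rule ennreal_leI)
        also have "\<dots> = ennreal (4 / real (Suc n)) * (\<Sum>m\<in>A n. ennreal ((cmod (f (z + m)))\<^sup>2))"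
          by (subst ennreal_mult'') (auto simp: sum_nonneg sum_ennreal)
        finally show "ennreal ((cmod (\<Sum>m\<in>A n. d m * f (z + m)))\<^sup>2)
            \<le> ennreal (4 / real (Suc n)) * (\<Sum>m\<in>A n. ennreal ((cmod (f (z + m)))\<^sup>2))" .
      qed
      also have "\<dots> = ennreal (4 / real (Suc n)) * (\<Sum>m\<in>A n. coef_sq f m)"
        unfolding coef_sq_def l2sq_def using meas
        by (subst nn_integral_cmult) (auto simp: nn_integral_sum simp del: sum_ennreal intro!: borel_measurable_sum)
      also have "\<dots> \<le> ennreal (4 / real (Suc n)) * ?X"
        by (intro mult_left_mono sum_coef_sq_le fD A) auto
      finally show ?thesis .
    qed
    obtain x where x: "x \<ge> 0" "?X = ennreal x" using fD(3) by (cases ?X) auto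
    have "(\<lambda>n. 4 * (1 / real (Suc n)) * x) \<longlonglongrightarrow> 4 * 0 * x"
      by (intro tendsto_intros LIMSEQ_Suc[OF lim_1_over_n])
    then have "(\<lambda>n. 4 / real (Suc n) * x) \<longlonglongrightarrow> 0" by simp
    then have "(\<lambda>n. ennreal (4 / real (Suc n) * x)) \<longlonglongrightarrow> 0"
      using tendsto_ennrealI[of "\<lambda>n. 4 / real (Suc n) * x" 0] by simp
    then have X0: "(\<lambda>n. ennreal (4 / real (Suc n)) * ?X) \<longlonglongrightarrow> 0"
      using x(1) unfolding x(2) by (subst (asm) ennreal_mult'') simp_all
    show ?thesis
      by (rule tendsto_sandwich[OF always_eventually always_eventually tendsto_const X0])
        (simp, rule allI, rule bound)
  qed
  show thesis by (rule that[of s]) (simp_all only: fin sA2 lev lim simp_thms)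
qed

text \<open>
  The pointwise limits along the index sets \<open>A j\<close> define \<open>g\<close>; by Fatou's lemma the distance of
  \<open>g\<close> from the partial sum over any \<open>B\<close> is controlled by the tail of the series outside \<open>B\<close>, which
  gives unconditional convergence.
\<close>

lemma floquet_exists:
  assumes f: "f \<in> A2 \<Omega>"
  obtains g where "g \<in> Bochner_A2_eta \<omega>"
    "((\<lambda>A. pair_sq (\<lambda>p. floquet_partial_sum A f p - g p)) \<longlongrightarrow> 0) (finite_subsets_at_top gauss_lattice)"
proof -
  note fD = A2_D[OF f]
  obtain A :: "nat \<Rightarrow> complex set" where A: "\<And>j. finite (A j)" "\<And>j. A j \<subseteq> gauss_lattice"
    and tail: "\<And>i j. i \<le> j \<Longrightarrow> small_tail f (shift_set (lattice_enum i) (A j)) ((1 / 16) ^ j / 4)"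
    using summing_sets[OF f] by blast
  define S where "S = (\<lambda>i j. shift_set (lattice_enum i) (A j))"
  have S: "finite (S i j)" "S i j \<subseteq> gauss_lattice" for i j
    unfolding S_def by (auto intro!: finite_shift_set A shift_set_lattice[OF A(2) lattice_enum_in, THEN subsetD])
  obtain i0 where i0: "lattice_enum i0 = 0"
    using bij_lattice_enum lattice_0 unfolding bij_betw_def by (metis rangeE)
  have tailA: "small_tail f (A j) ((1 / 16) ^ j / 4)" if "i0 \<le> j" for j
    using tail[OF that] i0 by simp
  define P where "P = (\<lambda>\<eta> H. bloch \<eta> H \<and> (\<forall>z\<in>\<Omega>. (\<lambda>j. floquet_partial_sum (A j) f (z, \<eta>)) \<longlonglongrightarrow> H z) \<and>
    (\<lambda>j. l2sq MM (\<lambda>z. floquet_partial_sum (A j) f (z, \<eta>) - H z)) \<longlonglongrightarrow> 0)"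
  have "AE \<eta> in QQ. \<forall>i. \<exists>K\<ge>0. \<forall>j\<ge>i. l2sq MM (\<lambda>z. floquet_partial_sum (S i (Suc j)) f (z, \<eta>)
        - floquet_partial_sum (S i j) f (z, \<eta>)) \<le> ennreal (K * (1 / 4) ^ j)"
    unfolding AE_all_countable
  proof (intro allI slice_difference_bound fD S)
    fix i j :: nat assume "i \<le> j"
    then have "small_tail f (S i (Suc j)) ((1 / 16) ^ Suc j / 4)" unfolding S_def by (intro tail) simp
    then show "small_tail f (S i (Suc j)) ((1 / 16) ^ j / 4)" by (rule small_tail_weaken) simp
    show "small_tail f (S i j) ((1 / 16) ^ j / 4)" unfolding S_def by (rule tail[OF \<open>i \<le> j\<close>])
  qed
  moreover have "AE \<eta> in QQ. \<forall>i. \<forall>i'. \<exists>K\<ge>0. \<forall>j\<ge>max i i'. l2sq MM (\<lambda>z. floquet_partial_sum (S i j) f (z, \<eta>)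
        - floquet_partial_sum (S i' j) f (z, \<eta>)) \<le> ennreal (K * (1 / 4) ^ j)"
    unfolding AE_all_countable
    by (intro allI slice_difference_bound fD S) (auto simp: S_def intro!: tail)
  ultimately have "AE \<eta> in QQ. \<exists>H. P \<eta> H"
  proof eventually_elim
    case (elim \<eta>)
    show ?case
    proof (rule partial_sum_limit[OF fD(1) A elim(1)[unfolded S_def, THEN spec]
          elim(2)[unfolded S_def, THEN spec, THEN spec]])
      fix H
      assume "bloch \<eta> H" "\<And>z. z \<in> \<Omega> \<Longrightarrow> (\<lambda>j. floquet_partial_sum (A j) f (z, \<eta>)) \<longlonglongrightarrow> H z"
        "(\<lambda>j. l2sq MM (\<lambda>z. floquet_partial_sum (A j) f (z, \<eta>) - H z)) \<longlonglongrightarrow> 0"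
      then show "\<exists>H. P \<eta> H" unfolding P_def by (intro exI[of _ H] conjI ballI)
    qed
  qed
  define g where "g = (\<lambda>(z, \<eta>). (SOME H. P \<eta> H) z)"
  have P: "AE \<eta> in QQ. P \<eta> (\<lambda>z. g (z, \<eta>))"
    using \<open>AE \<eta> in QQ. \<exists>H. P \<eta> H\<close> by eventually_elim (simp add: g_def someI_ex)
  have gA2: "AE \<eta> in QQ. (\<lambda>z. g (z, \<eta>)) \<in> A2 \<omega>"
    using P
  proof eventually_elim
    case (elim \<eta>)
    let ?H = "\<lambda>z. g (z, \<eta>)"
    have hol: "?H holomorphic_on \<Omega>" using elim by (simp add: P_def bloch_def)
    have "eventually (\<lambda>j. l2sq MM (\<lambda>z. floquet_partial_sum (A j) f (z, \<eta>) - ?H z) < 1) sequentially"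
      using elim unfolding P_def by (intro order_tendstoD(2)[of _ 0]) auto
    then obtain j where j: "l2sq MM (\<lambda>z. floquet_partial_sum (A j) f (z, \<eta>) - ?H z) < 1"
      by (auto simp: eventually_sequentially)
    let ?T = "\<lambda>z. floquet_partial_sum (A j) f (z, \<eta>)"
    have T: "?T \<in> A2 \<omega>" by (rule partial_sum_A2[OF f A])
    then have Tm: "?T \<in> borel_measurable MM" "l2sq MM ?T < \<infinity>" by (auto simp: A2_def L2_iff)
    have "l2sq MM ?H = l2sq MM (\<lambda>z. ?T z - (?T z - ?H z))" by simp
    also have "\<dots> \<le> 2 * l2sq MM ?T + 2 * l2sq MM (\<lambda>z. ?T z - ?H z)"
      by (intro l2sq_diff_le borel_measurable_diff Tm cell_measurable hol)
    also have "\<dots> < \<infinity>" using Tm(2) j by (auto simp: ennreal_mult_less_top intro: less_trans)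
    finally show ?case
      using cell_measurable[OF hol] holomorphic_on_subset[OF hol cell_subset_domain] by (simp add: A2_def L2_iff)
  qed
  have gA2eta: "AE \<eta> in QQ. (\<lambda>z. g (z, \<eta>)) \<in> A2_eta \<omega> \<eta>"
    using P gA2
  proof eventually_elim
    case (elim \<eta>)
    then have "bloch \<eta> (\<lambda>z. g (z, \<eta>))" by (simp add: P_def)
    then show ?case unfolding A2_eta_iff using elim(2) by blast
  qed
  obtain s :: "nat \<Rightarrow> real \<times> real \<Rightarrow> complex \<Rightarrow> complex" where
    s0: "\<forall>n. finite (s n ` quasimomenta)" "\<forall>n \<eta>. s n \<eta> \<in> A2 \<omega>"
    "\<forall>n h. {\<eta> \<in> quasimomenta. s n \<eta> = h} \<in> sets lebesgue"
    and slim0: "\<forall>\<eta>. (\<lambda>n. l2sq MM (\<lambda>z. s n \<eta> z - floquet_partial_sum (A n) f (z, \<eta>))) \<longlonglongrightarrow> 0"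
    by (rule simple_partial_sums[OF f A])
  note s = s0[rule_format] and slim = slim0[rule_format]
  have "AE \<eta> in QQ. (\<lambda>n. L2_norm \<omega> (\<lambda>z. s n \<eta> z - g (z, \<eta>))) \<longlonglongrightarrow> 0"
    using P gA2
  proof eventually_elim
    case (elim \<eta>)
    let ?H = "\<lambda>z. g (z, \<eta>)" and ?T = "\<lambda>n z. floquet_partial_sum (A n) f (z, \<eta>)"
    have Hm: "?H \<in> borel_measurable MM" using elim(2) by (simp add: A2_def L2_def)
    have sm: "s n \<eta> \<in> borel_measurable MM" for n using s(2)[of n \<eta>] by (simp add: A2_def L2_def)
    have Tm: "?T n \<in> borel_measurable MM" for n using partial_sum_A2[OF f A] by (simp add: A2_def L2_def)
    have le: "l2sq MM (\<lambda>z. s n \<eta> z - ?H z) \<le> 2 * l2sq MM (\<lambda>z. s n \<eta> z - ?T n z) + 2 * l2sq MM (\<lambda>z. ?T n z - ?H z)" for n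
      using l2sq_add_le[OF borel_measurable_diff[OF sm Tm] borel_measurable_diff[OF Tm Hm], of n n n] by simp
    have "(\<lambda>n. 2 * l2sq MM (\<lambda>z. s n \<eta> z - ?T n z) + 2 * l2sq MM (\<lambda>z. ?T n z - ?H z)) \<longlonglongrightarrow> 2 * 0 + 2 * 0"
      using elim(1) unfolding P_def by (intro tendsto_add ennreal_tendsto_cmult slim) auto
    then have r0: "(\<lambda>n. 2 * l2sq MM (\<lambda>z. s n \<eta> z - ?T n z) + 2 * l2sq MM (\<lambda>z. ?T n z - ?H z)) \<longlonglongrightarrow> 0" by simp
    have "(\<lambda>n. l2sq MM (\<lambda>z. s n \<eta> z - ?H z)) \<longlonglongrightarrow> 0"
      by (rule tendsto_sandwich[OF always_eventually always_eventually tendsto_const r0])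
        (simp, rule allI, rule le)
    moreover have "l2sq MM (\<lambda>z. s n \<eta> z - ?H z) = ennreal ((L2_norm \<omega> (\<lambda>z. s n \<eta> z - ?H z))\<^sup>2)" for n
      using s(2)[of n \<eta>] elim(2) A2_subset_L2[of \<omega>] by (intro L2_norm_sq[symmetric] L2_diff) auto
    ultimately show ?case by (intro tendsto_ennreal_sqrt_0) simp
  qed
  then have ap: "approximable g" unfolding approximable_def using s by (intro exI[of _ s]) auto
  obtain g' where g': "joint_version g g'" using approximable_version[OF gA2 ap] .
  have error: "pair_sq (\<lambda>p. floquet_partial_sum B f p - g p) \<le> ennreal (4 * \<epsilon>)"
    if B: "finite B" "B \<subseteq> gauss_lattice" "small_tail f B \<epsilon>" and \<epsilon>: "\<epsilon> > 0" for B \<epsilon>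
  proof -
    let ?D = "\<lambda>j p. floquet_partial_sum B f p - floquet_partial_sum (A j) f p"
    have Dm: "?D j \<in> borel_measurable (MM \<Otimes>\<^sub>M QQ)" for j
      by (intro borel_measurable_diff partial_sum_measurable fD A B)
    have "pair_sq (\<lambda>p. floquet_partial_sum B f p - g p) \<le> (\<integral>\<^sup>+\<eta>. liminf (\<lambda>j. l2sq MM (\<lambda>z. ?D j (z, \<eta>))) \<partial>QQ)"
      unfolding pair_sq_def
    proof (rule nn_integral_mono_AE)
      show "AE \<eta> in QQ. l2sq MM (\<lambda>z. floquet_partial_sum B f (z, \<eta>) - g (z, \<eta>)) \<le> liminf (\<lambda>j. l2sq MM (\<lambda>z. ?D j (z, \<eta>)))"
        using P
      proof eventually_elim
        case (elim \<eta>)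
        show ?case
        proof (rule l2sq_fatou)
          show "(\<lambda>z. ?D j (z, \<eta>)) \<in> borel_measurable MM" for j
            by (intro borel_measurable_diff cell_measurable partial_sum_holomorphic fD B A)
          show "AE z in MM. (\<lambda>j. ?D j (z, \<eta>)) \<longlonglongrightarrow> floquet_partial_sum B f (z, \<eta>) - g (z, \<eta>)"
            using elim cell_subset_domain by (intro AE_I2) (auto simp: P_def intro!: tendsto_intros)
        qed
      qed
    qed
    also have "\<dots> \<le> liminf (\<lambda>j. pair_sq (?D j))"
      unfolding pair_sq_def by (intro nn_integral_liminf slice_l2sq_measurable Dm)
    also have "\<dots> \<le> ennreal (4 * \<epsilon>)"
    proof (rule liminf_le_of_eventually_le)
      obtain J where J: "\<forall>j\<ge>J. (1 / 4) * (1 / 4 :: real) ^ j \<le> \<epsilon>"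
        using geometric_eventually_le[OF \<epsilon>, of 0 "1 / 4"] by blast
      have "pair_sq (?D j) \<le> ennreal (4 * \<epsilon>)" if j: "j \<ge> max J i0" for j
      proof (rule pair_sq_partial_sum_diff_le[OF fD(1) B(1,2) A B(3)])
        have "(1 / 16 :: real) ^ j \<le> (1 / 4) ^ j" by (intro power_mono) auto
        then have "(1 / 16 :: real) ^ j / 4 \<le> \<epsilon>" using J j by force
        then show "small_tail f (A j) \<epsilon>" using tailA[of j] j small_tail_weaken by auto
      qed (use \<epsilon> in auto)
      then show "eventually (\<lambda>j. pair_sq (?D j) \<le> ennreal (4 * \<epsilon>)) sequentially"
        unfolding eventually_sequentially by blast
    qed
    finally show ?thesis .
  qed
  have "pair_sq g < \<infinity>"
  proof -
    obtain B where B: "finite B" "B \<subseteq> gauss_lattice" "small_tail f B 1" using small_tail_exists[OF f, of 1] by auto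
    let ?S = "floquet_partial_sum B f"
    have rS: "joint_version ?S ?S" by (intro joint_version_self partial_sum_measurable fD B)
    have "pair_sq g = pair_sq (\<lambda>p. ?S p - (?S p - g p))" by simp
    also have "\<dots> \<le> 2 * pair_sq ?S + 2 * pair_sq (\<lambda>p. ?S p - g p)"
      by (rule pair_sq_diff_le[OF rS joint_version_diff[OF rS g']])
    also have "\<dots> < \<infinity>"
    proof -
      have "pair_sq ?S < \<infinity>"
        unfolding pair_sq_partial_sum[OF fD(1) B(1,2)] using sum_coef_sq_le[OF fD(2) B(1,2)] fD(3) by (rule le_less_trans)
      moreover have "pair_sq (\<lambda>p. ?S p - g p) < \<infinity>"
        using error[OF B] by (auto intro: le_less_trans)
      ultimately show ?thesis by (auto simp: ennreal_mult_less_top)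
    qed
    finally show ?thesis .
  qed
  then have "g \<in> Bochner_A2_eta \<omega>"
    unfolding Bochner_A2_eta_def using Bochner_A2_I[OF gA2 ap] gA2eta by blast
  moreover have "((\<lambda>B. pair_sq (\<lambda>p. floquet_partial_sum B f p - g p)) \<longlongrightarrow> 0) (finite_subsets_at_top gauss_lattice)"
  proof (rule ennreal_tendsto_0I)
    fix e :: real assume e: "e > 0"
    obtain B where B: "finite B" "B \<subseteq> gauss_lattice" "small_tail f B (e / 4)"
      using small_tail_exists[OF f, of "e / 4"] e by auto
    show "eventually (\<lambda>C. pair_sq (\<lambda>p. floquet_partial_sum C f p - g p) \<le> ennreal e) (finite_subsets_at_top gauss_lattice)"
      unfolding eventually_finite_subsets_at_top
    proof (intro exI[of _ B] conjI allI impI B)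
      fix C assume C: "finite C \<and> B \<subseteq> C \<and> C \<subseteq> gauss_lattice"
      then have "small_tail f C (e / 4)" using small_tail_mono[OF B(3)] by blast
      then show "pair_sq (\<lambda>p. floquet_partial_sum C f p - g p) \<le> ennreal e"
        using error[of C "e / 4"] C e by simp
    qed
  qed
  ultimately show thesis by (rule that)
qed

end

lemma polarization_pointwise:
  "p * cnj q = (\<Sum>c\<in>{1, -1, \<i>, -\<i>}. c * complex_of_real ((cmod (1 * p + c * q))\<^sup>2)) / 4"
  by (simp add: complex_eq_iff cmod_power2 del: of_real_power) (simp add: power2_eq_square algebra_simps)

lemma polarization:
  assumes [measurable]: "u \<in> borel_measurable M" "v \<in> borel_measurable M"
    and fin: "l2sq M u < \<infinity>" "l2sq M v < \<infinity>"
  shows "(LINT x|M. u x * cnj (v x)) = (\<Sum>c\<in>{1, -1, \<i>, -\<i>}. c * of_real (enn2real (l2sq M (\<lambda>x. 1 * u x + c * v x)))) / 4"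
proof -
  have int: "integrable M (\<lambda>x. (cmod (1 * u x + c * v x))\<^sup>2)" for c
    using l2sq_lincomb_le[of u M v 1 c] fin
    by (subst l2sq_finite_iff[symmetric]) (auto simp: ennreal_mult_less_top elim!: le_less_trans)
  have eq: "of_real (enn2real (l2sq M (\<lambda>x. 1 * u x + c * v x))) = (LINT x|M. complex_of_real ((cmod (1 * u x + c * v x))\<^sup>2))" for c
  proof -
    have "l2sq M (\<lambda>x. 1 * u x + c * v x) = ennreal (LINT x|M. (cmod (1 * u x + c * v x))\<^sup>2)"
      unfolding l2sq_def using nn_integral_eq_integral[OF int[of c]] by simp
    then have "enn2real (l2sq M (\<lambda>x. 1 * u x + c * v x)) = (LINT x|M. (cmod (1 * u x + c * v x))\<^sup>2)" by simp
    then show ?thesis by (simp only: integral_complex_of_real)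
  qed
  have "u x * cnj (v x) = (\<Sum>c\<in>{1, -1, \<i>, -\<i>}. c * complex_of_real ((cmod (1 * u x + c * v x))\<^sup>2)) / 4" for x
    by (rule polarization_pointwise)
  then have "(LINT x|M. u x * cnj (v x)) = (LINT x|M. (\<Sum>c\<in>{1, -1, \<i>, -\<i>}. c * complex_of_real ((cmod (1 * u x + c * v x))\<^sup>2)) / 4)"
    by (simp only:)
  also have "\<dots> = (\<Sum>c\<in>{1, -1, \<i>, -\<i>}. c * (LINT x|M. complex_of_real ((cmod (1 * u x + c * v x))\<^sup>2))) / 4"
    using int by (simp only: integral_divide_zero integral_mult_right_zero Bochner_Integration.integral_sum integrable_mult_right integrable_of_real)
  finally show ?thesis by (simp only: eq)
qed

text \<open>
  Continuity of the norm, from \<open>\<bar>a + b\<bar>\<^sup>2 \<le> (1 + \<delta>) \<bar>a\<bar>\<^sup>2 + (1 + 1/\<delta>) \<bar>b\<bar>\<^sup>2\<close> with \<open>\<delta>\<close>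
  tending to \<open>0\<close>.
\<close>

lemma l2sq_limit_eq:
  assumes u[measurable]: "\<And>n::nat. u n \<in> borel_measurable M" and g[measurable]: "g \<in> borel_measurable M"
    and diff: "(\<lambda>n. l2sq M (\<lambda>x. u n x - g x)) \<longlonglongrightarrow> 0" and X: "(\<lambda>n. l2sq M (u n)) \<longlonglongrightarrow> X"
    and fin: "X < \<infinity>" "l2sq M g < \<infinity>"
  shows "l2sq M g = X"
proof -
  have weighted: "l2sq M (\<lambda>x. a x + b x) \<le> ennreal (1 + \<delta>) * l2sq M a + ennreal (1 + 1 / \<delta>) * l2sq M b"
    if \<delta>: "\<delta> > 0" and [measurable]: "a \<in> borel_measurable M" "b \<in> borel_measurable M" for \<delta> a b
  proof -
    have pt: "(cmod (p + q))\<^sup>2 \<le> (1 + \<delta>) * (cmod p)\<^sup>2 + (1 + 1 / \<delta>) * (cmod q)\<^sup>2" for p q :: complex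
    proof -
      have "(cmod (p + q))\<^sup>2 \<le> (cmod p + cmod q)\<^sup>2" by (intro power_mono norm_triangle_ineq) auto
      moreover have "0 \<le> (\<delta> * cmod p - cmod q)\<^sup>2 / \<delta>" using \<delta> by simp
      moreover have "(\<delta> * cmod p - cmod q)\<^sup>2 / \<delta> = \<delta> * (cmod p)\<^sup>2 - 2 * cmod p * cmod q + (cmod q)\<^sup>2 / \<delta>"
        using \<delta> by (simp add: power2_eq_square field_simps)
      ultimately show ?thesis by (simp add: power2_sum algebra_simps)
    qed
    have "l2sq M (\<lambda>x. a x + b x) \<le> (\<integral>\<^sup>+x. ennreal (1 + \<delta>) * ennreal ((cmod (a x))\<^sup>2) + ennreal (1 + 1 / \<delta>) * ennreal ((cmod (b x))\<^sup>2) \<partial>M)"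
      unfolding l2sq_def
    proof (rule nn_integral_mono)
      fix x
      have "ennreal ((cmod (a x + b x))\<^sup>2) \<le> ennreal ((1 + \<delta>) * (cmod (a x))\<^sup>2 + (1 + 1 / \<delta>) * (cmod (b x))\<^sup>2)"
        by (rule ennreal_leI[OF pt])
      also have "\<dots> = ennreal (1 + \<delta>) * ennreal ((cmod (a x))\<^sup>2) + ennreal (1 + 1 / \<delta>) * ennreal ((cmod (b x))\<^sup>2)"
        using \<delta> by (subst ennreal_plus) (auto simp: ennreal_mult'' simp del: ennreal_plus)
      finally show "ennreal ((cmod (a x + b x))\<^sup>2) \<le> ennreal (1 + \<delta>) * ennreal ((cmod (a x))\<^sup>2) + ennreal (1 + 1 / \<delta>) * ennreal ((cmod (b x))\<^sup>2)" .
    qed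
    also have "\<dots> = ennreal (1 + \<delta>) * l2sq M a + ennreal (1 + 1 / \<delta>) * l2sq M b"
      unfolding l2sq_def by (subst nn_integral_add) (auto simp: nn_integral_cmult)
    finally show ?thesis .
  qed
  have eps: "a \<le> b" if ab: "\<And>\<delta>. \<delta> > 0 \<Longrightarrow> a \<le> ennreal (1 + \<delta>) * b" and b: "b < \<infinity>" for a b :: ennreal
  proof (rule ennreal_le_epsilon)
    fix e :: real assume e: "0 < e"
    obtain r where r: "r \<ge> 0" "b = ennreal r" using b by (cases b) auto
    define \<delta> where "\<delta> = e / (r + 1)"
    have \<delta>: "\<delta> > 0" using e r by (simp add: \<delta>_def)
    have "\<delta> * r \<le> e" using e r by (simp add: \<delta>_def field_simps)
    then have "(1 + \<delta>) * r \<le> r + e" by (simp add: algebra_simps)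
    then have "ennreal ((1 + \<delta>) * r) \<le> ennreal (r + e)" by (rule ennreal_leI)
    then have "ennreal (1 + \<delta>) * b \<le> b + ennreal e" using r e \<delta> by (simp add: ennreal_mult'' )
    then show "a \<le> b + ennreal e" using ab[OF \<delta>] by simp
  qed
  show ?thesis
  proof (rule antisym)
    show "l2sq M g \<le> X"
    proof (rule eps[OF _ fin(1)])
      fix \<delta> :: real assume \<delta>: "\<delta> > 0"
      have le: "l2sq M g \<le> ennreal (1 + \<delta>) * l2sq M (u n) + ennreal (1 + 1 / \<delta>) * l2sq M (\<lambda>x. u n x - g x)" for n
        using weighted[OF \<delta>, of "u n" "\<lambda>x. g x - u n x"] by (simp add: l2sq_minus_commute[of M g])
      have "(\<lambda>n. ennreal (1 + \<delta>) * l2sq M (u n) + ennreal (1 + 1 / \<delta>) * l2sq M (\<lambda>x. u n x - g x))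
          \<longlonglongrightarrow> ennreal (1 + \<delta>) * X + ennreal (1 + 1 / \<delta>) * 0"
        by (intro tendsto_add ennreal_tendsto_cmult diff X) auto
      from LIMSEQ_le_const[OF this] le show "l2sq M g \<le> ennreal (1 + \<delta>) * X" by (simp only: mult_zero_right add_0_right) blast
    qed
    show "X \<le> l2sq M g"
    proof (rule eps[OF _ fin(2)])
      fix \<delta> :: real assume \<delta>: "\<delta> > 0"
      have le: "l2sq M (u n) \<le> ennreal (1 + \<delta>) * l2sq M g + ennreal (1 + 1 / \<delta>) * l2sq M (\<lambda>x. u n x - g x)" for n
        using weighted[OF \<delta>, of g "\<lambda>x. u n x - g x"] by simp
      have "(\<lambda>n. ennreal (1 + \<delta>) * l2sq M g + ennreal (1 + 1 / \<delta>) * l2sq M (\<lambda>x. u n x - g x))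
          \<longlonglongrightarrow> ennreal (1 + \<delta>) * l2sq M g + ennreal (1 + 1 / \<delta>) * 0"
        by (intro tendsto_add tendsto_const ennreal_tendsto_cmult diff) auto
      then have "X \<le> ennreal (1 + \<delta>) * l2sq M g + ennreal (1 + 1 / \<delta>) * 0"
        by (rule LIMSEQ_le[OF X]) (use le in blast)
      then show "X \<le> ennreal (1 + \<delta>) * l2sq M g" by simp
    qed
  qed
qed

context cell_setting
begin

lemma bloch_lincomb: "bloch \<eta> H \<Longrightarrow> bloch \<eta> K \<Longrightarrow> bloch \<eta> (\<lambda>z. a * H z + b * K z)"
  by (auto simp: bloch_def algebra_simps intro!: holomorphic_intros)

lemma Bochner_A2_etaD:
  assumes "g \<in> Bochner_A2_eta \<omega>" shows "g \<in> Bochner_L2 \<omega> (A2 \<omega>)" "AE \<eta> in QQ. (\<lambda>z. g (z, \<eta>)) \<in> A2_eta \<omega> \<eta>"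
  using assms by (auto simp: Bochner_A2_eta_def)

lemma Bochner_A2_eta_lincomb:
  assumes g: "g \<in> Bochner_A2_eta \<omega>" and h: "h \<in> Bochner_A2_eta \<omega>"
  shows "(\<lambda>p. a * g p + b * h p) \<in> Bochner_A2_eta \<omega>"
proof -
  have "AE \<eta> in QQ. (\<lambda>z. a * g (z, \<eta>) + b * h (z, \<eta>)) \<in> A2_eta \<omega> \<eta>"
    using Bochner_A2_etaD(2)[OF g] Bochner_A2_etaD(2)[OF h]
  proof eventually_elim
    case (elim \<eta>)
    then obtain H K where HK: "bloch \<eta> H" "bloch \<eta> K" "\<forall>z\<in>\<omega>. H z = g (z, \<eta>)" "\<forall>z\<in>\<omega>. K z = h (z, \<eta>)"
      and A: "(\<lambda>z. g (z, \<eta>)) \<in> A2 \<omega>" "(\<lambda>z. h (z, \<eta>)) \<in> A2 \<omega>"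
      unfolding A2_eta_iff by blast
    have "\<forall>z\<in>\<omega>. a * H z + b * K z = a * g (z, \<eta>) + b * h (z, \<eta>)" using HK(3,4) by simp
    then show ?case unfolding A2_eta_iff using A2_lincomb[OF A] bloch_lincomb[OF HK(1,2)] by blast
  qed
  then show ?thesis
    using Bochner_A2_lincomb[OF Bochner_A2_etaD(1)[OF g] Bochner_A2_etaD(1)[OF h]] by (simp add: Bochner_A2_eta_def)
qed

text \<open>
  For square integrable \<open>f\<close> and \<open>g\<close> all differences have finite \<open>pair_sq\<close>, so that the Bochner norm
  in the definition of the transform never takes its default value.
\<close>

lemma has_floquet_iff:
  assumes f: "f \<in> A2 \<Omega>" and g: "g \<in> Bochner_A2_eta \<omega>"
  shows "has_floquet_transform \<omega> f g \<longleftrightarrow>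
    ((\<lambda>A. pair_sq (\<lambda>p. floquet_partial_sum A f p - g p)) \<longlongrightarrow> 0) (finite_subsets_at_top gauss_lattice)"
proof -
  note fD = A2_D[OF f]
  obtain g' where g': "joint_version g g'" "pair_sq g < \<infinity>" using Bochner_A2_version[OF Bochner_A2_etaD(1)[OF g]] .
  have fin: "eventually (\<lambda>A. finite A \<and> A \<subseteq> gauss_lattice) (finite_subsets_at_top gauss_lattice)"
    unfolding eventually_finite_subsets_at_top by (intro exI[of _ "{}"]) auto
  have eq: "ennreal ((Bochner_norm \<omega> (\<lambda>p. floquet_partial_sum A f p - g p))\<^sup>2) = pair_sq (\<lambda>p. floquet_partial_sum A f p - g p)"
    if A: "finite A \<and> A \<subseteq> gauss_lattice" for A
  proof (rule joint_version_norm_sq(2))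
    let ?S = "floquet_partial_sum A f"
    have r: "joint_version ?S ?S" using A by (intro joint_version_self partial_sum_measurable fD) auto
    show "joint_version (\<lambda>p. ?S p - g p) (\<lambda>p. ?S p - g' p)" by (rule joint_version_diff[OF r g'(1)])
    have "pair_sq ?S \<le> l2sq (lebesgue_on \<Omega>) f"
      using A sum_coef_sq_le[OF fD(2), of A] pair_sq_partial_sum[OF fD(1), of A] by simp
    then have "pair_sq ?S < \<infinity>" using fD(3) by (rule le_less_trans)
    then show "pair_sq (\<lambda>p. ?S p - g p) < \<infinity>"
      using pair_sq_diff_le[OF r g'(1)] g'(2) by (auto simp: ennreal_mult_less_top elim!: le_less_trans)
  qed
  have "has_floquet_transform \<omega> f g \<longleftrightarrow>
    ((\<lambda>A. Bochner_norm \<omega> (\<lambda>p. floquet_partial_sum A f p - g p)) \<longlongrightarrow> 0) (finite_subsets_at_top gauss_lattice)"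
    unfolding has_floquet_transform_def
    using f A2_subset_L2 Bochner_L2_mono[OF A2_subset_L2] Bochner_A2_etaD(1)[OF g] by blast
  also have "\<dots> \<longleftrightarrow> ((\<lambda>A. ennreal ((Bochner_norm \<omega> (\<lambda>p. floquet_partial_sum A f p - g p))\<^sup>2)) \<longlongrightarrow> 0) (finite_subsets_at_top gauss_lattice)"
  proof
    assume "((\<lambda>A. Bochner_norm \<omega> (\<lambda>p. floquet_partial_sum A f p - g p)) \<longlongrightarrow> 0) (finite_subsets_at_top gauss_lattice)"
    then have "((\<lambda>A. ennreal ((Bochner_norm \<omega> (\<lambda>p. floquet_partial_sum A f p - g p))\<^sup>2)) \<longlongrightarrow> ennreal (0\<^sup>2)) (finite_subsets_at_top gauss_lattice)"
      by (intro tendsto_intros)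
    then show "((\<lambda>A. ennreal ((Bochner_norm \<omega> (\<lambda>p. floquet_partial_sum A f p - g p))\<^sup>2)) \<longlongrightarrow> 0) (finite_subsets_at_top gauss_lattice)" by simp
  qed (rule tendsto_ennreal_sqrt_0)
  also have "\<dots> \<longleftrightarrow> ((\<lambda>A. pair_sq (\<lambda>p. floquet_partial_sum A f p - g p)) \<longlongrightarrow> 0) (finite_subsets_at_top gauss_lattice)"
    by (rule tendsto_cong[OF eventually_mono[OF fin eq]])
  finally show ?thesis .
qed

text \<open>
  The squared norms of the partial sums along an enumeration of the lattice are the partial sums of
  the squared norms of \<open>f\<close> on the translated cells.
\<close>

lemma floquet_norm:
  assumes f: "f \<in> A2 \<Omega>" and g: "g \<in> Bochner_A2_eta \<omega>" and fg: "has_floquet_transform \<omega> f g"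
  shows "pair_sq g = l2sq (lebesgue_on \<Omega>) f"
proof -
  note fD = A2_D[OF f]
  obtain g' where g': "joint_version g g'" "pair_sq g < \<infinity>" using Bochner_A2_version[OF Bochner_A2_etaD(1)[OF g]] .
  define A where "A = (\<lambda>N. lattice_enum ` {..<N::nat})"
  have A: "finite (A N)" "A N \<subseteq> gauss_lattice" for N using lattice_enum_in by (auto simp: A_def)
  have flim: "filterlim A (finite_subsets_at_top gauss_lattice) sequentially"
    unfolding filterlim_finite_subsets_at_top
  proof (intro allI impI)
    fix X assume X: "finite X \<and> X \<subseteq> gauss_lattice"
    have "\<forall>x\<in>X. \<exists>n. x = lattice_enum n" using X bij_lattice_enum by (auto simp: bij_betw_def)
    then obtain n where n: "\<And>x. x \<in> X \<Longrightarrow> x = lattice_enum (n x)" by metis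
    have "X \<subseteq> A N" if "N \<ge> Suc (\<Sum>x\<in>X. n x)" for N
    proof
      fix x assume x: "x \<in> X"
      then have "n x \<le> (\<Sum>x\<in>X. n x)" using X by (intro member_le_sum) auto
      then show "x \<in> A N" using n[OF x] that by (auto simp: A_def)
    qed
    then show "eventually (\<lambda>N. finite (A N) \<and> X \<subseteq> A N \<and> A N \<subseteq> gauss_lattice) sequentially"
      unfolding eventually_sequentially using A by blast
  qed
  let ?M = "MM \<Otimes>\<^sub>M QQ"
  have Sm: "floquet_partial_sum (A N) f \<in> borel_measurable ?M" for N by (intro partial_sum_measurable fD A)
  have "(\<lambda>N. pair_sq (\<lambda>p. floquet_partial_sum (A N) f p - g p)) \<longlonglongrightarrow> 0"
    using fg[unfolded has_floquet_iff[OF f g]] flim by (rule filterlim_compose)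
  then have diff: "(\<lambda>N. l2sq ?M (\<lambda>p. floquet_partial_sum (A N) f p - g' p)) \<longlonglongrightarrow> 0"
    by (simp add: pair_sq_version[OF joint_version_diff[OF joint_version_self[OF Sm] g'(1)]])
  have lim: "(\<lambda>N. l2sq ?M (floquet_partial_sum (A N) f)) \<longlonglongrightarrow> l2sq (lebesgue_on \<Omega>) f"
    using coef_sq_sums[OF fD(2)]
    by (simp add: A_def[symmetric] pair_sq_version[OF joint_version_self[OF Sm], symmetric] pair_sq_partial_sum[OF fD(1) A] fun_cong[OF A_def, symmetric])
  have "g' \<in> borel_measurable ?M" "l2sq ?M g' < \<infinity>" using g' pair_sq_version[OF g'(1)] by (auto simp: joint_version_def)
  then have "l2sq ?M g' = l2sq (lebesgue_on \<Omega>) f" by (intro l2sq_limit_eq[OF Sm _ diff lim fD(3)])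
  then show ?thesis using pair_sq_version[OF g'(1)] by simp
qed

lemma floquet_partial_sum_lincomb:
  "floquet_partial_sum A (\<lambda>x. a * f x + b * f' x) p = a * floquet_partial_sum A f p + b * floquet_partial_sum A f' p"
proof -
  obtain z \<eta> where p: "p = (z, \<eta>)" by (metis surj_pair)
  show ?thesis unfolding p floquet_partial_sum_eq
    by (simp add: sum_distrib_left sum.distrib[symmetric] algebra_simps)
qed

lemma floquet_lincomb:
  assumes f: "f \<in> A2 \<Omega>" "g \<in> Bochner_A2_eta \<omega>" "has_floquet_transform \<omega> f g"
    and f': "f' \<in> A2 \<Omega>" "g' \<in> Bochner_A2_eta \<omega>" "has_floquet_transform \<omega> f' g'"
  shows "has_floquet_transform \<omega> (\<lambda>x. a * f x + b * f' x) (\<lambda>p. a * g p + b * g' p)"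
  unfolding has_floquet_iff[OF A2_lincomb[OF f(1) f'(1)] Bochner_A2_eta_lincomb[OF f(2) f'(2)]]
proof (rule tendsto_sandwich[OF always_eventually _ tendsto_const])
  let ?F = "finite_subsets_at_top gauss_lattice"
  let ?e = "\<lambda>A. pair_sq (\<lambda>p. floquet_partial_sum A f p - g p)" and ?e' = "\<lambda>A. pair_sq (\<lambda>p. floquet_partial_sum A f' p - g' p)"
  obtain k where k: "joint_version g k" "pair_sq g < \<infinity>" using Bochner_A2_version[OF Bochner_A2_etaD(1)[OF f(2)]] .
  obtain k' where k': "joint_version g' k'" "pair_sq g' < \<infinity>" using Bochner_A2_version[OF Bochner_A2_etaD(1)[OF f'(2)]] .
  have "((\<lambda>A. 2 * (ennreal ((cmod a)\<^sup>2) * ?e A) + 2 * (ennreal ((cmod b)\<^sup>2) * ?e' A))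
      \<longlongrightarrow> 2 * (ennreal ((cmod a)\<^sup>2) * 0) + 2 * (ennreal ((cmod b)\<^sup>2) * 0)) ?F"
    by (intro tendsto_add ennreal_tendsto_cmult f(3)[unfolded has_floquet_iff[OF f(1,2)]]
        f'(3)[unfolded has_floquet_iff[OF f'(1,2)]]) auto
  then show "((\<lambda>A. 2 * (ennreal ((cmod a)\<^sup>2) * ?e A) + 2 * (ennreal ((cmod b)\<^sup>2) * ?e' A)) \<longlongrightarrow> 0) ?F" by simp
  have fin: "eventually (\<lambda>A. finite A \<and> A \<subseteq> gauss_lattice) ?F"
    unfolding eventually_finite_subsets_at_top by (intro exI[of _ "{}"]) auto
  then show "eventually (\<lambda>A. pair_sq (\<lambda>p. floquet_partial_sum A (\<lambda>x. a * f x + b * f' x) p - (a * g p + b * g' p))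
      \<le> 2 * (ennreal ((cmod a)\<^sup>2) * ?e A) + 2 * (ennreal ((cmod b)\<^sup>2) * ?e' A)) ?F"
  proof eventually_elim
    case (elim A)
    have r: "joint_version (floquet_partial_sum A f) (floquet_partial_sum A f)" "joint_version (floquet_partial_sum A f') (floquet_partial_sum A f')"
      using elim by (auto intro!: joint_version_self partial_sum_measurable A2_D f f')
    have "floquet_partial_sum A (\<lambda>x. a * f x + b * f' x) p - (a * g p + b * g' p)
      = a * (floquet_partial_sum A f p - g p) + b * (floquet_partial_sum A f' p - g' p)" for p
      unfolding floquet_partial_sum_lincomb by (simp add: algebra_simps)
    then show ?case using pair_sq_lincomb_le[OF joint_version_diff[OF r(1) k(1)] joint_version_diff[OF r(2) k'(1)], of a b] by simp
  qed
qed simp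

lemma floquet_inner:
  assumes f: "f \<in> A2 \<Omega>" "g \<in> Bochner_A2_eta \<omega>" "has_floquet_transform \<omega> f g"
    and f': "f' \<in> A2 \<Omega>" "g' \<in> Bochner_A2_eta \<omega>" "has_floquet_transform \<omega> f' g'"
  shows "Bochner_inner \<omega> g g' = L2_inner \<Omega> f f'"
proof -
  obtain k where k: "joint_version g k" "pair_sq g < \<infinity>" using Bochner_A2_version[OF Bochner_A2_etaD(1)[OF f(2)]] .
  obtain k' where k': "joint_version g' k'" "pair_sq g' < \<infinity>" using Bochner_A2_version[OF Bochner_A2_etaD(1)[OF f'(2)]] .
  let ?M = "MM \<Otimes>\<^sub>M QQ" and ?L = "lebesgue_on \<Omega>"
  have km: "k \<in> borel_measurable ?M" "k' \<in> borel_measurable ?M" using k k' by (auto simp: joint_version_def)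
  have kf: "l2sq ?M k < \<infinity>" "l2sq ?M k' < \<infinity>" using k k' by (simp_all add: pair_sq_version)
  have fm: "f \<in> borel_measurable ?L" "f' \<in> borel_measurable ?L" "l2sq ?L f < \<infinity>" "l2sq ?L f' < \<infinity>"
    using f(1) f'(1) by (auto simp: A2_def L2_iff)
  have norm: "l2sq ?M (\<lambda>p. 1 * k p + c * k' p) = l2sq ?L (\<lambda>z. 1 * f z + c * f' z)" for c
    using floquet_norm[OF A2_lincomb[OF f(1) f'(1)] Bochner_A2_eta_lincomb[OF f(2) f'(2)] floquet_lincomb[OF f f'], of 1 c]
    unfolding pair_sq_version[OF joint_version_lincomb[OF k(1) k'(1)]] .
  show ?thesis
    unfolding Bochner_inner_version[OF k k'] L2_inner_def polarization[OF km kf] polarization[OF fm] norm ..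
qed

text \<open>
  The difference of \<open>f\<close> and \<open>f'\<close> has transform \<open>0\<close>, hence norm \<open>0\<close>; analytic functions of
  norm \<open>0\<close> vanish at every point.
\<close>

lemma floquet_injective:
  assumes f: "f \<in> A2 \<Omega>" "has_floquet_transform \<omega> f g" and f': "f' \<in> A2 \<Omega>" "has_floquet_transform \<omega> f' g"
    and g: "g \<in> Bochner_A2_eta \<omega>" and z: "z \<in> \<Omega>"
  shows "f z = f' z"
proof -
  let ?d = "\<lambda>z. 1 * f z + (-1) * f' z" and ?z = "\<lambda>p. 1 * g p + (-1) * g p"
  have d: "?d \<in> A2 \<Omega>" by (rule A2_lincomb[OF f(1) f'(1)])
  have "pair_sq ?z = l2sq (lebesgue_on \<Omega>) ?d"
    by (rule floquet_norm[OF d Bochner_A2_eta_lincomb[OF g g] floquet_lincomb[OF f(1) g f(2) f'(1) g f'(2)]])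
  moreover have "pair_sq ?z = 0" by (simp add: pair_sq_def l2sq_def)
  ultimately have 0: "l2sq (lebesgue_on \<Omega>) ?d = 0" by simp
  obtain C where "C \<ge> 0" "\<forall>G. G holomorphic_on \<Omega> \<longrightarrow> ennreal ((cmod (G z))\<^sup>2) \<le> ennreal C * l2sq (lebesgue_on \<Omega>) G"
    using bergman_estimate[OF open_domain z] by blast
  then have "ennreal ((cmod (?d z))\<^sup>2) \<le> ennreal C * l2sq (lebesgue_on \<Omega>) ?d" using A2_D(1)[OF d] by blast
  then show ?thesis unfolding 0 by simp
qed

lemma bloch_local_bound:
  assumes z: "z \<in> \<Omega>"
  obtains r C where "r > 0" "C \<ge> 0" "cball z r \<subseteq> \<Omega>"
    "\<forall>\<eta> H. bloch \<eta> H \<longrightarrow> (\<forall>w\<in>cball z r. ennreal ((cmod (H w))\<^sup>2) \<le> ennreal C * l2sq MM H)"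
proof -
  obtain r C F where r: "r > 0" "C \<ge> 0" "cball z r \<subseteq> \<Omega>" "finite F" "F \<subseteq> gauss_lattice"
    and est: "\<forall>G w. G holomorphic_on \<Omega> \<longrightarrow> w \<in> cball z r \<longrightarrow>
       ennreal ((cmod (G w))\<^sup>2) \<le> ennreal C * (\<Sum>l\<in>F. l2sq MM (\<lambda>v. G (v + l)))"
    using local_bergman_estimate[OF z] by blast
  have "ennreal ((cmod (H w))\<^sup>2) \<le> ennreal (C * card F) * l2sq MM H" if H: "bloch \<eta> H" and w: "w \<in> cball z r" for \<eta> H w
  proof -
    have "ennreal ((cmod (H w))\<^sup>2) \<le> ennreal C * (\<Sum>l\<in>F. l2sq MM (\<lambda>v. H (v + l)))"
      using est H w unfolding bloch_def by blast
    also have "(\<Sum>l\<in>F. l2sq MM (\<lambda>v. H (v + l))) = (\<Sum>l\<in>F. l2sq MM H)"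
    proof (rule sum.cong[OF refl])
      fix l assume "l \<in> F"
      then have l: "l \<in> gauss_lattice" using r by blast
      have "cmod (H (v + l)) = cmod (H v)" if "v \<in> \<omega>" for v
        using H l that cell_subset_domain by (auto simp: bloch_def norm_mult)
      then show "l2sq MM (\<lambda>v. H (v + l)) = l2sq MM H" unfolding l2sq_def by (intro nn_integral_cong) simp
    qed
    also have "ennreal C * (\<Sum>l\<in>F. l2sq MM H) = ennreal (C * card F) * l2sq MM H"
      using r by (simp add: ennreal_mult'' ennreal_of_nat_eq_real_of_nat mult.assoc)
    finally show ?thesis .
  qed
  then show thesis using that[of r "C * card F"] r by (simp add: mult_nonneg_nonneg)
qed

end

section \<open>Preservation of inner products\<close>

lemma holomorphic_on_integral:
  fixes K :: "'a \<Rightarrow> complex \<Rightarrow> complex"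
  assumes S: "open S" and hol: "AE \<eta> in N. K \<eta> holomorphic_on S"
    and meas: "\<And>z. z \<in> S \<Longrightarrow> (\<lambda>\<eta>. K \<eta> z) \<in> borel_measurable N"
    and bound: "\<And>z. z \<in> S \<Longrightarrow> \<exists>r>0. \<exists>\<beta>. cball z r \<subseteq> S \<and> integrable N \<beta> \<and> (AE \<eta> in N. \<forall>w\<in>cball z r. cmod (K \<eta> w) \<le> \<beta> \<eta>)"
  shows "(\<lambda>z. LINT \<eta>|N. K \<eta> z) holomorphic_on S"
proof -
  have "(\<lambda>z. LINT \<eta>|N. K \<eta> z) field_differentiable (at z)" if z: "z \<in> S" for z
  proof -
    obtain r \<beta> where r: "r > 0" "cball z r \<subseteq> S" and \<beta>: "integrable N \<beta>" "AE \<eta> in N. \<forall>w\<in>cball z r. cmod (K \<eta> w) \<le> \<beta> \<eta>"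
      using bound[OF z] by blast
    have int: "integrable N (\<lambda>\<eta>. K \<eta> w)" if w: "w \<in> cball z r" for w
    proof (rule Bochner_Integration.integrable_bound[OF \<beta>(1)])
      show "(\<lambda>\<eta>. K \<eta> w) \<in> borel_measurable N" using meas w r by blast
      show "AE \<eta> in N. norm (K \<eta> w) \<le> norm (\<beta> \<eta>)" using \<beta>(2) by eventually_elim (use w in force)
    qed
    define q where "q = (\<lambda>y \<eta>. (K \<eta> y - K \<eta> z) / (y - z))"
    have lipschitz: "AE \<eta> in N. \<forall>y\<in>ball z (r / 2). y \<noteq> z \<longrightarrow> cmod (q y \<eta>) \<le> 2 / r * \<beta> \<eta>"
      using hol \<beta>(2)
    proof eventually_elim
      case (elim \<eta>)
      have der: "(K \<eta> has_field_derivative deriv (K \<eta>) w) (at w within ball z (r / 2))" if w: "w \<in> ball z (r / 2)" for w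
      proof -
        have "w \<in> S" using w r by auto
        then have "(K \<eta> has_field_derivative deriv (K \<eta>) w) (at w)" using elim(1) S holomorphic_derivI by blast
        then show ?thesis by (rule has_field_derivative_at_within)
      qed
      have bd: "cmod (deriv (K \<eta>) w) \<le> 2 / r * \<beta> \<eta>" if w: "w \<in> ball z (r / 2)" for w
      proof -
        have sub: "cball w (r / 2) \<subseteq> cball z r"
        proof
          fix x assume "x \<in> cball w (r / 2)"
          then show "x \<in> cball z r" using w dist_triangle[of z x w] by simp
        qed
        then have h: "K \<eta> holomorphic_on cball w (r / 2)" using elim(1) r(2) holomorphic_on_subset by blast
        have "cmod ((deriv ^^ 1) (K \<eta>) w) \<le> fact 1 * \<beta> \<eta> / (r / 2) ^ 1"
        proof (rule Cauchy_inequality)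
          show "K \<eta> holomorphic_on ball w (r / 2)" using h ball_subset_cball holomorphic_on_subset by blast
          show "continuous_on (cball w (r / 2)) (K \<eta>)" using h holomorphic_on_imp_continuous_on by blast
          fix x assume "cmod (w - x) = r / 2"
          then have "x \<in> cball z r" using sub by (auto simp: dist_norm)
          then show "cmod (K \<eta> x) \<le> \<beta> \<eta>" using elim(2) by blast
        qed (use r in auto)
        then show ?thesis by (simp add: field_simps)
      qed
      show ?case
      proof (intro ballI impI)
        fix y assume y: "y \<in> ball z (r / 2)" "y \<noteq> z"
        have "cmod (K \<eta> y - K \<eta> z) \<le> 2 / r * \<beta> \<eta> * cmod (y - z)"
          by (rule field_differentiable_bound[OF convex_ball der bd]) (use y r in auto)
        then show "cmod (q y \<eta>) \<le> 2 / r * \<beta> \<eta>" using y(2) by (simp add: q_def norm_divide divide_le_eq)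
      qed
    qed
    have quot: "((LINT \<eta>|N. K \<eta> y) - (LINT \<eta>|N. K \<eta> z)) / (y - z) = (LINT \<eta>|N. q y \<eta>)" if "y \<in> cball z r" for y
      unfolding q_def using int[OF that] int[of z] r by simp
    have der: "AE \<eta> in N. (\<lambda>i. q (Y i) \<eta>) \<longlonglongrightarrow> deriv (K \<eta>) z"
      if Y: "\<And>i::nat. Y i \<noteq> z" "Y \<longlonglongrightarrow> z" for Y
      using hol
    proof eventually_elim
      case (elim \<eta>)
      have "(K \<eta> has_field_derivative deriv (K \<eta>) z) (at z)" using elim S z holomorphic_derivI by blast
      then have "((\<lambda>y. q y \<eta>) \<longlongrightarrow> deriv (K \<eta>) z) (at z)" by (simp add: has_field_derivative_iff q_def)
      moreover have "filterlim Y (at z) sequentially" using Y by (simp add: filterlim_at)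
      ultimately show ?case by (rule filterlim_compose)
    qed
    have qm: "q y \<in> borel_measurable N" if "y \<in> cball z r" for y
      unfolding q_def using meas that r z by (intro borel_measurable_divide borel_measurable_diff) auto
    \<comment> \<open>the derivative agrees almost everywhere with a measurable function, a limit of difference quotients; without measurability its integral would be meaningless\<close>
    obtain D where D: "D \<in> borel_measurable N" "AE \<eta> in N. D \<eta> = deriv (K \<eta>) z"
    proof
      define Y where "Y = (\<lambda>i. z + of_real (r / real (Suc i)))"
      have "(\<lambda>i. r * (1 / real (Suc i))) \<longlonglongrightarrow> r * 0" by (intro tendsto_intros LIMSEQ_Suc[OF lim_1_over_n])
      then have "(\<lambda>i. r / real (Suc i)) \<longlonglongrightarrow> 0" by simp
      then have "Y \<longlonglongrightarrow> z + of_real 0" unfolding Y_def by (intro tendsto_add tendsto_const tendsto_of_real)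
      then have Ylim: "Y \<longlonglongrightarrow> z" by simp
      have Yne: "Y i \<noteq> z" for i using r(1) by (simp add: Y_def of_real_eq_0_iff del: of_real_divide of_nat_Suc)
      have Yb: "Y i \<in> cball z r" for i
      proof -
        have "dist z (Y i) = r / real (Suc i)" using r(1) by (simp add: Y_def dist_norm del: of_real_divide of_nat_Suc)
        also have "\<dots> \<le> r / 1" using r(1) by (intro divide_left_mono) auto
        finally show ?thesis by simp
      qed
      show "(\<lambda>\<eta>. lim (\<lambda>i. q (Y i) \<eta>)) \<in> borel_measurable N"
        by (rule borel_measurable_lim_metric) (rule qm[OF Yb])
      show "AE \<eta> in N. lim (\<lambda>i. q (Y i) \<eta>) = deriv (K \<eta>) z"
        using der[OF Yne Ylim] by eventually_elim (rule limI)
    qed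
    have seq: "(\<lambda>i. ((LINT \<eta>|N. K \<eta> (X i)) - (LINT \<eta>|N. K \<eta> z)) / (X i - z)) \<longlonglongrightarrow> (LINT \<eta>|N. D \<eta>)"
      if X: "\<And>i. X i \<noteq> z" "X \<longlonglongrightarrow> z" for X
    proof -
      have "eventually (\<lambda>i. X i \<in> ball z (r / 2)) sequentially"
        using X(2) r by (intro topological_tendstoD) auto
      then obtain i0 where i0: "\<And>i. i \<ge> i0 \<Longrightarrow> X i \<in> ball z (r / 2)" unfolding eventually_sequentially by blast
      define Y where "Y = (\<lambda>i. X (i + i0))"
      have Y: "Y i \<in> ball z (r / 2)" "Y i \<noteq> z" "Y i \<in> cball z r" for i
        using i0[of "i + i0"] X(1) r by (auto simp: Y_def)
      have Ylim: "Y \<longlonglongrightarrow> z" unfolding Y_def by (rule LIMSEQ_ignore_initial_segment[OF X(2)])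
      have Dlim: "AE \<eta> in N. (\<lambda>i. q (Y i) \<eta>) \<longlonglongrightarrow> D \<eta>"
        using der[OF Y(2) Ylim] D(2) by eventually_elim simp
      have "(\<lambda>i. LINT \<eta>|N. q (Y i) \<eta>) \<longlonglongrightarrow> (LINT \<eta>|N. D \<eta>)"
      proof (rule integral_dominated_convergence[OF D(1) qm[OF Y(3)] _ Dlim])
        show "integrable N (\<lambda>\<eta>. 2 / r * \<beta> \<eta>)" using \<beta>(1) by simp
        show "AE \<eta> in N. norm (q (Y i) \<eta>) \<le> 2 / r * \<beta> \<eta>" for i
          using lipschitz by eventually_elim (use Y in blast)
      qed
      then have "(\<lambda>i. ((LINT \<eta>|N. K \<eta> (Y i)) - (LINT \<eta>|N. K \<eta> z)) / (Y i - z)) \<longlonglongrightarrow> (LINT \<eta>|N. D \<eta>)"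
        using quot[OF Y(3)] by simp
      then show ?thesis unfolding Y_def by (rule LIMSEQ_offset)
    qed
    have "((\<lambda>y. ((LINT \<eta>|N. K \<eta> y) - (LINT \<eta>|N. K \<eta> z)) / (y - z)) \<longlongrightarrow> (LINT \<eta>|N. D \<eta>)) (at z)"
      unfolding tendsto_at_iff_sequentially o_def using seq by simp
    then have "((\<lambda>z. LINT \<eta>|N. K \<eta> z) has_field_derivative (LINT \<eta>|N. D \<eta>)) (at z)"
      by (simp add: has_field_derivative_iff)
    then show ?thesis using field_differentiable_def by blast
  qed
  then show ?thesis by (simp add: holomorphic_on_def field_differentiable_at_within)
qed

context cell_setting
begin

lemma cell_value_bloch:
  assumes H: "bloch \<eta> H" "\<forall>z\<in>\<omega>. H z = u z" and w: "w \<in> \<Omega>" "w \<in> closure \<omega>"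
  shows "cell_value \<omega> u w = H w"
proof (cases "w \<in> \<omega>")
  case True
  then show ?thesis using H(2) by (simp add: cell_value_def)
next
  case False
  have "isCont H w"
    using H(1) w(1) open_domain unfolding bloch_def
    by (metis continuous_on_eq_continuous_at holomorphic_on_imp_continuous_on)
  then have "(H \<longlongrightarrow> H w) (at w within \<omega>)"
    unfolding isCont_def by (rule tendsto_within_subset) simp
  moreover have "eventually (\<lambda>z. H z = u z) (at w within \<omega>)"
    using H(2) by (auto simp: eventually_at_filter)
  ultimately have "(u \<longlongrightarrow> H w) (at w within \<omega>)" by (rule Lim_transform_eventually)
  moreover have "at w within \<omega> \<noteq> bot"
    using False w(2) by (simp add: at_within_eq_bot_iff)
  ultimately have "Lim (at w within \<omega>) u = H w" by (intro tendsto_Lim)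
  then show ?thesis using False by (simp add: cell_value_def)
qed

lemma bloch_extension:
  assumes g: "g \<in> Bochner_A2_eta \<omega>"
  obtains H where "AE \<eta> in QQ. bloch \<eta> (H \<eta>) \<and> (\<forall>z\<in>\<omega>. H \<eta> z = g (z, \<eta>))"
proof
  let ?P = "\<lambda>\<eta> H. bloch \<eta> H \<and> (\<forall>z\<in>\<omega>. H z = g (z, \<eta>))"
  show "AE \<eta> in QQ. ?P \<eta> (SOME H. ?P \<eta> H)"
    using Bochner_A2_etaD(2)[OF g]
  proof eventually_elim
    case (elim \<eta>)
    then have "\<exists>H. ?P \<eta> H" unfolding A2_eta_iff by blast
    then show ?case by (rule someI_ex)
  qed
qed

text \<open>
  On the sides of the unit square \<open>g\<close> itself says nothing; there the Bloch function is a limit of its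
  values in the cell.
\<close>

lemma bloch_extension_measurable:
  assumes g': "joint_version g g'" and H: "AE \<eta> in QQ. bloch \<eta> (H \<eta>) \<and> (\<forall>z\<in>\<omega>. H \<eta> z = g (z, \<eta>))"
    and z: "z \<in> \<Omega>"
  shows "(\<lambda>\<eta>. H \<eta> z) \<in> borel_measurable QQ"
proof -
  have [measurable]: "g' \<in> borel_measurable (MM \<Otimes>\<^sub>M QQ)" and ae: "AE \<eta> in QQ. \<forall>z\<in>\<omega>. g (z, \<eta>) = g' (z, \<eta>)"
    using g' by (auto simp: joint_version_def)
  define n where "n = cell_index z"
  have n: "n \<in> gauss_lattice" by (simp add: n_def cell_index_in_lattice)
  have w: "z - n \<in> \<Omega>" "z - n \<in> closure \<omega>" using diff_cell_index_mem[OF z] by (auto simp: n_def)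
  obtain x where x: "\<forall>k. x k \<in> \<omega>" "x \<longlonglongrightarrow> z - n" using w(2) unfolding closure_sequential by blast
  have m: "(\<lambda>\<eta>. phase \<eta> n * g' (x k, \<eta>)) \<in> borel_measurable QQ" for k
  proof -
    have "x k \<in> space MM" using x by simp
    then have [measurable]: "(\<lambda>\<eta>. g' (x k, \<eta>)) \<in> borel_measurable QQ" by measurable
    show ?thesis by measurable
  qed
  have "AE \<eta> in QQ. lim (\<lambda>k. phase \<eta> n * g' (x k, \<eta>)) = H \<eta> z"
    using ae H
  proof eventually_elim
    case (elim \<eta>)
    have "continuous_on \<Omega> (H \<eta>)" using elim by (auto simp: bloch_def holomorphic_on_imp_continuous_on)
    then have "(\<lambda>k. H \<eta> (x k)) \<longlonglongrightarrow> H \<eta> (z - n)"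
      using x w(1) cell_subset_domain open_domain
      by (intro isCont_tendsto_compose[of "z - n" "H \<eta>"]) (auto simp: continuous_on_eq_continuous_at)
    then have "(\<lambda>k. phase \<eta> n * H \<eta> (x k)) \<longlonglongrightarrow> phase \<eta> n * H \<eta> (z - n)" by (intro tendsto_intros)
    moreover have "H \<eta> (x k) = g' (x k, \<eta>)" for k using elim x(1) by simp
    moreover have "phase \<eta> n * H \<eta> (z - n) = H \<eta> z"
    proof -
      have "H \<eta> ((z - n) + n) = phase \<eta> n * H \<eta> (z - n)" using elim w(1) n unfolding bloch_def by blast
      then show ?thesis by simp
    qed
    ultimately show ?case by (simp add: limI)
  qed
  then show ?thesis by (intro QQ_measurable_AE[OF borel_measurable_lim_metric[OF m]])
qed

lemma floquet_inverse_eq: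
  assumes g': "joint_version g g'" and H: "AE \<eta> in QQ. bloch \<eta> (H \<eta>) \<and> (\<forall>z\<in>\<omega>. H \<eta> z = g (z, \<eta>))"
    and z: "z \<in> \<Omega>"
  shows "floquet_inverse \<omega> g z = 1 / (2 * of_real pi) * (LINT \<eta>|QQ. H \<eta> z)"
proof -
  define n where "n = cell_index z"
  have n: "n \<in> gauss_lattice" by (simp add: n_def cell_index_in_lattice)
  have w: "z - n \<in> \<Omega>" "z - n \<in> closure \<omega>" using diff_cell_index_mem[OF z] by (auto simp: n_def)
  let ?I = "\<lambda>\<eta>. exp (\<i> * of_int \<lfloor>Re z\<rfloor> * of_real (fst \<eta>) + \<i> * of_int \<lfloor>Im z\<rfloor> * of_real (snd \<eta>)) *
        cell_value \<omega> (\<lambda>w. g (w, \<eta>)) (z - of_int \<lfloor>Re z\<rfloor> - \<i> * of_int \<lfloor>Im z\<rfloor>)"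
  have ae: "AE \<eta> in QQ. H \<eta> z = ?I \<eta>"
    using H
  proof eventually_elim
    case (elim \<eta>)
    have "H \<eta> ((z - n) + n) = phase \<eta> n * H \<eta> (z - n)" using elim w(1) n unfolding bloch_def by blast
    moreover have "cell_value \<omega> (\<lambda>w. g (w, \<eta>)) (z - n) = H \<eta> (z - n)"
      using elim by (intro cell_value_bloch[OF _ _ w]) auto
    moreover have "exp (\<i> * of_int \<lfloor>Re z\<rfloor> * of_real (fst \<eta>) + \<i> * of_int \<lfloor>Im z\<rfloor> * of_real (snd \<eta>)) = phase \<eta> n"
      unfolding phase_def n_def by (rule arg_cong[of _ _ exp]) (simp add: algebra_simps)
    moreover have "z - of_int \<lfloor>Re z\<rfloor> - \<i> * of_int \<lfloor>Im z\<rfloor> = z - n"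
      by (simp add: n_def cell_index_def)
    ultimately show ?case by (simp only: diff_add_cancel)
  qed
  note Hm = bloch_extension_measurable[OF g' H z]
  have "(LINT \<eta>|QQ. ?I \<eta>) = (LINT \<eta>|QQ. H \<eta> z)"
    by (rule integral_cong_AE[OF QQ_measurable_AE[OF Hm ae] Hm]) (use ae in \<open>eventually_elim, simp\<close>)
  then show ?thesis unfolding floquet_inverse_def by simp
qed

text \<open>
  Near each point Bergman's inequality bounds the Bloch function of \<open>g (\<cdot>, \<eta>)\<close> by the norm of
  \<open>g (\<cdot>, \<eta>)\<close>, whose square is integrable over \<open>\<eta>\<close>.
\<close>

lemma bloch_integral_holomorphic:
  assumes g': "joint_version g g'" "pair_sq g < \<infinity>" and H: "AE \<eta> in QQ. bloch \<eta> (H \<eta>) \<and> (\<forall>z\<in>\<omega>. H \<eta> z = g (z, \<eta>))"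
  shows "(\<lambda>z. LINT \<eta>|QQ. H \<eta> z) holomorphic_on \<Omega>"
proof (rule holomorphic_on_integral[OF open_domain])
  show "AE \<eta> in QQ. H \<eta> holomorphic_on \<Omega>" using H by eventually_elim (simp add: bloch_def)
  show "(\<lambda>\<eta>. H \<eta> z) \<in> borel_measurable QQ" if "z \<in> \<Omega>" for z by (rule bloch_extension_measurable[OF g'(1) H that])
  fix z assume z: "z \<in> \<Omega>"
  obtain r C where r: "r > 0" "C \<ge> 0" "cball z r \<subseteq> \<Omega>"
    and bd: "\<forall>\<eta> H. bloch \<eta> H \<longrightarrow> (\<forall>w\<in>cball z r. ennreal ((cmod (H w))\<^sup>2) \<le> ennreal C * l2sq MM H)"
    by (rule bloch_local_bound[OF z])
  let ?N = "\<lambda>\<eta>. (L2_norm \<omega> (\<lambda>z. g (z, \<eta>)))\<^sup>2"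
  note N = joint_version_norm_sq[OF g']
  have "integrable QQ (\<lambda>\<eta>. 1 + C * ?N \<eta>)"
    using N(1) finite_measure.integrable_const[OF finite_measure_QQ, of "1::real"] by simp
  moreover have "AE \<eta> in QQ. \<forall>w\<in>cball z r. cmod (H \<eta> w) \<le> 1 + C * ?N \<eta>"
    using H N(3)
  proof eventually_elim
    case (elim \<eta>)
    show ?case
    proof
      fix w assume w: "w \<in> cball z r"
      have "ennreal ((cmod (H \<eta> w))\<^sup>2) \<le> ennreal C * l2sq MM (H \<eta>)" using bd elim w by blast
      also have "l2sq MM (H \<eta>) = l2sq MM (\<lambda>z. g (z, \<eta>))" using elim by (intro l2sq_MM_cong) simp
      also have "\<dots> = ennreal (?N \<eta>)" using elim by (intro L2_norm_sq[symmetric]) simp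
      finally have "ennreal ((cmod (H \<eta> w))\<^sup>2) \<le> ennreal (C * ?N \<eta>)" using r by (simp add: ennreal_mult'')
      then have "(cmod (H \<eta> w))\<^sup>2 \<le> C * ?N \<eta>" using r by (subst (asm) ennreal_le_iff) auto
      moreover have "cmod (H \<eta> w) \<le> 1 + (cmod (H \<eta> w))\<^sup>2"
      proof -
        have "0 \<le> (cmod (H \<eta> w) - 1)\<^sup>2" by simp
        then have "2 * cmod (H \<eta> w) \<le> 1 + (cmod (H \<eta> w))\<^sup>2" by (simp add: power2_diff)
        then show ?thesis using norm_ge_zero[of "H \<eta> w"] by linarith
      qed
      ultimately show "cmod (H \<eta> w) \<le> 1 + C * ?N \<eta>" by linarith
    qed
  qed
  ultimately show "\<exists>r>0. \<exists>\<beta>. cball z r \<subseteq> \<Omega> \<and> integrable QQ \<beta> \<and> (AE \<eta> in QQ. \<forall>w\<in>cball z r. cmod (H \<eta> w) \<le> \<beta> \<eta>)"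
    using r by (intro exI[of _ r] conjI exI[of _ "\<lambda>\<eta>. 1 + C * ?N \<eta>"])
qed

text \<open>
  Translating the argument of a Bloch function multiplies it by a character, so integration over
  \<open>\<eta>\<close> at \<open>z + m\<close> extracts a Fourier coefficient at \<open>z\<close>.
\<close>

lemma floquet_inverse_coefficients:
  assumes g': "joint_version g g'" and H: "AE \<eta> in QQ. bloch \<eta> (H \<eta>) \<and> (\<forall>z\<in>\<omega>. H \<eta> z = g (z, \<eta>))"
    and z: "z \<in> \<omega>" and m: "m \<in> gauss_lattice"
  shows "floquet_inverse \<omega> g (z + m) = (LINT \<eta>|QQ. g' (z, \<eta>) * cnj (mode m \<eta>))"
proof -
  have [measurable]: "g' \<in> borel_measurable (MM \<Otimes>\<^sub>M QQ)" and ae: "AE \<eta> in QQ. \<forall>z\<in>\<omega>. g (z, \<eta>) = g' (z, \<eta>)"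
    using g' by (auto simp: joint_version_def)
  have "z \<in> space MM" using z by simp
  then have [measurable]: "(\<lambda>\<eta>. g' (z, \<eta>)) \<in> borel_measurable QQ" by measurable
  have zm: "z + m \<in> \<Omega>" by (rule cell_add_mem[OF z m])
  have "(LINT \<eta>|QQ. H \<eta> (z + m)) = (LINT \<eta>|QQ. 2 * of_real pi * (g' (z, \<eta>) * cnj (mode m \<eta>)))"
  proof (rule integral_cong_AE)
    show "(\<lambda>\<eta>. H \<eta> (z + m)) \<in> borel_measurable QQ" by (rule bloch_extension_measurable[OF g' H zm])
    show "AE \<eta> in QQ. H \<eta> (z + m) = 2 * of_real pi * (g' (z, \<eta>) * cnj (mode m \<eta>))"
      using ae H
    proof eventually_elim
      case (elim \<eta>)
      then have "H \<eta> (z + m) = phase \<eta> m * g' (z, \<eta>)"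
        using z m cell_subset_domain by (auto simp: bloch_def)
      then show ?case by (simp add: mode_def cnj_phase)
    qed
  qed measurable
  then show ?thesis using floquet_inverse_eq[OF g' H zm] by simp
qed

text \<open>
  Bessel's inequality for \<open>g (z, \<cdot>)\<close>, integrated over \<open>z\<close>.
\<close>

lemma floquet_inverse_A2:
  assumes g: "g \<in> Bochner_A2_eta \<omega>"
  shows "floquet_inverse \<omega> g \<in> A2 \<Omega>"
proof -
  let ?f = "floquet_inverse \<omega> g"
  obtain g' where g': "joint_version g g'" "pair_sq g < \<infinity>" using Bochner_A2_version[OF Bochner_A2_etaD(1)[OF g]] .
  obtain H where H: "AE \<eta> in QQ. bloch \<eta> (H \<eta>) \<and> (\<forall>z\<in>\<omega>. H \<eta> z = g (z, \<eta>))" by (rule bloch_extension[OF g])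
  have gm[measurable]: "g' \<in> borel_measurable (MM \<Otimes>\<^sub>M QQ)" using g' by (auto simp: joint_version_def)
  have "(\<lambda>z. 1 / (2 * of_real pi) * (LINT \<eta>|QQ. H \<eta> z)) holomorphic_on \<Omega>"
    by (intro holomorphic_intros bloch_integral_holomorphic[OF g' H])
  then have hol: "?f holomorphic_on \<Omega>"
    by (rule holomorphic_transform) (rule floquet_inverse_eq[OF g'(1) H, symmetric])
  then have cont: "continuous_on \<Omega> ?f" by (rule holomorphic_on_imp_continuous_on)
  have le: "(\<Sum>m\<in>F. coef_sq ?f m) \<le> pair_sq g" if F: "finite F" "F \<subseteq> gauss_lattice" for F
  proof -
    have meas: "(\<lambda>z. ?f (z + m)) \<in> borel_measurable MM" if "m \<in> F" for m
      using that F by (intro cell_measurable_translate hol) auto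
    have "(\<Sum>m\<in>F. coef_sq ?f m) = (\<integral>\<^sup>+z. (\<Sum>m\<in>F. ennreal ((cmod (?f (z + m)))\<^sup>2)) \<partial>MM)"
      unfolding coef_sq_def l2sq_def using meas by (intro nn_integral_sum[symmetric]) simp
    also have "\<dots> \<le> (\<integral>\<^sup>+z. l2sq QQ (\<lambda>\<eta>. g' (z, \<eta>)) \<partial>MM)"
    proof (rule nn_integral_mono)
      fix z assume zs: "z \<in> space MM"
      then have z: "z \<in> \<omega>" by simp
      have sm: "(\<lambda>\<eta>. g' (z, \<eta>)) \<in> borel_measurable QQ" using zs by measurable
      show "(\<Sum>m\<in>F. ennreal ((cmod (?f (z + m)))\<^sup>2)) \<le> l2sq QQ (\<lambda>\<eta>. g' (z, \<eta>))"
      proof (cases "l2sq QQ (\<lambda>\<eta>. g' (z, \<eta>)) < \<infinity>")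
        case True
        have "ennreal (\<Sum>m\<in>F. (cmod (?f (z + m)))\<^sup>2) \<le> l2sq QQ (\<lambda>\<eta>. g' (z, \<eta>))"
          by (rule bessel_QQ[OF sm True F]) (use floquet_inverse_coefficients[OF g'(1) H z] F in blast)
        then show ?thesis by (simp add: sum_ennreal)
      qed (simp add: not_less top_unique)
    qed
    also have "\<dots> = pair_sq g" by (rule pair_sq_version_swap[OF g'(1), symmetric])
    finally show ?thesis .
  qed
  have "l2sq (lebesgue_on \<Omega>) ?f \<le> pair_sq g"
    by (rule LIMSEQ_le_const2[OF coef_sq_sums[OF cont]]) (use le lattice_enum_in in blast)
  then have "l2sq (lebesgue_on \<Omega>) ?f < \<infinity>" using g'(2) by (rule le_less_trans)
  then show ?thesis using hol holomorphic_measurable_lebesgue_on[OF hol open_domain] by (simp add: A2_def L2_iff)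
qed

lemma AE_slice_finite:
  assumes "joint_version g g'" "pair_sq g < \<infinity>"
  shows "AE z in MM. l2sq QQ (\<lambda>\<eta>. g' (z, \<eta>)) < \<infinity>"
proof -
  have [measurable]: "g' \<in> borel_measurable (MM \<Otimes>\<^sub>M QQ)" using assms by (auto simp: joint_version_def)
  have "(\<lambda>z. l2sq QQ (\<lambda>\<eta>. g' (z, \<eta>))) \<in> borel_measurable MM" unfolding l2sq_def by measurable
  then have "AE z in MM. l2sq QQ (\<lambda>\<eta>. g' (z, \<eta>)) \<noteq> \<infinity>"
    using assms(2) unfolding pair_sq_version_swap[OF assms(1)] by (intro nn_integral_PInf_AE) auto
  then show ?thesis by eventually_elim (simp add: less_top)
qed

text \<open>
  The \<open>m\<close>-th Fourier coefficient depends continuously on the function, and for a partial sum whose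
  index set contains \<open>m\<close> it is \<open>f (z + m)\<close>.
\<close>

lemma transform_coefficients:
  assumes f: "f \<in> A2 \<Omega>" and g': "joint_version g g'" "pair_sq g < \<infinity>"
    and lim: "((\<lambda>A. pair_sq (\<lambda>p. floquet_partial_sum A f p - g p)) \<longlongrightarrow> 0) (finite_subsets_at_top gauss_lattice)"
    and m: "m \<in> gauss_lattice"
  shows "AE z in MM. f (z + m) = (LINT \<eta>|QQ. g' (z, \<eta>) * cnj (mode m \<eta>))"
proof -
  note fD = A2_D[OF f]
  have gm[measurable]: "g' \<in> borel_measurable (MM \<Otimes>\<^sub>M QQ)" using g' by (auto simp: joint_version_def)
  define c where "c = (\<lambda>z. LINT \<eta>|QQ. g' (z, \<eta>) * cnj (mode m \<eta>))"
  have [measurable]: "c \<in> borel_measurable MM"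
    unfolding c_def by (rule MQ.M2.borel_measurable_lebesgue_integral) measurable
  have [measurable]: "(\<lambda>z. f (z + m)) \<in> borel_measurable MM" by (rule cell_measurable_translate[OF fD(1) m])
  have ip: "integrable QQ (\<lambda>\<eta>. h \<eta> * cnj (mode k \<eta>))" if "integrable QQ h" for h k
    by (rule Bochner_Integration.integrable_bound[OF integrable_mult_right[OF that, of "1 / (2 * pi)"]])
      (use that in \<open>auto simp: norm_mult cmod_mode norm_divide\<close>)
  have le: "l2sq MM (\<lambda>z. f (z + m) - c z) \<le> pair_sq (\<lambda>p. floquet_partial_sum A f p - g p)"
    if A: "finite A" "A \<subseteq> gauss_lattice" "m \<in> A" for A
  proof -
    let ?S = "floquet_partial_sum A f"
    have Sm[measurable]: "?S \<in> borel_measurable (MM \<Otimes>\<^sub>M QQ)" by (intro partial_sum_measurable fD A)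
    have "l2sq MM (\<lambda>z. f (z + m) - c z) \<le> (\<integral>\<^sup>+z. l2sq QQ (\<lambda>\<eta>. ?S (z, \<eta>) - g' (z, \<eta>)) \<partial>MM)"
      unfolding l2sq_def[of MM]
    proof (rule nn_integral_mono_AE)
      have "AE z in MM. z \<in> space MM" by (rule AE_space)
      with AE_slice_finite[OF g'] show "AE z in MM. ennreal ((cmod (f (z + m) - c z))\<^sup>2) \<le> l2sq QQ (\<lambda>\<eta>. ?S (z, \<eta>) - g' (z, \<eta>))"
      proof eventually_elim
        case (elim z)
        have zm: "(\<lambda>\<eta>. g' (z, \<eta>)) \<in> borel_measurable QQ" using elim by measurable
        have Szm: "(\<lambda>\<eta>. ?S (z, \<eta>)) \<in> borel_measurable QQ" using elim by measurable
        have Sl: "l2sq QQ (\<lambda>\<eta>. ?S (z, \<eta>)) < \<infinity>"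
          using l2sq_trig[OF A(1,2), of "\<lambda>m. f (z + m)"] by (simp add: floquet_partial_sum_eq mult.commute)
        have fin: "l2sq QQ (\<lambda>\<eta>. ?S (z, \<eta>) - g' (z, \<eta>)) < \<infinity>"
          using l2sq_diff_le[OF Szm zm] elim Sl by (auto simp: ennreal_mult_less_top elim!: le_less_trans)
        have iS: "integrable QQ (\<lambda>\<eta>. ?S (z, \<eta>))" by (rule integrable_of_l2sq_QQ[OF Szm Sl])
        have ig: "integrable QQ (\<lambda>\<eta>. g' (z, \<eta>))" by (rule integrable_of_l2sq_QQ[OF zm]) (use elim in simp)
        have im: "integrable QQ (mode k)" for k
          unfolding mode_def[abs_def] by (intro integrable_divide integrable_phase)
        have "(LINT \<eta>|QQ. ?S (z, \<eta>) * cnj (mode m \<eta>)) = (LINT \<eta>|QQ. (\<Sum>k\<in>A. f (z + k) * (mode k \<eta> * cnj (mode m \<eta>))))"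
          by (simp add: floquet_partial_sum_eq sum_distrib_left sum_distrib_right mult_ac)
        also have "\<dots> = (\<Sum>k\<in>A. f (z + k) * (LINT \<eta>|QQ. mode k \<eta> * cnj (mode m \<eta>)))"
          using ip[OF im] by simp
        also have "\<dots> = (\<Sum>k\<in>A. if k = m then f (z + k) else 0)"
          using A m by (intro sum.cong refl) (auto simp: mode_orthonormal subset_eq)
        also have "\<dots> = f (z + m)" using A by simp
        finally have "(LINT \<eta>|QQ. (?S (z, \<eta>) - g' (z, \<eta>)) * cnj (mode m \<eta>)) = f (z + m) - c z"
          using ip[OF iS, of m] ip[OF ig, of m] by (simp add: left_diff_distrib c_def)
        then have "f (z + m) - c z = (LINT \<eta>|QQ. (?S (z, \<eta>) - g' (z, \<eta>)) * cnj (mode m \<eta>))" ..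
        then have "ennreal (\<Sum>k\<in>{m}. (cmod (f (z + m) - c z))\<^sup>2) \<le> l2sq QQ (\<lambda>\<eta>. ?S (z, \<eta>) - g' (z, \<eta>))"
          using m by (intro bessel_QQ[OF borel_measurable_diff[OF Szm zm] fin]) auto
        then show ?case by simp
      qed
    qed
    also have "\<dots> = pair_sq (\<lambda>p. ?S p - g p)"
      by (rule pair_sq_version_swap[OF joint_version_diff[OF joint_version_self[OF Sm] g'(1)], symmetric])
    finally show ?thesis .
  qed
  have "eventually (\<lambda>A. l2sq MM (\<lambda>z. f (z + m) - c z) \<le> pair_sq (\<lambda>p. floquet_partial_sum A f p - g p)) (finite_subsets_at_top gauss_lattice)"
    unfolding eventually_finite_subsets_at_top using m le by (intro exI[of _ "{m}"]) auto
  then have "l2sq MM (\<lambda>z. f (z + m) - c z) \<le> 0"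
    by (rule tendsto_lowerbound[OF lim]) simp
  then have "AE z in MM. ennreal ((cmod (f (z + m) - c z))\<^sup>2) = 0"
    unfolding l2sq_def by (subst (asm) le_zero_eq, subst (asm) nn_integral_0_iff_AE) auto
  then show ?thesis by eventually_elim (simp add: c_def)
qed

text \<open>
  The inverse transform of \<open>g\<close> has some transform \<open>h\<close>, and \<open>h\<close> and \<open>g\<close> have the same Fourier
  coefficients for almost every \<open>z\<close>.
\<close>

lemma floquet_inverse_transform:
  assumes g: "g \<in> Bochner_A2_eta \<omega>"
  shows "has_floquet_transform \<omega> (floquet_inverse \<omega> g) g"
proof -
  let ?f = "floquet_inverse \<omega> g"
  have f: "?f \<in> A2 \<Omega>" by (rule floquet_inverse_A2[OF g])
  obtain h where h: "h \<in> Bochner_A2_eta \<omega>"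
    and lim: "((\<lambda>A. pair_sq (\<lambda>p. floquet_partial_sum A ?f p - h p)) \<longlongrightarrow> 0) (finite_subsets_at_top gauss_lattice)"
    by (rule floquet_exists[OF f])
  obtain g' where g': "joint_version g g'" "pair_sq g < \<infinity>" using Bochner_A2_version[OF Bochner_A2_etaD(1)[OF g]] .
  obtain h' where h': "joint_version h h'" "pair_sq h < \<infinity>" using Bochner_A2_version[OF Bochner_A2_etaD(1)[OF h]] .
  obtain H where H: "AE \<eta> in QQ. bloch \<eta> (H \<eta>) \<and> (\<forall>z\<in>\<omega>. H \<eta> z = g (z, \<eta>))" by (rule bloch_extension[OF g])
  have [measurable]: "g' \<in> borel_measurable (MM \<Otimes>\<^sub>M QQ)" "h' \<in> borel_measurable (MM \<Otimes>\<^sub>M QQ)"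
    using g' h' by (auto simp: joint_version_def)
  have coef: "AE z in MM. \<forall>m\<in>gauss_lattice. ?f (z + m) = (LINT \<eta>|QQ. h' (z, \<eta>) * cnj (mode m \<eta>))"
    by (subst AE_ball_countable[OF countable_lattice]) (intro ballI transform_coefficients[OF f h' lim])
  have "AE z in MM. z \<in> space MM" by (rule AE_space)
  with coef AE_slice_finite[OF g'] AE_slice_finite[OF h'] have "AE z in MM. l2sq QQ (\<lambda>\<eta>. h' (z, \<eta>) - g' (z, \<eta>)) = 0"
  proof eventually_elim
    case (elim z)
    then have z: "z \<in> \<omega>" by simp
    have m1: "(\<lambda>\<eta>. g' (z, \<eta>)) \<in> borel_measurable QQ" using elim(4) by measurable
    have m2: "(\<lambda>\<eta>. h' (z, \<eta>)) \<in> borel_measurable QQ" using elim(4) by measurable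
    have i1: "integrable QQ (\<lambda>\<eta>. g' (z, \<eta>))" by (rule integrable_of_l2sq_QQ[OF m1 elim(2)])
    have i2: "integrable QQ (\<lambda>\<eta>. h' (z, \<eta>))" by (rule integrable_of_l2sq_QQ[OF m2 elim(3)])
    have "AE \<eta> in QQ. h' (z, \<eta>) - g' (z, \<eta>) = 0"
    proof (rule fourier_uniqueness)
      show "integrable QQ (\<lambda>\<eta>. h' (z, \<eta>) - g' (z, \<eta>))" using i1 i2 by simp
      fix m assume m: "m \<in> gauss_lattice"
      have conv: "(LINT \<eta>|QQ. phase \<eta> m * u \<eta>) = 2 * of_real pi * (LINT \<eta>|QQ. u \<eta> * cnj (mode m \<eta>))" for u
        by (subst integral_mult_right_zero[symmetric]) (simp add: mode_def cnj_phase mult.commute)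
      have "(LINT \<eta>|QQ. phase \<eta> m * g' (z, \<eta>)) = (LINT \<eta>|QQ. phase \<eta> m * h' (z, \<eta>))"
        unfolding conv using elim(1) m floquet_inverse_coefficients[OF g'(1) H z m] by simp
      then show "(LINT \<eta>|QQ. phase \<eta> m * (h' (z, \<eta>) - g' (z, \<eta>))) = 0"
        using integrable_phase_mult[OF i1] integrable_phase_mult[OF i2] by (simp add: right_diff_distrib)
    qed
    then have "l2sq QQ (\<lambda>\<eta>. h' (z, \<eta>) - g' (z, \<eta>)) = l2sq QQ (\<lambda>_. 0)" by (rule l2sq_cong_AE)
    then show ?case by (simp add: l2sq_def)
  qed
  then have "(\<integral>\<^sup>+z. l2sq QQ (\<lambda>\<eta>. h' (z, \<eta>) - g' (z, \<eta>)) \<partial>MM) = (\<integral>\<^sup>+z. 0 \<partial>MM)" by (rule nn_integral_cong_AE)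
  then have hg: "pair_sq (\<lambda>p. h p - g p) = 0" using pair_sq_version_swap[OF joint_version_diff[OF h'(1) g'(1)]] by simp
  show ?thesis
    unfolding has_floquet_iff[OF f g]
  proof (rule tendsto_sandwich[OF always_eventually _ tendsto_const])
    let ?F = "finite_subsets_at_top gauss_lattice"
    have "((\<lambda>A. 2 * pair_sq (\<lambda>p. floquet_partial_sum A ?f p - h p)) \<longlongrightarrow> 2 * 0) ?F"
      by (intro ennreal_tendsto_cmult lim) auto
    then show "((\<lambda>A. 2 * pair_sq (\<lambda>p. floquet_partial_sum A ?f p - h p)) \<longlongrightarrow> 0) ?F" by simp
    show "eventually (\<lambda>A. pair_sq (\<lambda>p. floquet_partial_sum A ?f p - g p) \<le> 2 * pair_sq (\<lambda>p. floquet_partial_sum A ?f p - h p)) ?F"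
      unfolding eventually_finite_subsets_at_top
    proof (intro exI[of _ "{}"] conjI allI impI)
      fix A assume A: "finite A \<and> {} \<subseteq> A \<and> A \<subseteq> gauss_lattice"
      have r: "joint_version (floquet_partial_sum A ?f) (floquet_partial_sum A ?f)"
        using A by (intro joint_version_self partial_sum_measurable A2_D[OF f]) auto
      show "pair_sq (\<lambda>p. floquet_partial_sum A ?f p - g p) \<le> 2 * pair_sq (\<lambda>p. floquet_partial_sum A ?f p - h p)"
        using pair_sq_lincomb_le[OF joint_version_diff[OF r h'(1)] joint_version_diff[OF h'(1) g'(1)], of 1 1] by (simp add: hg)
    qed auto
  qed simp
qed

lemma floquet_unitary:
  "unitary_graph (A2 \<Omega>) (L2_inner \<Omega>) (Bochner_A2_eta \<omega>) (Bochner_inner \<omega>) (has_floquet_transform \<omega>)"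
  unfolding unitary_graph_def
proof (intro conjI ballI impI allI)
  fix f assume f: "f \<in> A2 \<Omega>"
  obtain g where "g \<in> Bochner_A2_eta \<omega>"
    "((\<lambda>A. pair_sq (\<lambda>p. floquet_partial_sum A f p - g p)) \<longlongrightarrow> 0) (finite_subsets_at_top gauss_lattice)"
    by (rule floquet_exists[OF f])
  then show "\<exists>g\<in>Bochner_A2_eta \<omega>. has_floquet_transform \<omega> f g" using has_floquet_iff[OF f] by blast
qed (blast intro: floquet_inverse_A2 floquet_inverse_transform, (rule floquet_lincomb floquet_inner; assumption)+)

end

theorem theorem3p4:
  fixes \<omega> \<Omega> :: "complex set"
  assumes cell: "periodic_cell \<omega>"
    and Omega: "\<Omega> = periodic_domain \<omega>"
    and A: "assumption_A \<omega>"
    and null: "negligible (\<Omega> - (\<Union>m\<in>gauss_lattice. translated_cell \<omega> m))"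
  shows "unitary_graph (A2 \<Omega>) (L2_inner \<Omega>) (Bochner_A2_eta \<omega>) (Bochner_inner \<omega>)
           (has_floquet_transform \<omega>) \<and>
         (\<forall>g \<in> Bochner_A2_eta \<omega>.
            floquet_inverse \<omega> g \<in> A2 \<Omega> \<and> has_floquet_transform \<omega> (floquet_inverse \<omega> g) g) \<and>
         (\<forall>f \<in> A2 \<Omega>. \<forall>g \<in> Bochner_A2_eta \<omega>.
            has_floquet_transform \<omega> f g \<longrightarrow> (\<forall>z\<in>\<Omega>. floquet_inverse \<omega> g z = f z))"
proof -
  interpret cell_setting \<omega>
    by unfold_locales (use cell null Omega in auto)
  show ?thesis
    unfolding Omega
  proof (intro conjI ballI impI floquet_unitary floquet_inverse_A2 floquet_inverse_transform)
    fix f g z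
    assume "f \<in> A2 (periodic_domain \<omega>)" "g \<in> Bochner_A2_eta \<omega>" "has_floquet_transform \<omega> f g" "z \<in> periodic_domain \<omega>"
    then show "floquet_inverse \<omega> g z = f z"
      using floquet_injective[OF floquet_inverse_A2 floquet_inverse_transform] by blast
  qed
qed

end
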